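(* Let $r\ge 2$ and let $C\subset L\cong\mathbb{P}^r\subseteq\mathbb{P}^{2r-1}$ be a rational normal curve of degree $r$. Let $\mu:\mathcal{O}_{\mathbb{P}^1}^{r-1}(-r-2)\oplus\mathcal{O}_{\mathbb{P}^1}^{r-1}(-r)\to\mathcal{O}_{\mathbb{P}^1}(-2)$ be a general map, where general means that the restriction $\mu_|:\mathcal{O}_{\mathbb{P}^1}^{r-1}(-r)\to\mathcal{O}_{\mathbb{P}^1}(-2)$ has no degree $0$ syzygy. Then the double structure $X$ on $C$ associated to $\mu$ (which has degree $2r$ and arithmetic genus $1$) is a non-degenerate arithmetically Gorenstein curve in $\mathbb{P}^{2r-1}$.
   Context: $K$ is an algebraically closed field of characteristic $0$, $n=2r-1$, $R=K[x_0,\dots,x_n]$, $\mathbb{P}^n=\operatorname{Proj}R$. A rational normal curve of degree $r\le n$ in $\mathbb{P}^n$ is the image of the degree $r$ Veronese embedding $\mathbb{P}^1\to\mathbb{P}^r$ followed by a linear embedding $\mathbb{P}^r\to\mathbb{P}^n$ (with image $L$). In suitable coordinates $L=V(x_{r+1},\dots,x_n)$, $C\subset L$ is defined by the $2\times 2$ minors $f_{pq}=x_{p-1}x_q-x_px_{q-1}$ ($1\le p<q\le r$) of $\begin{pmatrix} x_0 & x_1 & \cdots & x_{r-1} \\ x_1 & x_2 & \cdots & x_r \end{pmatrix}$, and $j:\mathbb{P}^1\to C$, $j(t:u)=(t^r:t^{r-1}u:\cdots:u^r:0:\cdots:0)$, is an isomorphism. The sheaf $j^*(\mathcal{I}_C/\mathcal{I}_C^2)$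 is identified with $\mathcal{O}_{\mathbb{P}^1}^{r-1}(-r-2)\oplus\mathcal{O}_{\mathbb{P}^1}^{n-r}(-r)$ so that, with $g_1,\dots,g_{r-1}$ the canonical basis of the first summand, the class of $f_{pq}$ is $\sum_{h=p}^{q-1}t^{r-h-1}u^{h-1}g_{p+q-1-h}$, and the class of $x_{r+i}$ is the $i$-th canonical basis element of the second summand. A surjective map $\mu$ to $\mathcal{O}_{\mathbb{P}^1}(-2)$ corresponds to a surjection $\mathcal{I}_C/\mathcal{I}_C^2\to\mathcal{L}=j_*\mathcal{O}_{\mathbb{P}^1}(-2)$; the associated double structure $X$ is the curve with ideal sheaf $\mathcal{I}_X$, $\mathcal{I}_C^2\subseteq\mathcal{I}_X\subseteq\mathcal{I}_C$, such that $\mathcal{I}_X/\mathcal{I}_C^2$ is the kernel of this surjection. The restriction $\mu_|$ is a row $(l_1,\dots,l_{r-1})$ of forms of degree $r-2$ in $K[t,u]$; having no degree $0$ syzygy means that $l_1,\dots,l_{r-1}$ are linearly independent over $K$ (which forces $\mu$ to be surjective). A curve $X$ is arithmetically Gorenstein if its homogeneous coordinate ring $R/I_X$ is Gorenstein; non-degenerate means not contained in a hyperplane. *)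

theory Defs
  imports
    "HOL-Library.Poly_Mapping"
    "HOL-Computational_Algebra.Polynomial"
    "HOL-Algebra.Module"
    "HOL-Algebra.QuotRing"
    "HOL-Algebra.Ring_Divisibility"
begin

section \<open>Gorenstein rings\<close>

definition mod_hom ::
    "('a, 'c) ring_scheme \<Rightarrow> ('a, 'b, 'd) module_scheme \<Rightarrow> ('a, 'e, 'f) module_scheme \<Rightarrow> ('b \<Rightarrow> 'e) set"
  where
    "mod_hom A M N = {f \<in> carrier M \<rightarrow> carrier N.
       (\<forall>x\<in>carrier M. \<forall>y\<in>carrier M. f (x \<oplus>\<^bsub>M\<^esub> y) = f x \<oplus>\<^bsub>N\<^esub> f y) \<and>
       (\<forall>a\<in>carrier A. \<forall>x\<in>carrier M. f (a \<odot>\<^bsub>M\<^esub> x) = a \<odot>\<^bsub>N\<^esub> f x)}"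

text \<open>
  The usual lifting property. HOL cannot quantify over modules of all types; the test modules
  range over those whose elements have the type of the ring elements. These include all ideals
  of the ring, so by Baer's criterion nothing is lost.
\<close>

definition injective_module :: "('a, 'c) ring_scheme \<Rightarrow> ('a, 'e, 'd) module_scheme \<Rightarrow> bool" where
  "injective_module A E \<longleftrightarrow> module A E \<and>
     (\<forall>(M :: ('a, 'a) module) (N :: ('a, 'a) module). \<forall>i f.
        module A M \<and> module A N \<and> i \<in> mod_hom A M N \<and> inj_on i (carrier M) \<and> f \<in> mod_hom A M E
        \<longrightarrow> (\<exists>g \<in> mod_hom A N E. \<forall>x\<in>carrier M. g (i x) = f x))"

text \<open>
  There is a finite injective resolution \<open>0 \<rightarrow> M \<rightarrow> E 0 \<rightarrow> E 1 \<rightarrow> \<dots> \<rightarrow> E n \<rightarrow> 0\<close>, continued by zero modules.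
  The terms are modules with elements of type \<^typ>\<open>('a \<Rightarrow> 'a) set\<close>. This is no restriction in the
  case used below, a Noetherian local ring regarded as a module over itself: if the ring is
  infinite, the terms of its minimal injective resolution have at most the cardinality of the
  ring; if it is finite, it is Artinian, and then it is self-injective as soon as its injective
  dimension is finite.
\<close>

definition finite_injective_dimension ::
    "('a, 'c) ring_scheme \<Rightarrow> ('a, 'b, 'd) module_scheme \<Rightarrow> bool"
  where
    "finite_injective_dimension A M \<longleftrightarrow>
       (\<exists>(E :: nat \<Rightarrow> ('a, ('a \<Rightarrow> 'a) set) module) e d n.
          (\<forall>i. injective_module A (E i)) \<and>
          (\<forall>i>n. carrier (E i) = {\<zero>\<^bsub>E i\<^esub>}) \<and>
          e \<in> mod_hom A M (E 0) \<and> inj_on e (carrier M) \<and>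
          (\<forall>i. d i \<in> mod_hom A (E i) (E (Suc i))) \<and>
          e ` carrier M = {x \<in> carrier (E 0). d 0 x = \<zero>\<^bsub>E 1\<^esub>} \<and>
          (\<forall>i. d i ` carrier (E i) =
             {x \<in> carrier (E (Suc i)). d (Suc i) x = \<zero>\<^bsub>E (Suc (Suc i))\<^esub>}))"

definition self_module :: "('a, 'c) ring_scheme \<Rightarrow> ('a, 'a) module" where
  "self_module A = \<lparr>carrier = carrier A, monoid.mult = mult A, one = one A,
     ring.zero = ring.zero A, add = add A, smult = mult A\<rparr>"

text \<open>The localization at a prime ideal \<open>P\<close>; a fraction \<open>a/s\<close> is its class of pairs \<open>(a, s)\<close>.\<close>

definition loc_frac :: "('a, 'c) ring_scheme \<Rightarrow> 'a set \<Rightarrow> 'a \<Rightarrow> 'a \<Rightarrow> ('a \<times> 'a) set" where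
  "loc_frac A P a s = {(b, t). b \<in> carrier A \<and> t \<in> carrier A - P \<and>
     (\<exists>u\<in>carrier A - P. u \<otimes>\<^bsub>A\<^esub> (a \<otimes>\<^bsub>A\<^esub> t) = u \<otimes>\<^bsub>A\<^esub> (b \<otimes>\<^bsub>A\<^esub> s))}"

definition localization :: "('a, 'c) ring_scheme \<Rightarrow> 'a set \<Rightarrow> ('a \<times> 'a) set ring" where
  "localization A P =
     \<lparr>carrier = {loc_frac A P a s | a s. a \<in> carrier A \<and> s \<in> carrier A - P},
      monoid.mult = (\<lambda>U V. \<Union>(a, s)\<in>U. \<Union>(b, t)\<in>V. loc_frac A P (a \<otimes>\<^bsub>A\<^esub> b) (s \<otimes>\<^bsub>A\<^esub> t)),
      one = loc_frac A P \<one>\<^bsub>A\<^esub> \<one>\<^bsub>A\<^esub>,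
      ring.zero = loc_frac A P \<zero>\<^bsub>A\<^esub> \<one>\<^bsub>A\<^esub>,
      add = (\<lambda>U V. \<Union>(a, s)\<in>U. \<Union>(b, t)\<in>V.
               loc_frac A P (a \<otimes>\<^bsub>A\<^esub> t \<oplus>\<^bsub>A\<^esub> b \<otimes>\<^bsub>A\<^esub> s) (s \<otimes>\<^bsub>A\<^esub> t))\<rparr>"

definition gorenstein_ring :: "('a, 'c) ring_scheme \<Rightarrow> bool" where
  "gorenstein_ring A \<longleftrightarrow> cring A \<and> noetherian_ring A \<and>
     (\<forall>P. primeideal P A \<longrightarrow>
        finite_injective_dimension (localization A P) (self_module (localization A P)))"


section \<open>Polynomial rings and closed subschemes of projective space\<close>

type_synonym 'k mpoly = "(nat \<Rightarrow>\<^sub>0 nat) \<Rightarrow>\<^sub>0 'k"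

definition Const :: "'k \<Rightarrow> 'k::field mpoly" where
  "Const a = Poly_Mapping.single 0 a"

definition Var :: "nat \<Rightarrow> 'k::field mpoly" where
  "Var i = Poly_Mapping.single (Poly_Mapping.single i 1) 1"

interpretation mpoly: vector_space "\<lambda>a (p :: 'k::field mpoly). Const a * p"
  by standard (simp_all add: Const_def algebra_simps single_add mult_single flip: mult.assoc)

text \<open>\<open>K[x\<^sub>0, \<dots>, x\<^sub>N\<^sub>-\<^sub>1]\<close>: the polynomials in which only the variables with index below \<open>N\<close> occur.\<close>

definition polys :: "nat \<Rightarrow> 'k::field mpoly set" where
  "polys N = {p. \<forall>m\<in>Poly_Mapping.keys p. Poly_Mapping.keys m \<subseteq> {..<N}}"

definition forms :: "nat \<Rightarrow> nat \<Rightarrow> 'k::field mpoly set" where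
  "forms N d = {p \<in> polys N. \<forall>m\<in>Poly_Mapping.keys p. (\<Sum>i\<in>Poly_Mapping.keys m. Poly_Mapping.lookup m i) = d}"

definition poly_ring :: "nat \<Rightarrow> 'k::field mpoly ring" where
  "poly_ring N = \<lparr>carrier = polys N, monoid.mult = (*), one = 1, ring.zero = 0, add = (+)\<rparr>"

definition subst :: "(nat \<Rightarrow> 'k mpoly) \<Rightarrow> 'k::field mpoly \<Rightarrow> 'k mpoly" where
  "subst c p = (\<Sum>m\<in>Poly_Mapping.keys p.
     Const (Poly_Mapping.lookup p m) * (\<Prod>i\<in>Poly_Mapping.keys m. c i ^ Poly_Mapping.lookup m i))"

text \<open>
  A closed subscheme of \<open>\<P>\<^sup>N\<^sup>-\<^sup>1\<close> is represented by its saturated homogeneous ideal. If \<open>J\<close> is a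
  homogeneous ideal, then \<open>saturation N J\<close> is the ideal of all global sections of the twists of
  the ideal sheaf associated to \<open>J\<close>.
\<close>

definition saturation :: "nat \<Rightarrow> 'k::field mpoly set \<Rightarrow> 'k mpoly set" where
  "saturation N J = {F \<in> polys N. \<exists>d. \<forall>g\<in>forms N d. g * F \<in> J}"

definition arithmetically_gorenstein :: "nat \<Rightarrow> 'k::field mpoly set \<Rightarrow> bool" where
  "arithmetically_gorenstein N I \<longleftrightarrow> gorenstein_ring (poly_ring N Quot I)"

definition nondegenerate :: "nat \<Rightarrow> 'k::field mpoly set \<Rightarrow> bool" where
  "nondegenerate N I \<longleftrightarrow> (\<forall>h\<in>forms N 1. h \<noteq> 0 \<longrightarrow> h \<notin> I)"

definition hilbert_function :: "nat \<Rightarrow> 'k::field mpoly set \<Rightarrow> nat \<Rightarrow> nat" where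
  "hilbert_function N I d =
     mpoly.dim (forms N d :: 'k mpoly set) - mpoly.dim (I \<inter> forms N d)"

definition has_hilbert_polynomial :: "nat \<Rightarrow> 'k::field mpoly set \<Rightarrow> rat poly \<Rightarrow> bool" where
  "has_hilbert_polynomial N I P \<longleftrightarrow>
     (\<exists>d0. \<forall>d\<ge>d0. poly P (of_nat d) = of_nat (hilbert_function N I d))"

definition curve_of_degree_genus :: "nat \<Rightarrow> 'k::field mpoly set \<Rightarrow> nat \<Rightarrow> int \<Rightarrow> bool" where
  "curve_of_degree_genus N I \<delta> g \<longleftrightarrow> \<delta> > 0 \<and> has_hilbert_polynomial N I [:1 - of_int g, of_nat \<delta>:]"


section \<open>Rational normal curves and their double structures\<close>

text \<open>In \<open>K[t, u]\<close>, the variable \<open>t\<close> is \<^term>\<open>Var 0\<close> and \<open>u\<close> is \<^term>\<open>Var 1\<close>.\<close>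

definition linear_embedding :: "nat \<Rightarrow> nat \<Rightarrow> (nat \<Rightarrow> nat \<Rightarrow> 'k::field) \<Rightarrow> bool" where
  "linear_embedding r N e \<longleftrightarrow>
     (\<forall>v. (\<forall>k<N. (\<Sum>i\<le>r. e k i * v i) = 0) \<longrightarrow> (\<forall>i\<le>r. v i = 0))"

text \<open>
  The \<open>k\<close>-th coordinate of the composition \<open>j\<close> of the degree \<open>r\<close> Veronese embedding
  \<open>\<P>\<^sup>1 \<rightarrow> \<P>\<^sup>r\<close> with the linear map given by the matrix \<open>e\<close>.
\<close>

definition rnc_param :: "nat \<Rightarrow> (nat \<Rightarrow> nat \<Rightarrow> 'k::field) \<Rightarrow> nat \<Rightarrow> 'k mpoly" where
  "rnc_param r e k = (\<Sum>i\<le>r. Const (e k i) * (Var 0 ^ (r - i) * Var 1 ^ i))"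

abbreviation rnc_pullback :: "nat \<Rightarrow> (nat \<Rightarrow> nat \<Rightarrow> 'k::field) \<Rightarrow> 'k mpoly \<Rightarrow> 'k mpoly" where
  "rnc_pullback r e \<equiv> subst (rnc_param r e)"

text \<open>
  Coordinates \<open>y\<^sub>0, \<dots>, y\<^sub>2\<^sub>r\<^sub>-\<^sub>1\<close> on \<open>\<P>\<^sup>2\<^sup>r\<^sup>-\<^sup>1\<close> in which \<open>j(t:u) = (t\<^sup>r : t\<^sup>r\<^sup>-\<^sup>1u : \<dots> : u\<^sup>r : 0 : \<dots> : 0)\<close>.
\<close>

definition adapted_coordinates ::
    "nat \<Rightarrow> (nat \<Rightarrow> nat \<Rightarrow> 'k::field) \<Rightarrow> (nat \<Rightarrow> 'k mpoly) \<Rightarrow> bool"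
  where
    "adapted_coordinates r e y \<longleftrightarrow>
       (\<forall>k<2*r. y k \<in> forms (2*r) 1) \<and>
       (\<forall>c. (\<Sum>k<2*r. Const (c k) * y k) = 0 \<longrightarrow> (\<forall>k<2*r. c k = 0)) \<and>
       (\<forall>k<2*r. rnc_pullback r e (y k) = (if k \<le> r then Var 0 ^ (r - k) * Var 1 ^ k else 0))"

definition rnc_minor :: "(nat \<Rightarrow> 'k::field mpoly) \<Rightarrow> nat \<Rightarrow> nat \<Rightarrow> 'k mpoly" where
  "rnc_minor y p q = y (p - 1) * y q - y p * y (q - 1)"

text \<open>
  A map \<open>\<mu>\<close> from \<open>\<O>\<^sup>r\<^sup>-\<^sup>1(-r-2) \<oplus> \<O>\<^sup>r\<^sup>-\<^sup>1(-r)\<close> to \<open>\<O>(-2)\<close> on \<open>\<P>\<^sup>1\<close> is a row of forms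
  \<open>m\<^sub>1, \<dots>, m\<^sub>r\<^sub>-\<^sub>1\<close> of degree \<open>r\<close> and \<open>l\<^sub>1, \<dots>, l\<^sub>r\<^sub>-\<^sub>1\<close> of degree \<open>r - 2\<close>, the images of the canonical
  basis elements. The following is the image under \<open>\<mu>\<close> of the class of the minor \<open>f\<^sub>p\<^sub>q\<close>, which is
  the sum of the \<open>t\<^sup>r\<^sup>-\<^sup>h\<^sup>-\<^sup>1u\<^sup>h\<^sup>-\<^sup>1g\<^sub>p\<^sub>+\<^sub>q\<^sub>-\<^sub>1\<^sub>-\<^sub>h\<close> over \<open>p \<le> h < q\<close>.
\<close>

definition mu_minor :: "nat \<Rightarrow> (nat \<Rightarrow> 'k::field mpoly) \<Rightarrow> nat \<Rightarrow> nat \<Rightarrow> 'k mpoly" where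
  "mu_minor r m p q =
     (\<Sum>h\<in>{p..<q}. Var 0 ^ (r - h - 1) * Var 1 ^ (h - 1) * m (p + q - 1 - h))"

text \<open>
  The elements of the ideal of \<open>C\<close>, written in terms of its generators \<open>f\<^sub>p\<^sub>q\<close> and \<open>y\<^sub>r\<^sub>+\<^sub>i\<close>, whose
  classes in the conormal sheaf are mapped to zero by \<open>\<mu>\<close>. The associated ideal sheaf is the kernel
  of \<open>\<I>\<^sub>C \<rightarrow> \<I>\<^sub>C/\<I>\<^sub>C\<^sup>2 \<rightarrow> j\<^sub>*\<O>(-2)\<close>; it contains \<open>\<I>\<^sub>C\<^sup>2\<close> since the pullback of \<open>\<I>\<^sub>C\<close> vanishes.
\<close>

definition conormal_kernel ::
    "nat \<Rightarrow> (nat \<Rightarrow> nat \<Rightarrow> 'k::field) \<Rightarrow> (nat \<Rightarrow> 'k mpoly) \<Rightarrow>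
     (nat \<Rightarrow> 'k mpoly) \<Rightarrow> (nat \<Rightarrow> 'k mpoly) \<Rightarrow> 'k mpoly set"
  where
    "conormal_kernel r e y m l =
       {F. \<exists>a b. (\<forall>p q. a p q \<in> polys (2*r)) \<and> (\<forall>i. b i \<in> polys (2*r)) \<and>
          F = (\<Sum>q\<in>{1..r}. \<Sum>p\<in>{1..<q}. a p q * rnc_minor y p q) + (\<Sum>i\<in>{1..<r}. b i * y (r + i)) \<and>
          (\<Sum>q\<in>{1..r}. \<Sum>p\<in>{1..<q}. rnc_pullback r e (a p q) * mu_minor r m p q) +
          (\<Sum>i\<in>{1..<r}. rnc_pullback r e (b i) * l i) = 0}"

definition double_structure ::
    "nat \<Rightarrow> (nat \<Rightarrow> nat \<Rightarrow> 'k::field) \<Rightarrow> (nat \<Rightarrow> 'k mpoly) \<Rightarrow>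
     (nat \<Rightarrow> 'k mpoly) \<Rightarrow> (nat \<Rightarrow> 'k mpoly) \<Rightarrow> 'k mpoly set"
  where
    "double_structure r e y m l = saturation (2*r) (conormal_kernel r e y m l)"

end

theory Submission
  imports Defs
begin

text \<open>
  Modulo the square of its ideal the curve moves along a vector field whose derivative of each
  equation is the prescribed value of \<open>\<mu>\<close>. Evaluating polynomials on this first order deformation
  identifies the coordinate ring \<open>A\<close> of \<open>X\<close> with an extension of the Veronese ring \<open>B\<close> of degree \<open>r\<close> by
  its canonical module \<open>\<omega> = \<Oplus> H\<^sup>0(\<O>(rd - 2))\<close>; independence of the \<open>l\<^sub>i\<close> is what makes all
  of \<open>\<omega>\<close> occur. Both \<open>B\<close> and \<open>\<omega>\<close> are free over \<open>T = K[t\<^sup>r, u\<^sup>r]\<close>, so \<open>A\<close> is free over \<open>T\<close> with \<open>1\<close> generator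
  in degree \<open>0\<close>, \<open>2r - 2\<close> in degree \<open>1\<close> and \<open>1\<close> in degree \<open>2\<close>, and the coefficient of the last
  one defines a perfect pairing \<open>A \<times> A \<rightarrow> T\<close>.

  Hence \<open>A \<cong> Hom\<^sub>T(A, T)\<close>. Applying \<open>Hom\<^sub>T(A, -)\<close> to the resolution of \<open>T\<close> by modules
  coinduced from \<open>K\<close> gives an injective resolution \<open>0 \<rightarrow> A \<rightarrow> E \<rightarrow> E\<^sup>2 \<rightarrow> E \<rightarrow> 0\<close> with
  \<open>E = Hom\<^sub>K(A, T)\<close>. Since \<open>A\<close> is Noetherian, its localizations are injective resolutions of the
  local rings of \<open>A\<close>.
\<close>

section \<open>Baer's criterion\<close>

text \<open>Gorensteinness is demanded at every prime, graded or not. One resolution over the whole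
  ring settles all primes at once, without dimension or depth; its length 2 comes from the two
  variables of \<open>T\<close>. The price is two general facts, Baer's criterion and the
  localization of injectives over a Noetherian ring.

  The kernel defining \<open>X\<close> refers to chosen expressions of a polynomial in the
  generators of the ideal of the curve. A derivation \<open>\<delta>\<close> along the curve removes
  this choice: on that ideal it is \<open>t^r\<close> times \<open>\<mu>\<close>, whatever the
  expression. The ideal of \<open>X\<close> is then the common kernel of the pullback and
  \<open>\<delta>\<close>, and visibly saturated.

  The generators over \<open>T\<close> come from monomials: \<open>1\<close> and
  \<open>t^(r-k) u^k\<close> with \<open>0 < k < r\<close> for \<open>B\<close>, and for
  \<open>\<omega>\<close> the \<open>t^\<rho> u^\<sigma>\<close> with
  \<open>\<rho> + \<sigma> = r - 2\<close> together with \<open>t^(r-1) u^(r-1)\<close>. The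
  coefficient of the last one acts as a residue, under which the two lists are dual. The
  \<open>r - 1\<close> independent forms \<open>l i\<close> are a basis of the forms of degree
  \<open>r - 2\<close>, so the first \<open>r - 1\<close> generators of \<open>\<omega>\<close> lift
  to linear forms.\<close>

definition baer_injective :: "('a, 'c) ring_scheme \<Rightarrow> ('a, 'e, 'd) module_scheme \<Rightarrow> bool" where
  "baer_injective A E \<longleftrightarrow> module A E \<and>
     (\<forall>J h. ideal J A \<and> h \<in> J \<rightarrow> carrier E \<and>
        (\<forall>x\<in>J. \<forall>y\<in>J. h (x \<oplus>\<^bsub>A\<^esub> y) = h x \<oplus>\<^bsub>E\<^esub> h y) \<and>
        (\<forall>a\<in>carrier A. \<forall>x\<in>J. h (a \<otimes>\<^bsub>A\<^esub> x) = a \<odot>\<^bsub>E\<^esub> h x)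
        \<longrightarrow> (\<exists>\<xi>\<in>carrier E. \<forall>x\<in>J. h x = x \<odot>\<^bsub>E\<^esub> \<xi>))"

lemma baer_injectiveE:
  assumes "baer_injective A E" "ideal J A" "\<And>x. x \<in> J \<Longrightarrow> h x \<in> carrier E"
    "\<And>x y. x \<in> J \<Longrightarrow> y \<in> J \<Longrightarrow> h (x \<oplus>\<^bsub>A\<^esub> y) = h x \<oplus>\<^bsub>E\<^esub> h y"
    "\<And>a x. a \<in> carrier A \<Longrightarrow> x \<in> J \<Longrightarrow> h (a \<otimes>\<^bsub>A\<^esub> x) = a \<odot>\<^bsub>E\<^esub> h x"
  obtains \<xi> where "\<xi> \<in> carrier E" "\<And>x. x \<in> J \<Longrightarrow> h x = x \<odot>\<^bsub>E\<^esub> \<xi>"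
proof -
  have "\<exists>\<xi>\<in>carrier E. \<forall>x\<in>J. h x = x \<odot>\<^bsub>E\<^esub> \<xi>"
    using assms(1) unfolding baer_injective_def by (auto simp: assms(2-))
  then show ?thesis using that by blast
qed

lemma baer_injectiveI:
  assumes "module A E"
    and "\<And>J h. \<lbrakk>ideal J A; \<And>x. x \<in> J \<Longrightarrow> h x \<in> carrier E;
      \<And>x y. x \<in> J \<Longrightarrow> y \<in> J \<Longrightarrow> h (x \<oplus>\<^bsub>A\<^esub> y) = h x \<oplus>\<^bsub>E\<^esub> h y;
      \<And>a x. a \<in> carrier A \<Longrightarrow> x \<in> J \<Longrightarrow> h (a \<otimes>\<^bsub>A\<^esub> x) = a \<odot>\<^bsub>E\<^esub> h x\<rbrakk>
      \<Longrightarrow> \<exists>\<xi>\<in>carrier E. \<forall>x\<in>J. h x = x \<odot>\<^bsub>E\<^esub> \<xi>"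
  shows "baer_injective A E"
  unfolding baer_injective_def using assms(1) by (auto intro!: assms(2) simp: Pi_def)

lemma (in cring) ideal_if_closed:
  assumes "J \<subseteq> carrier R" "\<zero> \<in> J" "\<And>x y. x \<in> J \<Longrightarrow> y \<in> J \<Longrightarrow> x \<oplus> y \<in> J"
    "\<And>a x. a \<in> carrier R \<Longrightarrow> x \<in> J \<Longrightarrow> a \<otimes> x \<in> J"
  shows "ideal J R"
proof (rule idealI)
  show "ring R" by unfold_locales
  show "subgroup J (add_monoid R)"
  proof (rule add.subgroupI)
    show "J \<subseteq> carrier R" by fact
    show "J \<noteq> {}" using assms(2) by auto
    show "\<ominus> x \<in> J" if "x \<in> J" for x
    proof -
      have "\<ominus> x = (\<ominus> \<one>) \<otimes> x" using that assms(1) l_minus by auto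
      then show ?thesis using assms(4)[of "\<ominus> \<one>" x] that by simp
    qed
    show "x \<oplus> y \<in> J" if "x \<in> J" "y \<in> J" for x y using assms(3) that by auto
  qed
  show "a \<otimes> x \<in> J" if "x \<in> J" "a \<in> carrier R" for x a using assms(4) that by auto
  show "x \<otimes> a \<in> J" if "x \<in> J" "a \<in> carrier R" for x a
    using assms(4)[OF that(2,1)] m_comm[of x a] that assms(1) by auto
qed

lemma mod_homD:
  assumes "f \<in> mod_hom A M N"
  shows "\<And>x. x \<in> carrier M \<Longrightarrow> f x \<in> carrier N"
    and "\<And>x y. x \<in> carrier M \<Longrightarrow> y \<in> carrier M \<Longrightarrow> f (x \<oplus>\<^bsub>M\<^esub> y) = f x \<oplus>\<^bsub>N\<^esub> f y"
    and "\<And>a x. a \<in> carrier A \<Longrightarrow> x \<in> carrier M \<Longrightarrow> f (a \<odot>\<^bsub>M\<^esub> x) = a \<odot>\<^bsub>N\<^esub> f x"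
  using assms unfolding mod_hom_def by auto

lemma mod_hom_zero:
  assumes "f \<in> mod_hom A M N" "module A M" "module A N"
  shows "f \<zero>\<^bsub>M\<^esub> = \<zero>\<^bsub>N\<^esub>"
proof -
  interpret M: module A M by fact
  interpret N: module A N by fact
  have "f \<zero>\<^bsub>M\<^esub> = f (\<zero>\<^bsub>A\<^esub> \<odot>\<^bsub>M\<^esub> \<zero>\<^bsub>M\<^esub>)" by simp
  also have "\<dots> = \<zero>\<^bsub>A\<^esub> \<odot>\<^bsub>N\<^esub> f \<zero>\<^bsub>M\<^esub>"
    by (rule mod_homD(3)[OF assms(1)]) simp_all
  also have "\<dots> = \<zero>\<^bsub>N\<^esub>" by (simp add: mod_homD(1)[OF assms(1)])
  finally show ?thesis .
qed

text \<open>The set \<open>B\<close> is the graph of the map to be extended and \<open>G\<close> the graph of an extension to a submodule.\<close>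

definition partial_extension ::
    "('a, 'c) ring_scheme \<Rightarrow> ('a, 'n, 'd) module_scheme \<Rightarrow> ('a, 'e, 'f) module_scheme \<Rightarrow>
     ('n \<times> 'e) set \<Rightarrow> ('n \<times> 'e) set \<Rightarrow> bool" where
  "partial_extension A N E B G \<longleftrightarrow> G \<subseteq> carrier N \<times> carrier E \<and> B \<subseteq> G \<and>
     (\<forall>(x, v)\<in>G. \<forall>(y, w)\<in>G. (x \<oplus>\<^bsub>N\<^esub> y, v \<oplus>\<^bsub>E\<^esub> w) \<in> G) \<and>
     (\<forall>a\<in>carrier A. \<forall>(x, v)\<in>G. (a \<odot>\<^bsub>N\<^esub> x, a \<odot>\<^bsub>E\<^esub> v) \<in> G) \<and>
     (\<forall>v. (\<zero>\<^bsub>N\<^esub>, v) \<in> G \<longrightarrow> v = \<zero>\<^bsub>E\<^esub>)"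

lemma partial_extensionD:
  assumes "partial_extension A N E B G"
  shows "\<And>x v. (x, v) \<in> G \<Longrightarrow> x \<in> carrier N" "\<And>x v. (x, v) \<in> G \<Longrightarrow> v \<in> carrier E"
    "\<And>x v. (x, v) \<in> B \<Longrightarrow> (x, v) \<in> G"
    "\<And>x v y w. (x, v) \<in> G \<Longrightarrow> (y, w) \<in> G \<Longrightarrow> (x \<oplus>\<^bsub>N\<^esub> y, v \<oplus>\<^bsub>E\<^esub> w) \<in> G"
    "\<And>a x v. a \<in> carrier A \<Longrightarrow> (x, v) \<in> G \<Longrightarrow> (a \<odot>\<^bsub>N\<^esub> x, a \<odot>\<^bsub>E\<^esub> v) \<in> G"
    "\<And>v. (\<zero>\<^bsub>N\<^esub>, v) \<in> G \<Longrightarrow> v = \<zero>\<^bsub>E\<^esub>"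
  using assms unfolding partial_extension_def by blast+

lemma partial_extension_diff:
  assumes "module A N" "module A E" "partial_extension A N E B G" "(x, v) \<in> G" "(y, w) \<in> G"
  shows "(x \<ominus>\<^bsub>N\<^esub> y, v \<ominus>\<^bsub>E\<^esub> w) \<in> G"
proof -
  interpret N: module A N by fact
  interpret E: module A E by fact
  note D = partial_extensionD[OF assms(3)]
  have "(\<ominus>\<^bsub>A\<^esub> \<one>\<^bsub>A\<^esub> \<odot>\<^bsub>N\<^esub> y, \<ominus>\<^bsub>A\<^esub> \<one>\<^bsub>A\<^esub> \<odot>\<^bsub>E\<^esub> w) \<in> G"
    by (rule D(5)) (use assms(5) in auto)
  then have "(\<ominus>\<^bsub>N\<^esub> y, \<ominus>\<^bsub>E\<^esub> w) \<in> G"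
    using D(1)[OF assms(5)] D(2)[OF assms(5)] by (simp add: N.smult_l_minus E.smult_l_minus)
  from D(4)[OF assms(4) this] show ?thesis by (simp add: a_minus_def)
qed

lemma partial_extension_unique:
  assumes "module A N" "module A E" "partial_extension A N E B G" "(x, v) \<in> G" "(x, w) \<in> G"
  shows "v = w"
proof -
  interpret N: module A N by fact
  interpret E: module A E by fact
  note D = partial_extensionD[OF assms(3)]
  have "(x \<ominus>\<^bsub>N\<^esub> x, v \<ominus>\<^bsub>E\<^esub> w) \<in> G" by (rule partial_extension_diff) fact+
  then have "v \<ominus>\<^bsub>E\<^esub> w = \<zero>\<^bsub>E\<^esub>" using D(1)[OF assms(4)] D(6) by (simp add: N.r_neg a_minus_def)
  then show ?thesis using D(2)[OF assms(4)] D(2)[OF assms(5)] 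
    by (metis E.M.minus_equality E.M.minus_minus E.M.minus_eq E.M.add.inv_closed)
qed

text \<open>The multipliers carrying \<open>n\<close> into the domain of \<open>G\<close> form an
  ideal \<open>J\<close>, and \<open>G\<close> read on the multiples of \<open>n\<close> is a
  homomorphism from \<open>J\<close> to \<open>E\<close>. Baer's condition writes it as
  multiplication by some \<open>\<xi>\<close>, which is a consistent value at
  \<open>n\<close>.\<close>

lemma partial_extension_step:
  assumes "baer_injective A E" "module A N" "partial_extension A N E B G" "n \<in> carrier N"
  shows "\<exists>G' \<xi>. partial_extension A N E B G' \<and> G \<subseteq> G' \<and> (n, \<xi>) \<in> G'"
proof -
  have mE: "module A E" using assms(1) by (simp add: baer_injective_def)
  interpret N: module A N by fact
  interpret E: module A E by fact
  note D = partial_extensionD[OF assms(3)]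
  note uniq = partial_extension_unique[OF assms(2) mE assms(3)]
  define J where "J = {a \<in> carrier A. \<exists>v. (a \<odot>\<^bsub>N\<^esub> n, v) \<in> G}"
  define h where "h a = (THE v. (a \<odot>\<^bsub>N\<^esub> n, v) \<in> G)" for a
  have h: "h a = v" if "(a \<odot>\<^bsub>N\<^esub> n, v) \<in> G" for a v
    unfolding h_def using that uniq by (intro the_equality) auto
  have hG: "(a \<odot>\<^bsub>N\<^esub> n, h a) \<in> G" if "a \<in> J" for a
    using that h unfolding J_def by auto
  have JA: "a \<in> carrier A" if "a \<in> J" for a using that by (simp add: J_def)
  have hadd: "(x \<oplus>\<^bsub>A\<^esub> y) \<in> J \<and> h (x \<oplus>\<^bsub>A\<^esub> y) = h x \<oplus>\<^bsub>E\<^esub> h y" if "x \<in> J" "y \<in> J" for x y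
  proof -
    have "((x \<oplus>\<^bsub>A\<^esub> y) \<odot>\<^bsub>N\<^esub> n, h x \<oplus>\<^bsub>E\<^esub> h y) \<in> G"
      using D(4)[OF hG hG] that assms(4) by (simp add: N.smult_l_distr JA)
    then show ?thesis using h JA that by (auto simp: J_def)
  qed
  have hmult: "(a \<otimes>\<^bsub>A\<^esub> x) \<in> J \<and> h (a \<otimes>\<^bsub>A\<^esub> x) = a \<odot>\<^bsub>E\<^esub> h x" if "x \<in> J" "a \<in> carrier A" for a x
  proof -
    have "((a \<otimes>\<^bsub>A\<^esub> x) \<odot>\<^bsub>N\<^esub> n, a \<odot>\<^bsub>E\<^esub> h x) \<in> G"
      using D(5)[OF that(2) hG[OF that(1)]] that assms(4) by (simp add: N.smult_assoc1 JA)
    then show ?thesis using h JA that by (auto simp: J_def)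
  qed
  have "\<exists>\<xi>\<in>carrier E. \<forall>x\<in>J. h x = x \<odot>\<^bsub>E\<^esub> \<xi>"
  \<comment> \<open>The relation \<open>G\<close> may be empty when \<open>B\<close> is; then it
    contains no zero pair, and \<open>J\<close> is the empty set rather than an ideal.\<close>
  proof (cases "G = {}")
    case True
    then have "J = {}" by (auto simp: J_def)
    then show ?thesis by auto
  next
    case False
    then obtain x v where "(x, v) \<in> G" by auto
    then have "(\<zero>\<^bsub>A\<^esub> \<odot>\<^bsub>N\<^esub> n, \<zero>\<^bsub>E\<^esub>) \<in> G"
      using D(5)[of "\<zero>\<^bsub>A\<^esub>" x v] D(1,2) assms(4) by auto
    then have "\<zero>\<^bsub>A\<^esub> \<in> J" by (auto simp: J_def)
    then have "ideal J A"
      using hadd hmult by (intro N.ideal_if_closed) (auto simp: JA)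
    moreover have "h \<in> J \<rightarrow> carrier E" using hG D(2) by blast
    ultimately show ?thesis
      using assms(1) hadd hmult unfolding baer_injective_def by blast
  qed
  then obtain \<xi> where \<xi>: "\<xi> \<in> carrier E" and h\<xi>: "\<And>x. x \<in> J \<Longrightarrow> h x = x \<odot>\<^bsub>E\<^esub> \<xi>" by auto
  show ?thesis
  proof (cases "G = {}")
    case True
    have "partial_extension A N E B {(a \<odot>\<^bsub>N\<^esub> n, \<zero>\<^bsub>E\<^esub>) | a. a \<in> carrier A}"
      unfolding partial_extension_def
    proof (intro conjI)
      show "\<forall>(x, v)\<in>{(a \<odot>\<^bsub>N\<^esub> n, \<zero>\<^bsub>E\<^esub>) |a. a \<in> carrier A}.
       \<forall>(y, w)\<in>{(a \<odot>\<^bsub>N\<^esub> n, \<zero>\<^bsub>E\<^esub>) |a. a \<in> carrier A}.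
          (x \<oplus>\<^bsub>N\<^esub> y, v \<oplus>\<^bsub>E\<^esub> w) \<in> {(a \<odot>\<^bsub>N\<^esub> n, \<zero>\<^bsub>E\<^esub>) |a. a \<in> carrier A}"
        using assms(4) by (force simp flip: N.smult_l_distr)
      show "\<forall>a\<in>carrier A. \<forall>(x, v)\<in>{(a \<odot>\<^bsub>N\<^esub> n, \<zero>\<^bsub>E\<^esub>) |a. a \<in> carrier A}.
          (a \<odot>\<^bsub>N\<^esub> x, a \<odot>\<^bsub>E\<^esub> v) \<in> {(a \<odot>\<^bsub>N\<^esub> n, \<zero>\<^bsub>E\<^esub>) |a. a \<in> carrier A}"
        using assms(4) by (force simp flip: N.smult_assoc1)
    qed (use True assms(4) D(3) in auto)
    moreover have "(n, \<zero>\<^bsub>E\<^esub>) \<in> {(a \<odot>\<^bsub>N\<^esub> n, \<zero>\<^bsub>E\<^esub>) | a. a \<in> carrier A}"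
      using assms(4) N.smult_one[of n] by (metis (mono_tags, lifting) N.R.one_closed mem_Collect_eq)
    ultimately show ?thesis using True by blast
  next
    case False
    then obtain x0 v0 where "(x0, v0) \<in> G" by auto
    then have zG: "(\<zero>\<^bsub>N\<^esub>, \<zero>\<^bsub>E\<^esub>) \<in> G"
      using D(5)[of "\<zero>\<^bsub>A\<^esub>" x0 v0] D(1,2) by auto
    define G' where "G' = {(x \<oplus>\<^bsub>N\<^esub> a \<odot>\<^bsub>N\<^esub> n, v \<oplus>\<^bsub>E\<^esub> a \<odot>\<^bsub>E\<^esub> \<xi>) | x v a. (x, v) \<in> G \<and> a \<in> carrier A}"
    have G'I: "(x \<oplus>\<^bsub>N\<^esub> a \<odot>\<^bsub>N\<^esub> n, v \<oplus>\<^bsub>E\<^esub> a \<odot>\<^bsub>E\<^esub> \<xi>) \<in> G'" if "(x, v) \<in> G" "a \<in> carrier A" for x v a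
      unfolding G'_def using that by blast
    have sub: "G \<subseteq> G'"
    proof
      fix p assume p: "p \<in> G"
      obtain x v where [simp]: "p = (x, v)" by (cases p)
      show "p \<in> G'" using G'I[of x v "\<zero>\<^bsub>A\<^esub>"] p D(1,2) assms(4) \<xi> by simp
    qed
    have "partial_extension A N E B G'"
      unfolding partial_extension_def
    proof (intro conjI)
      show "G' \<subseteq> carrier N \<times> carrier E" using D(1,2) assms(4) \<xi> by (auto simp: G'_def)
      show "B \<subseteq> G'" using sub D(3) by auto
      show "\<forall>(x, v)\<in>G'. \<forall>(y, w)\<in>G'. (x \<oplus>\<^bsub>N\<^esub> y, v \<oplus>\<^bsub>E\<^esub> w) \<in> G'"
      proof (clarify)
        fix x v y w assume "(x, v) \<in> G'" "(y, w) \<in> G'"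
        then obtain x' v' a y' w' b where
          *: "x = x' \<oplus>\<^bsub>N\<^esub> a \<odot>\<^bsub>N\<^esub> n" "v = v' \<oplus>\<^bsub>E\<^esub> a \<odot>\<^bsub>E\<^esub> \<xi>" "(x', v') \<in> G" "a \<in> carrier A"
          "y = y' \<oplus>\<^bsub>N\<^esub> b \<odot>\<^bsub>N\<^esub> n" "w = w' \<oplus>\<^bsub>E\<^esub> b \<odot>\<^bsub>E\<^esub> \<xi>" "(y', w') \<in> G" "b \<in> carrier A"
          by (auto simp: G'_def)
        have "x' \<in> carrier N" "y' \<in> carrier N" "v' \<in> carrier E" "w' \<in> carrier E" using D(1,2) * by blast+
        then have "x \<oplus>\<^bsub>N\<^esub> y = (x' \<oplus>\<^bsub>N\<^esub> y') \<oplus>\<^bsub>N\<^esub> (a \<oplus>\<^bsub>A\<^esub> b) \<odot>\<^bsub>N\<^esub> n"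
          "v \<oplus>\<^bsub>E\<^esub> w = (v' \<oplus>\<^bsub>E\<^esub> w') \<oplus>\<^bsub>E\<^esub> (a \<oplus>\<^bsub>A\<^esub> b) \<odot>\<^bsub>E\<^esub> \<xi>"
          using * assms(4) \<xi> by (simp_all add: N.smult_l_distr E.smult_l_distr N.M.a_ac E.M.a_ac)
        then show "(x \<oplus>\<^bsub>N\<^esub> y, v \<oplus>\<^bsub>E\<^esub> w) \<in> G'"
          using G'I[OF D(4)[OF *(3,7)], of "a \<oplus>\<^bsub>A\<^esub> b"] * by simp
      qed
      show "\<forall>c\<in>carrier A. \<forall>(x, v)\<in>G'. (c \<odot>\<^bsub>N\<^esub> x, c \<odot>\<^bsub>E\<^esub> v) \<in> G'"
      proof (clarify)
        fix c x v assume c: "c \<in> carrier A" and "(x, v) \<in> G'"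
        then obtain x' v' a where
          *: "x = x' \<oplus>\<^bsub>N\<^esub> a \<odot>\<^bsub>N\<^esub> n" "v = v' \<oplus>\<^bsub>E\<^esub> a \<odot>\<^bsub>E\<^esub> \<xi>" "(x', v') \<in> G" "a \<in> carrier A"
          by (auto simp: G'_def)
        have "x' \<in> carrier N" "v' \<in> carrier E" using D(1,2) * by blast+
        then have "c \<odot>\<^bsub>N\<^esub> x = c \<odot>\<^bsub>N\<^esub> x' \<oplus>\<^bsub>N\<^esub> (c \<otimes>\<^bsub>A\<^esub> a) \<odot>\<^bsub>N\<^esub> n"
          "c \<odot>\<^bsub>E\<^esub> v = c \<odot>\<^bsub>E\<^esub> v' \<oplus>\<^bsub>E\<^esub> (c \<otimes>\<^bsub>A\<^esub> a) \<odot>\<^bsub>E\<^esub> \<xi>"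
          using * assms(4) \<xi> c by (simp_all add: N.smult_r_distr E.smult_r_distr N.smult_assoc1 E.smult_assoc1)
        then show "(c \<odot>\<^bsub>N\<^esub> x, c \<odot>\<^bsub>E\<^esub> v) \<in> G'"
          using G'I[OF D(5)[OF c *(3)], of "c \<otimes>\<^bsub>A\<^esub> a"] * c by simp
      qed
      \<comment> \<open>Single-valuedness: a relation \<open>x' + a n = 0\<close> puts
        \<open>a\<close> into \<open>J\<close> with \<open>h a = - v'\<close>, and
        \<open>h a = a \<xi>\<close> then cancels \<open>v'\<close>.\<close>
      show "\<forall>v. (\<zero>\<^bsub>N\<^esub>, v) \<in> G' \<longrightarrow> v = \<zero>\<^bsub>E\<^esub>"
      proof (intro allI impI)
        fix v assume "(\<zero>\<^bsub>N\<^esub>, v) \<in> G'"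
        then obtain x' v' a where
          *: "\<zero>\<^bsub>N\<^esub> = x' \<oplus>\<^bsub>N\<^esub> a \<odot>\<^bsub>N\<^esub> n" "v = v' \<oplus>\<^bsub>E\<^esub> a \<odot>\<^bsub>E\<^esub> \<xi>" "(x', v') \<in> G" "a \<in> carrier A"
          by (auto simp: G'_def)
        have c: "x' \<in> carrier N" "v' \<in> carrier E" using D(1,2) * by blast+
        have "a \<odot>\<^bsub>N\<^esub> n = \<zero>\<^bsub>N\<^esub> \<ominus>\<^bsub>N\<^esub> x'"
          using *(1,4) c assms(4) N.M.minus_equality[of "a \<odot>\<^bsub>N\<^esub> n" x']
          by (simp add: N.M.a_comm a_minus_def)
        moreover have "(\<zero>\<^bsub>N\<^esub> \<ominus>\<^bsub>N\<^esub> x', \<zero>\<^bsub>E\<^esub> \<ominus>\<^bsub>E\<^esub> v') \<in> G"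
          by (rule partial_extension_diff[OF assms(2) mE assms(3) zG *(3)])
        ultimately have "(a \<odot>\<^bsub>N\<^esub> n, \<ominus>\<^bsub>E\<^esub> v') \<in> G" using c by (simp add: a_minus_def)
        then have "a \<in> J" "h a = \<ominus>\<^bsub>E\<^esub> v'" using h *(4) by (auto simp: J_def)
        then have "a \<odot>\<^bsub>E\<^esub> \<xi> = \<ominus>\<^bsub>E\<^esub> v'" using h\<xi> by simp
        then show "v = \<zero>\<^bsub>E\<^esub>" using * c by (simp add: E.M.r_neg)
      qed
    qed
    moreover have "(n, \<xi>) \<in> G'" using G'I[OF zG, of "\<one>\<^bsub>A\<^esub>"] assms(4) \<xi> by simp
    ultimately show ?thesis using sub by blast
  qed
qed

text \<open>Zorn's lemma for graphs of partial extensions ordered by inclusion, where the union of a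
  chain is an upper bound. Injectivity of \<open>i\<close> makes the initial graph single-valued,
  and by the one-element step a maximal graph has all of \<open>N\<close> as its domain.\<close>

proposition baer_criterion:
  assumes "baer_injective A E"
  shows "injective_module A E"
  unfolding injective_module_def
proof (intro conjI allI impI; (elim conjE)?)
  show mE: "module A E" using assms by (simp add: baer_injective_def)
  fix M N :: "('a, 'a) module" and i f
  assume mM: "module A M" and mN: "module A N" and i: "i \<in> mod_hom A M N"
    and inj: "inj_on i (carrier M)" and f: "f \<in> mod_hom A M E"
  interpret M: module A M by fact
  interpret N: module A N by fact
  interpret E: module A E by fact
  define B where "B = {(i x, f x) | x. x \<in> carrier M}"
  note iD = mod_homD[OF i] and fD = mod_homD[OF f]
  have B: "partial_extension A N E B B"
    unfolding partial_extension_def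
  proof (intro conjI)
    show "B \<subseteq> carrier N \<times> carrier E" using iD fD by (auto simp: B_def)
    show "\<forall>(x, v)\<in>B. \<forall>(y, w)\<in>B. (x \<oplus>\<^bsub>N\<^esub> y, v \<oplus>\<^bsub>E\<^esub> w) \<in> B"
      unfolding B_def by (clarify, metis iD(2) fD(2) M.M.add.m_closed)
    show "\<forall>a\<in>carrier A. \<forall>(x, v)\<in>B. (a \<odot>\<^bsub>N\<^esub> x, a \<odot>\<^bsub>E\<^esub> v) \<in> B"
      unfolding B_def by (clarify, metis iD(3) fD(3) M.smult_closed)
    show "\<forall>v. (\<zero>\<^bsub>N\<^esub>, v) \<in> B \<longrightarrow> v = \<zero>\<^bsub>E\<^esub>"
    proof (intro allI impI)
      fix v assume "(\<zero>\<^bsub>N\<^esub>, v) \<in> B"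
      then obtain x where x: "x \<in> carrier M" "\<zero>\<^bsub>N\<^esub> = i x" "v = f x" by (auto simp: B_def)
      then have "x = \<zero>\<^bsub>M\<^esub>" using inj mod_hom_zero[OF i mM mN] by (auto simp: inj_on_def)
      then show "v = \<zero>\<^bsub>E\<^esub>" using x mod_hom_zero[OF f mM mE] by simp
    qed
  qed simp
  have "\<exists>G\<in>{G. partial_extension A N E B G}. \<forall>X\<in>{G. partial_extension A N E B G}. G \<subseteq> X \<longrightarrow> X = G"
  proof (rule subset_Zorn_nonempty)
    show "{G. partial_extension A N E B G} \<noteq> {}" using B by auto
    fix \<C> assume ne: "\<C> \<noteq> {}" and ch: "subset.chain {G. partial_extension A N E B G} \<C>"
    have P: "partial_extension A N E B G" if "G \<in> \<C>" for G
      using ch that by (auto simp: subset_chain_def)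
    have lin: "X \<subseteq> Y \<or> Y \<subseteq> X" if "X \<in> \<C>" "Y \<in> \<C>" for X Y
      using ch that by (auto simp: subset_chain_def)
    have "partial_extension A N E B (\<Union>\<C>)"
      unfolding partial_extension_def
    proof (intro conjI)
      show "\<Union>\<C> \<subseteq> carrier N \<times> carrier E" using P partial_extensionD(1,2) by fast
      show "B \<subseteq> \<Union>\<C>" using ne P by (fastforce simp: partial_extension_def)
      show "\<forall>(x, v)\<in>\<Union>\<C>. \<forall>(y, w)\<in>\<Union>\<C>. (x \<oplus>\<^bsub>N\<^esub> y, v \<oplus>\<^bsub>E\<^esub> w) \<in> \<Union>\<C>"
      proof clarify
        fix x v y w X Y assume "(x, v) \<in> X" "X \<in> \<C>" "(y, w) \<in> Y" "Y \<in> \<C>"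
        then show "(x \<oplus>\<^bsub>N\<^esub> y, v \<oplus>\<^bsub>E\<^esub> w) \<in> \<Union>\<C>"
          using lin[of X Y] partial_extensionD(4)[OF P, of X] partial_extensionD(4)[OF P, of Y] by blast
      qed
      show "\<forall>a\<in>carrier A. \<forall>(x, v)\<in>\<Union>\<C>. (a \<odot>\<^bsub>N\<^esub> x, a \<odot>\<^bsub>E\<^esub> v) \<in> \<Union>\<C>"
        using partial_extensionD(5)[OF P] by blast
      show "\<forall>v. (\<zero>\<^bsub>N\<^esub>, v) \<in> \<Union>\<C> \<longrightarrow> v = \<zero>\<^bsub>E\<^esub>" using partial_extensionD(6)[OF P] by blast
    qed
    then show "\<Union>\<C> \<in> {G. partial_extension A N E B G}" by simp
  qed
  then obtain G where G: "partial_extension A N E B G"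
    and max: "\<And>X. partial_extension A N E B X \<Longrightarrow> G \<subseteq> X \<Longrightarrow> X = G" by auto
  note uniq = partial_extension_unique[OF mN mE G]
  note D = partial_extensionD[OF G]
  define g where "g n = (THE v. (n, v) \<in> G)" for n
  have gI: "g n = v" if "(n, v) \<in> G" for n v
    unfolding g_def using that uniq by (intro the_equality) auto
  have gG: "(n, g n) \<in> G" if n: "n \<in> carrier N" for n
  proof -
    obtain G' \<xi> where "partial_extension A N E B G'" "G \<subseteq> G'" "(n, \<xi>) \<in> G'"
      using partial_extension_step[OF assms mN G n] by blast
    with max[of G'] have "(n, \<xi>) \<in> G" by simp
    then show ?thesis using gI by simp
  qed
  have "g \<in> mod_hom A N E"
    unfolding mod_hom_def using D(2)[OF gG] gI[OF D(4)[OF gG gG]] gI[OF D(5)[OF _ gG]] by auto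
  moreover have "\<forall>x\<in>carrier M. g (i x) = f x"
    by (intro ballI gI D(3)) (auto simp: B_def)
  ultimately show "\<exists>g\<in>mod_hom A N E. \<forall>x\<in>carrier M. g (i x) = f x" by blast
qed

section \<open>Localization of modules\<close>

text \<open>A fraction is its set of pairs, as in \<open>loc_frac\<close>, so that over
  \<open>self_module\<close> the two notions coincide and well-definedness is settled once, for
  modules.\<close>

definition mfrac :: "('a, 'c) ring_scheme \<Rightarrow> ('a, 'e, 'd) module_scheme \<Rightarrow> 'a set \<Rightarrow> 'e \<Rightarrow> 'a \<Rightarrow> ('e \<times> 'a) set" where
  "mfrac A M P e s = {(e', s'). e' \<in> carrier M \<and> s' \<in> carrier A - P \<and>
     (\<exists>u\<in>carrier A - P. u \<odot>\<^bsub>M\<^esub> (s' \<odot>\<^bsub>M\<^esub> e) = u \<odot>\<^bsub>M\<^esub> (s \<odot>\<^bsub>M\<^esub> e'))}"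

definition loc_module :: "('a, 'c) ring_scheme \<Rightarrow> 'a set \<Rightarrow> ('a, 'e, 'd) module_scheme \<Rightarrow> (('a \<times> 'a) set, ('e \<times> 'a) set) module" where
  "loc_module A P M =
     \<lparr>carrier = {mfrac A M P e s | e s. e \<in> carrier M \<and> s \<in> carrier A - P},
      monoid.mult = undefined, one = undefined,
      ring.zero = mfrac A M P \<zero>\<^bsub>M\<^esub> \<one>\<^bsub>A\<^esub>,
      add = (\<lambda>U V. \<Union>(e, s)\<in>U. \<Union>(e', t)\<in>V.
               mfrac A M P (t \<odot>\<^bsub>M\<^esub> e \<oplus>\<^bsub>M\<^esub> s \<odot>\<^bsub>M\<^esub> e') (s \<otimes>\<^bsub>A\<^esub> t)),
      smult = (\<lambda>U V. \<Union>(a, s)\<in>U. \<Union>(e, t)\<in>V. mfrac A M P (a \<odot>\<^bsub>M\<^esub> e) (s \<otimes>\<^bsub>A\<^esub> t))\<rparr>"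

definition loc_map :: "('a, 'c) ring_scheme \<Rightarrow> 'a set \<Rightarrow> ('a, 'f, 'd) module_scheme \<Rightarrow> ('e \<Rightarrow> 'f) \<Rightarrow> ('e \<times> 'a) set \<Rightarrow> ('f \<times> 'a) set" where
  "loc_map A P N f U = (\<Union>(e, s)\<in>U. mfrac A N P (f e) s)"

text \<open>Operations on classes are unions over all representatives. If every representative
  yields the same class \<open>X\<close>, the union is \<open>X\<close>; the member \<open>p\<close>
  guards against an empty union.\<close>

lemma UN_pair_const:
  assumes "p \<in> U" "\<And>a b. (a, b) \<in> U \<Longrightarrow> F a b = X"
  shows "(\<Union>(a, b)\<in>U. F a b) = X"
proof -
  have "(case q of (a, b) \<Rightarrow> F a b) = X" if "q \<in> U" for q
    using assms(2) that by (cases q) auto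
  then show ?thesis using assms(1) by (auto simp: SUP_constant cong: SUP_cong split: if_splits)
qed

lemma UN_pair2_const:
  assumes "p \<in> U" "q \<in> V" "\<And>a b c d. (a, b) \<in> U \<Longrightarrow> (c, d) \<in> V \<Longrightarrow> F a b c d = X"
  shows "(\<Union>(a, b)\<in>U. \<Union>(c, d)\<in>V. F a b c d) = X"
  using assms by (intro UN_pair_const[of p] UN_pair_const[of q])

locale fraction_module = module R M + primeideal P R for P and R (structure) and M
begin

abbreviation "S \<equiv> carrier R - P"
abbreviation "fr \<equiv> mfrac R M P"

lemma S_one: "\<one> \<in> S"
  using I_notcarr one_imp_carrier by blast

lemma S_mult: "s \<in> S \<Longrightarrow> t \<in> S \<Longrightarrow> s \<otimes> t \<in> S"
  using I_prime by auto

lemma S_carrier: "s \<in> S \<Longrightarrow> s \<in> carrier R" by simp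

text \<open>The witness is \<open>u \<otimes> v \<otimes> s'\<close>: the middle denominator
  \<open>s'\<close> is included because it cannot be cancelled in a module with torsion.\<close>

lemma frac_rel_trans:
  assumes "e \<in> carrier M" "e' \<in> carrier M" "e'' \<in> carrier M" "s \<in> S" "s' \<in> S" "s'' \<in> S" "u \<in> S" "v \<in> S"
    "u \<odot>\<^bsub>M\<^esub> (s' \<odot>\<^bsub>M\<^esub> e) = u \<odot>\<^bsub>M\<^esub> (s \<odot>\<^bsub>M\<^esub> e')" "v \<odot>\<^bsub>M\<^esub> (s'' \<odot>\<^bsub>M\<^esub> e') = v \<odot>\<^bsub>M\<^esub> (s' \<odot>\<^bsub>M\<^esub> e'')"
  shows "\<exists>w\<in>S. w \<odot>\<^bsub>M\<^esub> (s'' \<odot>\<^bsub>M\<^esub> e) = w \<odot>\<^bsub>M\<^esub> (s \<odot>\<^bsub>M\<^esub> e'')"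
proof (rule bexI[of _ "u \<otimes> v \<otimes> s'"])
  have c: "s \<in> carrier R" "s' \<in> carrier R" "s'' \<in> carrier R" "u \<in> carrier R" "v \<in> carrier R"
    using assms by auto
  have "(u \<otimes> v \<otimes> s') \<odot>\<^bsub>M\<^esub> (s'' \<odot>\<^bsub>M\<^esub> e) = (v \<otimes> s'') \<odot>\<^bsub>M\<^esub> (u \<odot>\<^bsub>M\<^esub> (s' \<odot>\<^bsub>M\<^esub> e))"
    using c assms(1) by (simp add: m_ac flip: smult_assoc1)
  also have "\<dots> = (u \<otimes> s) \<odot>\<^bsub>M\<^esub> (v \<odot>\<^bsub>M\<^esub> (s'' \<odot>\<^bsub>M\<^esub> e'))"
    unfolding assms(9) using c assms(2) by (simp add: m_ac flip: smult_assoc1)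
  also have "\<dots> = (u \<otimes> v \<otimes> s') \<odot>\<^bsub>M\<^esub> (s \<odot>\<^bsub>M\<^esub> e'')"
    unfolding assms(10) using c assms(3) by (simp add: m_ac flip: smult_assoc1)
  finally show "(u \<otimes> v \<otimes> s') \<odot>\<^bsub>M\<^esub> (s'' \<odot>\<^bsub>M\<^esub> e) = (u \<otimes> v \<otimes> s') \<odot>\<^bsub>M\<^esub> (s \<odot>\<^bsub>M\<^esub> e'')" .
  show "u \<otimes> v \<otimes> s' \<in> S" using assms by (simp add: S_mult del: Diff_iff)
qed

lemma frac_refl: "e \<in> carrier M \<Longrightarrow> s \<in> S \<Longrightarrow> (e, s) \<in> fr e s"
  unfolding mfrac_def using S_one by auto

lemma frac_memD:
  assumes "(e', s') \<in> fr e s"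
  shows "e' \<in> carrier M" "s' \<in> S" "\<exists>u\<in>S. u \<odot>\<^bsub>M\<^esub> (s' \<odot>\<^bsub>M\<^esub> e) = u \<odot>\<^bsub>M\<^esub> (s \<odot>\<^bsub>M\<^esub> e')"
  using assms unfolding mfrac_def by auto

lemma frac_eq_iff:
  assumes "e \<in> carrier M" "s \<in> S" "e' \<in> carrier M" "s' \<in> S"
  shows "fr e s = fr e' s' \<longleftrightarrow> (\<exists>u\<in>S. u \<odot>\<^bsub>M\<^esub> (s' \<odot>\<^bsub>M\<^esub> e) = u \<odot>\<^bsub>M\<^esub> (s \<odot>\<^bsub>M\<^esub> e'))"
proof
  assume "fr e s = fr e' s'"
  then have "(e', s') \<in> fr e s" using frac_refl[OF assms(3,4)] by simp
  then show "\<exists>u\<in>S. u \<odot>\<^bsub>M\<^esub> (s' \<odot>\<^bsub>M\<^esub> e) = u \<odot>\<^bsub>M\<^esub> (s \<odot>\<^bsub>M\<^esub> e')" by (rule frac_memD(3))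
next
  assume "\<exists>u\<in>S. u \<odot>\<^bsub>M\<^esub> (s' \<odot>\<^bsub>M\<^esub> e) = u \<odot>\<^bsub>M\<^esub> (s \<odot>\<^bsub>M\<^esub> e')"
  then obtain u where u: "u \<in> S" "u \<odot>\<^bsub>M\<^esub> (s' \<odot>\<^bsub>M\<^esub> e) = u \<odot>\<^bsub>M\<^esub> (s \<odot>\<^bsub>M\<^esub> e')" by blast
  show "fr e s = fr e' s'"
  proof (intro subset_antisym subsetI)
    fix p assume p: "p \<in> fr e s"
    obtain f t where [simp]: "p = (f, t)" by (cases p)
    from p obtain v where v: "v \<in> S" "v \<odot>\<^bsub>M\<^esub> (t \<odot>\<^bsub>M\<^esub> e) = v \<odot>\<^bsub>M\<^esub> (s \<odot>\<^bsub>M\<^esub> f)" and f: "f \<in> carrier M" "t \<in> S"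
      using frac_memD[of f t e s] by auto
    show "p \<in> fr e' s'"
      using frac_rel_trans[OF assms(3,1) f(1) assms(4,2) f(2) u(1) v(1) u(2)[symmetric] v(2)] f
      by (simp add: mfrac_def)
  next
    fix p assume p: "p \<in> fr e' s'"
    obtain f t where [simp]: "p = (f, t)" by (cases p)
    from p obtain v where v: "v \<in> S" "v \<odot>\<^bsub>M\<^esub> (t \<odot>\<^bsub>M\<^esub> e') = v \<odot>\<^bsub>M\<^esub> (s' \<odot>\<^bsub>M\<^esub> f)" and f: "f \<in> carrier M" "t \<in> S"
      using frac_memD[of f t e' s'] by auto
    show "p \<in> fr e s"
      using frac_rel_trans[OF assms(1,3) f(1) assms(2,4) f(2) u(1) v(1) u(2) v(2)] f
      by (simp add: mfrac_def)
  qed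
qed

lemma frac_memI:
  assumes "(e', s') \<in> fr e s" "e \<in> carrier M" "s \<in> S"
  shows "fr e' s' = fr e s"
  using frac_eq_iff[OF assms(2,3) frac_memD(1,2)[OF assms(1)]] frac_memD(3)[OF assms(1)] by auto

lemma frac_eqI:
  assumes "e \<in> carrier M" "s \<in> S" "e' \<in> carrier M" "s' \<in> S" "s' \<odot>\<^bsub>M\<^esub> e = s \<odot>\<^bsub>M\<^esub> e'"
  shows "fr e s = fr e' s'"
  using frac_eq_iff[OF assms(1-4)] assms(5) S_one by auto

lemma frac_cancel:
  assumes "e \<in> carrier M" "s \<in> S" "t \<in> S"
  shows "fr (t \<odot>\<^bsub>M\<^esub> e) (t \<otimes> s) = fr e s"
  using frac_eqI[of "t \<odot>\<^bsub>M\<^esub> e" "t \<otimes> s" e s] assms S_mult[OF assms(3,2)]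
  by (simp add: m_comm flip: smult_assoc1)

lemma frac_add_cong:
  assumes "e \<in> carrier M" "s \<in> S" "f \<in> carrier M" "t \<in> S" "e' \<in> carrier M" "s' \<in> S" "f' \<in> carrier M" "t' \<in> S"
    and "fr e s = fr e' s'" "fr f t = fr f' t'"
  shows "fr (t \<odot>\<^bsub>M\<^esub> e \<oplus>\<^bsub>M\<^esub> s \<odot>\<^bsub>M\<^esub> f) (s \<otimes> t) = fr (t' \<odot>\<^bsub>M\<^esub> e' \<oplus>\<^bsub>M\<^esub> s' \<odot>\<^bsub>M\<^esub> f') (s' \<otimes> t')"
proof -
  have c: "s \<in> carrier R" "s' \<in> carrier R" "t \<in> carrier R" "t' \<in> carrier R" using assms by auto
  obtain u where u: "u \<in> S" "u \<odot>\<^bsub>M\<^esub> (s' \<odot>\<^bsub>M\<^esub> e) = u \<odot>\<^bsub>M\<^esub> (s \<odot>\<^bsub>M\<^esub> e')"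
    using assms frac_eq_iff[of e s e' s'] by auto
  obtain v where v: "v \<in> S" "v \<odot>\<^bsub>M\<^esub> (t' \<odot>\<^bsub>M\<^esub> f) = v \<odot>\<^bsub>M\<^esub> (t \<odot>\<^bsub>M\<^esub> f')"
    using assms frac_eq_iff[of f t f' t'] by auto
  have c': "u \<in> carrier R" "v \<in> carrier R" using u v by auto
  have "(u \<otimes> v) \<odot>\<^bsub>M\<^esub> ((s' \<otimes> t') \<odot>\<^bsub>M\<^esub> (t \<odot>\<^bsub>M\<^esub> e \<oplus>\<^bsub>M\<^esub> s \<odot>\<^bsub>M\<^esub> f)) =
    (v \<otimes> t \<otimes> t') \<odot>\<^bsub>M\<^esub> (u \<odot>\<^bsub>M\<^esub> (s' \<odot>\<^bsub>M\<^esub> e)) \<oplus>\<^bsub>M\<^esub> (u \<otimes> s \<otimes> s') \<odot>\<^bsub>M\<^esub> (v \<odot>\<^bsub>M\<^esub> (t' \<odot>\<^bsub>M\<^esub> f))"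
    using c c' assms(1,3) by (simp add: smult_r_distr m_ac flip: smult_assoc1)
  also have "\<dots> = (v \<otimes> t \<otimes> t') \<odot>\<^bsub>M\<^esub> (u \<odot>\<^bsub>M\<^esub> (s \<odot>\<^bsub>M\<^esub> e')) \<oplus>\<^bsub>M\<^esub> (u \<otimes> s \<otimes> s') \<odot>\<^bsub>M\<^esub> (v \<odot>\<^bsub>M\<^esub> (t \<odot>\<^bsub>M\<^esub> f'))"
    unfolding u(2) v(2) ..
  also have "\<dots> = (u \<otimes> v) \<odot>\<^bsub>M\<^esub> ((s \<otimes> t) \<odot>\<^bsub>M\<^esub> (t' \<odot>\<^bsub>M\<^esub> e' \<oplus>\<^bsub>M\<^esub> s' \<odot>\<^bsub>M\<^esub> f'))"
    using c c' assms(5,7) by (simp add: smult_r_distr m_ac flip: smult_assoc1)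
  finally have "\<exists>w\<in>S. w \<odot>\<^bsub>M\<^esub> ((s' \<otimes> t') \<odot>\<^bsub>M\<^esub> (t \<odot>\<^bsub>M\<^esub> e \<oplus>\<^bsub>M\<^esub> s \<odot>\<^bsub>M\<^esub> f)) = w \<odot>\<^bsub>M\<^esub> ((s \<otimes> t) \<odot>\<^bsub>M\<^esub> (t' \<odot>\<^bsub>M\<^esub> e' \<oplus>\<^bsub>M\<^esub> s' \<odot>\<^bsub>M\<^esub> f'))"
    using S_mult u(1) v(1) by blast
  then show ?thesis
    using frac_eq_iff[of "t \<odot>\<^bsub>M\<^esub> e \<oplus>\<^bsub>M\<^esub> s \<odot>\<^bsub>M\<^esub> f" "s \<otimes> t"] c assms S_mult by auto
qed

lemma frac_add:
  assumes "e \<in> carrier M" "s \<in> S" "f \<in> carrier M" "t \<in> S"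
  shows "(\<Union>(e, s)\<in>fr e s. \<Union>(f, t)\<in>fr f t. fr (t \<odot>\<^bsub>M\<^esub> e \<oplus>\<^bsub>M\<^esub> s \<odot>\<^bsub>M\<^esub> f) (s \<otimes> t))
     = fr (t \<odot>\<^bsub>M\<^esub> e \<oplus>\<^bsub>M\<^esub> s \<odot>\<^bsub>M\<^esub> f) (s \<otimes> t)"
proof -
  have "fr (t' \<odot>\<^bsub>M\<^esub> e' \<oplus>\<^bsub>M\<^esub> s' \<odot>\<^bsub>M\<^esub> f') (s' \<otimes> t') = fr (t \<odot>\<^bsub>M\<^esub> e \<oplus>\<^bsub>M\<^esub> s \<odot>\<^bsub>M\<^esub> f) (s \<otimes> t)"
    if "(e', s') \<in> fr e s" "(f', t') \<in> fr f t" for e' s' f' t'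
    by (rule frac_add_cong) (use assms that frac_memD[OF that(1)] frac_memD[OF that(2)] frac_memI in blast)+
  then show ?thesis
    by (intro UN_pair2_const[OF frac_refl[OF assms(1,2)] frac_refl[OF assms(3,4)]])
qed

text \<open>Stated for any structure \<open>G\<close> with these operations, since it is applied
  both to the additive group of the local ring and to \<open>loc_module\<close>, which are different
  records.\<close>

lemma abelian_group_fractions:
  assumes "carrier G = {fr e s | e s. e \<in> carrier M \<and> s \<in> S}" "\<zero>\<^bsub>G\<^esub> = fr \<zero>\<^bsub>M\<^esub> \<one>"
    and add: "\<And>e s f t. e \<in> carrier M \<Longrightarrow> s \<in> S \<Longrightarrow> f \<in> carrier M \<Longrightarrow> t \<in> S \<Longrightarrow>
      fr e s \<oplus>\<^bsub>G\<^esub> fr f t = fr (t \<odot>\<^bsub>M\<^esub> e \<oplus>\<^bsub>M\<^esub> s \<odot>\<^bsub>M\<^esub> f) (s \<otimes> t)"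
  shows "abelian_group G"
proof (rule abelian_groupI)
  note S' = S_mult[simplified] and [simp] = S_one[simplified]
  show "\<zero>\<^bsub>G\<^esub> \<in> carrier G" unfolding assms(1,2) using S_one M.zero_closed by blast
  fix x y z assume "x \<in> carrier G" "y \<in> carrier G" "z \<in> carrier G"
  then obtain e s f t g w where x: "x = fr e s" "e \<in> carrier M" "s \<in> S" and y: "y = fr f t" "f \<in> carrier M" "t \<in> S"
    and z: "z = fr g w" "g \<in> carrier M" "w \<in> S" using assms(1) by auto
  have c: "s \<in> carrier R" "t \<in> carrier R" "w \<in> carrier R" using x y z by auto
  have xy: "x \<oplus>\<^bsub>G\<^esub> y = fr (t \<odot>\<^bsub>M\<^esub> e \<oplus>\<^bsub>M\<^esub> s \<odot>\<^bsub>M\<^esub> f) (s \<otimes> t)" using x y add by simp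
  have num: "t \<odot>\<^bsub>M\<^esub> e \<oplus>\<^bsub>M\<^esub> s \<odot>\<^bsub>M\<^esub> f \<in> carrier M" "w \<odot>\<^bsub>M\<^esub> f \<oplus>\<^bsub>M\<^esub> t \<odot>\<^bsub>M\<^esub> g \<in> carrier M" using x y z c by auto
  show "x \<oplus>\<^bsub>G\<^esub> y \<in> carrier G" unfolding xy assms(1) using num S_mult[OF x(3) y(3)] by blast
  show "x \<oplus>\<^bsub>G\<^esub> y = y \<oplus>\<^bsub>G\<^esub> x" using x y c by (simp add: add M.a_comm m_comm)
  show "\<zero>\<^bsub>G\<^esub> \<oplus>\<^bsub>G\<^esub> x = x"
    using x c add[OF M.zero_closed S_one x(2,3)] by (simp add: assms(2))
  have "(x \<oplus>\<^bsub>G\<^esub> y) \<oplus>\<^bsub>G\<^esub> z = fr (w \<odot>\<^bsub>M\<^esub> (t \<odot>\<^bsub>M\<^esub> e \<oplus>\<^bsub>M\<^esub> s \<odot>\<^bsub>M\<^esub> f) \<oplus>\<^bsub>M\<^esub> (s \<otimes> t) \<odot>\<^bsub>M\<^esub> g) (s \<otimes> t \<otimes> w)"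
    unfolding xy z(1) by (rule add) (use num z S_mult[OF x(3) y(3)] in auto)
  moreover have "x \<oplus>\<^bsub>G\<^esub> (y \<oplus>\<^bsub>G\<^esub> z) = fr ((t \<otimes> w) \<odot>\<^bsub>M\<^esub> e \<oplus>\<^bsub>M\<^esub> s \<odot>\<^bsub>M\<^esub> (w \<odot>\<^bsub>M\<^esub> f \<oplus>\<^bsub>M\<^esub> t \<odot>\<^bsub>M\<^esub> g)) (s \<otimes> (t \<otimes> w))"
    unfolding x(1) y(1) z(1) add[OF y(2,3) z(2,3)] by (rule add) (use num x S_mult[OF y(3) z(3)] in auto)
  moreover have "w \<odot>\<^bsub>M\<^esub> (t \<odot>\<^bsub>M\<^esub> e \<oplus>\<^bsub>M\<^esub> s \<odot>\<^bsub>M\<^esub> f) \<oplus>\<^bsub>M\<^esub> (s \<otimes> t) \<odot>\<^bsub>M\<^esub> g = (t \<otimes> w) \<odot>\<^bsub>M\<^esub> e \<oplus>\<^bsub>M\<^esub> s \<odot>\<^bsub>M\<^esub> (w \<odot>\<^bsub>M\<^esub> f \<oplus>\<^bsub>M\<^esub> t \<odot>\<^bsub>M\<^esub> g)"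
    using x y z c by (simp add: smult_r_distr m_ac M.a_ac flip: smult_assoc1)
  ultimately show "x \<oplus>\<^bsub>G\<^esub> y \<oplus>\<^bsub>G\<^esub> z = x \<oplus>\<^bsub>G\<^esub> (y \<oplus>\<^bsub>G\<^esub> z)" using c by (simp add: m_assoc)
  show "\<exists>y\<in>carrier G. y \<oplus>\<^bsub>G\<^esub> x = \<zero>\<^bsub>G\<^esub>"
  proof (rule bexI)
    have "fr (\<ominus>\<^bsub>M\<^esub> e) s \<oplus>\<^bsub>G\<^esub> x = fr (s \<odot>\<^bsub>M\<^esub> (\<ominus>\<^bsub>M\<^esub> e) \<oplus>\<^bsub>M\<^esub> s \<odot>\<^bsub>M\<^esub> e) (s \<otimes> s)"
      unfolding x(1) by (rule add) (use x in auto)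
    also have "s \<odot>\<^bsub>M\<^esub> (\<ominus>\<^bsub>M\<^esub> e) \<oplus>\<^bsub>M\<^esub> s \<odot>\<^bsub>M\<^esub> e = \<zero>\<^bsub>M\<^esub>"
      using x c by (simp add: smult_r_minus M.l_neg)
    also have "fr \<zero>\<^bsub>M\<^esub> (s \<otimes> s) = fr \<zero>\<^bsub>M\<^esub> \<one>"
      by (rule frac_eqI) (use S_mult[OF x(3) x(3)] S_one c in auto)
    finally show "fr (\<ominus>\<^bsub>M\<^esub> e) s \<oplus>\<^bsub>G\<^esub> x = \<zero>\<^bsub>G\<^esub>" using assms(2) by simp
    show "fr (\<ominus>\<^bsub>M\<^esub> e) s \<in> carrier G" using assms(1) x by auto
  qed
qed

end

section \<open>The local ring at a prime\<close>

lemma self_module_simps [simp]: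
  "carrier (self_module A) = carrier A" "\<zero>\<^bsub>self_module A\<^esub> = \<zero>\<^bsub>A\<^esub>" "\<one>\<^bsub>self_module A\<^esub> = \<one>\<^bsub>A\<^esub>"
  "x \<oplus>\<^bsub>self_module A\<^esub> y = x \<oplus>\<^bsub>A\<^esub> y" "x \<odot>\<^bsub>self_module A\<^esub> y = x \<otimes>\<^bsub>A\<^esub> y"
  by (simp_all add: self_module_def)

lemma (in cring) module_self_module: "module R (self_module R)"
proof (rule moduleI)
  show "cring R" by unfold_locales
  show "abelian_group (self_module R)"
    by (rule abelian_groupI) (auto simp: a_ac intro!: bexI[of _ "\<ominus> _"] l_neg)
qed (auto simp: l_distr r_distr m_assoc)

locale localized_ring = primeideal P R for P and R (structure)
begin

sublocale self: fraction_module P R "self_module R"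
  by (intro fraction_module.intro module_self_module) unfold_locales

abbreviation "\<Lambda> \<equiv> localization R P"
abbreviation "rfrac \<equiv> loc_frac R P"

lemma rfrac_eq: "a \<in> carrier R \<Longrightarrow> s \<in> carrier R \<Longrightarrow> rfrac a s = mfrac R (self_module R) P a s"
  unfolding loc_frac_def mfrac_def by (auto simp: m_comm)

lemma carrier_\<Lambda>: "carrier \<Lambda> = {rfrac a s | a s. a \<in> carrier R \<and> s \<in> self.S}"
  by (simp add: localization_def)

lemma rfrac_carrier: "a \<in> carrier R \<Longrightarrow> s \<in> self.S \<Longrightarrow> rfrac a s \<in> carrier \<Lambda>"
  unfolding carrier_\<Lambda> by blast

lemma zero_\<Lambda>: "\<zero>\<^bsub>\<Lambda>\<^esub> = rfrac \<zero> \<one>" and one_\<Lambda>: "\<one>\<^bsub>\<Lambda>\<^esub> = rfrac \<one> \<one>"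
  by (simp_all add: localization_def)

lemma rfrac_mem:
  assumes "(b, t) \<in> rfrac a s" "a \<in> carrier R" "s \<in> self.S"
  shows "b \<in> carrier R" "t \<in> self.S" "rfrac b t = rfrac a s"
proof -
  have 1: "(b, t) \<in> mfrac R (self_module R) P a s" using assms by (simp add: rfrac_eq)
  show 2: "b \<in> carrier R" "t \<in> self.S" using self.frac_memD[OF 1] by auto
  show "rfrac b t = rfrac a s" using self.frac_memI[OF 1] assms 2 by (simp add: rfrac_eq)
qed

lemma rfrac_refl: "a \<in> carrier R \<Longrightarrow> s \<in> self.S \<Longrightarrow> (a, s) \<in> rfrac a s"
  using self.frac_refl[of a s] by (simp add: rfrac_eq)

lemma rfrac_eqI:
  assumes "a \<in> carrier R" "s \<in> self.S" "b \<in> carrier R" "t \<in> self.S" "t \<otimes> a = s \<otimes> b"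
  shows "rfrac a s = rfrac b t"
  using self.frac_eqI[of a s b t] assms by (simp add: rfrac_eq)

lemma rfrac_add:
  assumes "a \<in> carrier R" "s \<in> self.S" "b \<in> carrier R" "t \<in> self.S"
  shows "rfrac a s \<oplus>\<^bsub>\<Lambda>\<^esub> rfrac b t = rfrac (t \<otimes> a \<oplus> s \<otimes> b) (s \<otimes> t)"
proof -
  have *: "rfrac (a' \<otimes> t' \<oplus> b' \<otimes> s') (s' \<otimes> t') = rfrac (t \<otimes> a \<oplus> s \<otimes> b) (s \<otimes> t)"
    if "(a', s') \<in> rfrac a s" "(b', t') \<in> rfrac b t" for a' s' b' t'
  proof -
    note D = rfrac_mem[OF that(1) assms(1,2)] rfrac_mem[OF that(2) assms(3,4)]
    have c: "s' \<in> carrier R" "t' \<in> carrier R" "s \<in> carrier R" "t \<in> carrier R" using D assms by auto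
    show ?thesis
      using self.frac_add_cong[of a' s' b' t' a s b t] D assms c
      by (simp add: rfrac_eq m_comm)
  qed
  have "rfrac a s \<oplus>\<^bsub>\<Lambda>\<^esub> rfrac b t = (\<Union>(a', s')\<in>rfrac a s. \<Union>(b', t')\<in>rfrac b t. rfrac (a' \<otimes> t' \<oplus> b' \<otimes> s') (s' \<otimes> t'))"
    by (simp add: localization_def)
  also have "\<dots> = rfrac (t \<otimes> a \<oplus> s \<otimes> b) (s \<otimes> t)"
    by (intro UN_pair2_const[OF rfrac_refl[OF assms(1,2)] rfrac_refl[OF assms(3,4)]] *)
  finally show ?thesis .
qed

end

text \<open>Multiplication of fractions is well defined in every module at once; the ring is the special case of the module over itself.\<close>

context fraction_module
begin

lemma frac_smult_cong:
  assumes "(a', s') \<in> loc_frac R P a s" "(e', t') \<in> fr e t" "a \<in> carrier R" "s \<in> S" "e \<in> carrier M" "t \<in> S"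
  shows "fr (a' \<odot>\<^bsub>M\<^esub> e') (s' \<otimes> t') = fr (a \<odot>\<^bsub>M\<^esub> e) (s \<otimes> t)"
proof -
  obtain u where u: "u \<in> S" "u \<otimes> (a \<otimes> s') = u \<otimes> (a' \<otimes> s)" and a': "a' \<in> carrier R" "s' \<in> S"
    using assms(1) unfolding loc_frac_def by auto
  obtain v where v: "v \<in> S" "v \<odot>\<^bsub>M\<^esub> (t' \<odot>\<^bsub>M\<^esub> e) = v \<odot>\<^bsub>M\<^esub> (t \<odot>\<^bsub>M\<^esub> e')" and e': "e' \<in> carrier M" "t' \<in> S"
    using frac_memD[OF assms(2)] by auto
  have c: "u \<in> carrier R" "v \<in> carrier R" "s \<in> carrier R" "s' \<in> carrier R" "t \<in> carrier R" "t' \<in> carrier R"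
    using u v a' e' assms by auto
  have "(u \<otimes> v) \<odot>\<^bsub>M\<^esub> ((s' \<otimes> t') \<odot>\<^bsub>M\<^esub> (a \<odot>\<^bsub>M\<^esub> e)) = (u \<otimes> (a \<otimes> s')) \<odot>\<^bsub>M\<^esub> (v \<odot>\<^bsub>M\<^esub> (t' \<odot>\<^bsub>M\<^esub> e))"
    using c assms(3,5) by (simp add: m_ac flip: smult_assoc1)
  also have "\<dots> = (u \<otimes> v) \<odot>\<^bsub>M\<^esub> ((s \<otimes> t) \<odot>\<^bsub>M\<^esub> (a' \<odot>\<^bsub>M\<^esub> e'))"
    unfolding u(2) v(2) using c a' e' by (simp add: m_ac flip: smult_assoc1)
  finally have "\<exists>w\<in>S. w \<odot>\<^bsub>M\<^esub> ((s' \<otimes> t') \<odot>\<^bsub>M\<^esub> (a \<odot>\<^bsub>M\<^esub> e)) = w \<odot>\<^bsub>M\<^esub> ((s \<otimes> t) \<odot>\<^bsub>M\<^esub> (a' \<odot>\<^bsub>M\<^esub> e'))"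
    using S_mult[OF u(1) v(1)] by blast
  then show ?thesis
    using frac_eq_iff[of "a \<odot>\<^bsub>M\<^esub> e" "s \<otimes> t" "a' \<odot>\<^bsub>M\<^esub> e'" "s' \<otimes> t'"] S_mult assms a' e' by simp
qed

lemma loc_frac_refl: "a \<in> carrier R \<Longrightarrow> s \<in> S \<Longrightarrow> (a, s) \<in> loc_frac R P a s"
  unfolding loc_frac_def using S_one by auto

lemma UN_frac_smult:
  assumes "a \<in> carrier R" "s \<in> S" "e \<in> carrier M" "t \<in> S"
  shows "(\<Union>(a, s)\<in>loc_frac R P a s. \<Union>(e, t)\<in>fr e t. fr (a \<odot>\<^bsub>M\<^esub> e) (s \<otimes> t)) = fr (a \<odot>\<^bsub>M\<^esub> e) (s \<otimes> t)"
  by (intro UN_pair2_const[OF loc_frac_refl[OF assms(1,2)] frac_refl[OF assms(3,4)]] frac_smult_cong[OF _ _ assms])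

end

context localized_ring
begin

lemma rfrac_mult:
  assumes "a \<in> carrier R" "s \<in> self.S" "b \<in> carrier R" "t \<in> self.S"
  shows "rfrac a s \<otimes>\<^bsub>\<Lambda>\<^esub> rfrac b t = rfrac (a \<otimes> b) (s \<otimes> t)"
proof -
  have *: "rfrac (a' \<otimes> b') (s' \<otimes> t') = rfrac (a \<otimes> b) (s \<otimes> t)"
    if "(a', s') \<in> rfrac a s" "(b', t') \<in> rfrac b t" for a' s' b' t'
    using self.frac_smult_cong[OF that(1), of b' t' b t] that(2) assms
      rfrac_mem[OF that(1) assms(1,2)] rfrac_mem[OF that(2) assms(3,4)]
    by (simp add: rfrac_eq)
  have "rfrac a s \<otimes>\<^bsub>\<Lambda>\<^esub> rfrac b t = (\<Union>(a', s')\<in>rfrac a s. \<Union>(b', t')\<in>rfrac b t. rfrac (a' \<otimes> b') (s' \<otimes> t'))"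
    by (simp add: localization_def)
  also have "\<dots> = rfrac (a \<otimes> b) (s \<otimes> t)"
    by (intro UN_pair2_const[OF rfrac_refl[OF assms(1,2)] rfrac_refl[OF assms(3,4)]] *)
  finally show ?thesis .
qed

lemma cring_localization: "cring \<Lambda>"
proof (rule cringI)
  note c = self.S_carrier
  show "abelian_group \<Lambda>"
  proof (rule self.abelian_group_fractions)
    show "carrier \<Lambda> = {mfrac R (self_module R) P e s |e s. e \<in> carrier (self_module R) \<and> s \<in> self.S}"
      unfolding carrier_\<Lambda> using rfrac_eq by auto metis+
  qed (simp_all add: zero_\<Lambda> rfrac_eq[symmetric] rfrac_add)
  show "Group.comm_monoid \<Lambda>"
  proof (rule comm_monoidI)
    show "\<one>\<^bsub>\<Lambda>\<^esub> \<in> carrier \<Lambda>" unfolding one_\<Lambda> by (rule rfrac_carrier) (use self.S_one in auto)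
    fix x y z assume "x \<in> carrier \<Lambda>" "y \<in> carrier \<Lambda>" "z \<in> carrier \<Lambda>"
    then obtain a s b t d w where *: "x = rfrac a s" "a \<in> carrier R" "s \<in> self.S" "y = rfrac b t" "b \<in> carrier R" "t \<in> self.S"
      "z = rfrac d w" "d \<in> carrier R" "w \<in> self.S" unfolding carrier_\<Lambda> by blast
    note * = * c[OF *(3)] c[OF *(6)] c[OF *(9)]
    show "x \<otimes>\<^bsub>\<Lambda>\<^esub> y \<in> carrier \<Lambda>"
      unfolding *(1,4) rfrac_mult[OF *(2,3,5,6)] by (rule rfrac_carrier) (use * self.S_mult in auto)
    show "x \<otimes>\<^bsub>\<Lambda>\<^esub> y = y \<otimes>\<^bsub>\<Lambda>\<^esub> x"
      unfolding *(1,4) rfrac_mult[OF *(2,3,5,6)] rfrac_mult[OF *(5,6,2,3)] using * by (simp add: m_comm)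
    show "\<one>\<^bsub>\<Lambda>\<^esub> \<otimes>\<^bsub>\<Lambda>\<^esub> x = x"
      unfolding *(1,4) one_\<Lambda> rfrac_mult[OF one_closed self.S_one *(2,3)] using * by simp
    show "x \<otimes>\<^bsub>\<Lambda>\<^esub> y \<otimes>\<^bsub>\<Lambda>\<^esub> z = x \<otimes>\<^bsub>\<Lambda>\<^esub> (y \<otimes>\<^bsub>\<Lambda>\<^esub> z)"
      using rfrac_mult[OF *(2,3,5,6)] rfrac_mult[OF *(5,6,8,9)]
        rfrac_mult[OF m_closed[OF *(2,5)] self.S_mult[OF *(3,6)] *(8,9)]
        rfrac_mult[OF *(2,3) m_closed[OF *(5,8)] self.S_mult[OF *(6,9)]] * by (simp add: m_assoc)
  qed
  fix x y z assume "x \<in> carrier \<Lambda>" "y \<in> carrier \<Lambda>" "z \<in> carrier \<Lambda>"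
  then obtain a s b t d w where *: "x = rfrac a s" "a \<in> carrier R" "s \<in> self.S" "y = rfrac b t" "b \<in> carrier R" "t \<in> self.S"
    "z = rfrac d w" "d \<in> carrier R" "w \<in> self.S" unfolding carrier_\<Lambda> by blast
  note * = * c[OF *(3)] c[OF *(6)] c[OF *(9)]
  have n: "t \<otimes> a \<oplus> s \<otimes> b \<in> carrier R" using * by auto
  have "rfrac ((t \<otimes> a \<oplus> s \<otimes> b) \<otimes> d) (s \<otimes> t \<otimes> w) = rfrac ((t \<otimes> w) \<otimes> (a \<otimes> d) \<oplus> (s \<otimes> w) \<otimes> (b \<otimes> d)) ((s \<otimes> w) \<otimes> (t \<otimes> w))"
  proof (rule rfrac_eqI)
    show "s \<otimes> t \<otimes> w \<in> self.S" "(s \<otimes> w) \<otimes> (t \<otimes> w) \<in> self.S" using * self.S_mult by auto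
    show "s \<otimes> w \<otimes> (t \<otimes> w) \<otimes> ((t \<otimes> a \<oplus> s \<otimes> b) \<otimes> d) = s \<otimes> t \<otimes> w \<otimes> (t \<otimes> w \<otimes> (a \<otimes> d) \<oplus> s \<otimes> w \<otimes> (b \<otimes> d))"
      using * by (simp add: l_distr r_distr m_ac)
  qed (use * in auto)
  then show "(x \<oplus>\<^bsub>\<Lambda>\<^esub> y) \<otimes>\<^bsub>\<Lambda>\<^esub> z = x \<otimes>\<^bsub>\<Lambda>\<^esub> z \<oplus>\<^bsub>\<Lambda>\<^esub> y \<otimes>\<^bsub>\<Lambda>\<^esub> z"
    unfolding *(1,4,7) rfrac_add[OF *(2,3,5,6)] rfrac_mult[OF *(2,3,8,9)] rfrac_mult[OF *(5,6,8,9)]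
      rfrac_mult[OF n self.S_mult[OF *(3,6)] *(8,9)]
      rfrac_add[OF m_closed[OF *(2,8)] self.S_mult[OF *(3,9)] m_closed[OF *(5,8)] self.S_mult[OF *(6,9)]] .
qed

end

section \<open>Localized modules and Baer's condition for them\<close>

locale localized_module = fraction_module P R M + localized_ring P R for P and R (structure) and M
begin

abbreviation "LM \<equiv> loc_module R P M"

lemma carrier_LM: "carrier LM = {fr e s | e s. e \<in> carrier M \<and> s \<in> S}"
  and zero_LM: "\<zero>\<^bsub>LM\<^esub> = fr \<zero>\<^bsub>M\<^esub> \<one>"
  by (simp_all add: loc_module_def)

lemma fr_carrier: "e \<in> carrier M \<Longrightarrow> s \<in> S \<Longrightarrow> fr e s \<in> carrier LM"
  unfolding carrier_LM by blast

lemma LM_cases: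
  assumes "U \<in> carrier LM"
  obtains e s where "U = fr e s" "e \<in> carrier M" "s \<in> S"
  using assms unfolding carrier_LM by blast

lemma \<Lambda>_cases:
  assumes "U \<in> carrier \<Lambda>"
  obtains a s where "U = rfrac a s" "a \<in> carrier R" "s \<in> S"
  using assms unfolding carrier_\<Lambda> by blast

lemma fr_add:
  assumes "e \<in> carrier M" "s \<in> S" "f \<in> carrier M" "t \<in> S"
  shows "fr e s \<oplus>\<^bsub>LM\<^esub> fr f t = fr (t \<odot>\<^bsub>M\<^esub> e \<oplus>\<^bsub>M\<^esub> s \<odot>\<^bsub>M\<^esub> f) (s \<otimes> t)"
  using frac_add[OF assms] by (simp add: loc_module_def)

lemma fr_smult:
  assumes "a \<in> carrier R" "s \<in> S" "e \<in> carrier M" "t \<in> S"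
  shows "rfrac a s \<odot>\<^bsub>LM\<^esub> fr e t = fr (a \<odot>\<^bsub>M\<^esub> e) (s \<otimes> t)"
  using UN_frac_smult[OF assms] by (simp add: loc_module_def)

lemma fr_eq_zero_iff:
  assumes "e \<in> carrier M" "s \<in> S"
  shows "fr e s = \<zero>\<^bsub>LM\<^esub> \<longleftrightarrow> (\<exists>u\<in>S. u \<odot>\<^bsub>M\<^esub> e = \<zero>\<^bsub>M\<^esub>)"
  unfolding zero_LM using frac_eq_iff[OF assms M.zero_closed S_one] assms by auto

lemma module_LM: "module \<Lambda> LM"
proof (rule moduleI)
  note c = S_carrier
  show "cring \<Lambda>" by (rule cring_localization)
  show "abelian_group LM"
    by (rule abelian_group_fractions) (simp_all add: carrier_LM zero_LM fr_add)
  show "\<one>\<^bsub>\<Lambda>\<^esub> \<odot>\<^bsub>LM\<^esub> x = x" if "x \<in> carrier LM" for x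
    using that
  proof (rule LM_cases)
    fix e s assume *: "x = fr e s" "e \<in> carrier M" "s \<in> S"
    show ?thesis unfolding *(1) one_\<Lambda> fr_smult[OF one_closed S_one *(2,3)] using * by simp
  qed
  fix a b x y assume "x \<in> carrier LM" "y \<in> carrier LM" "a \<in> carrier \<Lambda>" "b \<in> carrier \<Lambda>"
  then obtain e s f t p v q w where
    *: "x = fr e s" "e \<in> carrier M" "s \<in> S" "y = fr f t" "f \<in> carrier M" "t \<in> S"
       "a = rfrac p v" "p \<in> carrier R" "v \<in> S" "b = rfrac q w" "q \<in> carrier R" "w \<in> S"
    by (elim LM_cases \<Lambda>_cases)
  note * = * c[OF *(3)] c[OF *(6)] c[OF *(9)] c[OF *(12)]
  show "a \<odot>\<^bsub>LM\<^esub> x \<in> carrier LM"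
    unfolding *(1,7) fr_smult[OF *(8,9,2,3)] by (rule fr_carrier) (use * S_mult in auto)
  show "(a \<otimes>\<^bsub>\<Lambda>\<^esub> b) \<odot>\<^bsub>LM\<^esub> x = a \<odot>\<^bsub>LM\<^esub> (b \<odot>\<^bsub>LM\<^esub> x)"
    using rfrac_mult[OF *(8,9,11,12)] fr_smult[OF *(11,12,2,3)]
      fr_smult[OF m_closed[OF *(8,11)] S_mult[OF *(9,12)] *(2,3)]
      fr_smult[OF *(8,9) smult_closed[OF *(11,2)] S_mult[OF *(12,3)]] *
    by (simp add: m_assoc smult_assoc1)
  have n1: "w \<otimes> p \<oplus> v \<otimes> q \<in> carrier R" and n2: "t \<odot>\<^bsub>M\<^esub> e \<oplus>\<^bsub>M\<^esub> s \<odot>\<^bsub>M\<^esub> f \<in> carrier M" using * by auto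
  have "fr ((w \<otimes> p \<oplus> v \<otimes> q) \<odot>\<^bsub>M\<^esub> e) (v \<otimes> w \<otimes> s) = fr ((w \<otimes> s) \<odot>\<^bsub>M\<^esub> (p \<odot>\<^bsub>M\<^esub> e) \<oplus>\<^bsub>M\<^esub> (v \<otimes> s) \<odot>\<^bsub>M\<^esub> (q \<odot>\<^bsub>M\<^esub> e)) ((v \<otimes> s) \<otimes> (w \<otimes> s))"
  proof (rule frac_eqI)
    show "v \<otimes> w \<otimes> s \<in> S" "(v \<otimes> s) \<otimes> (w \<otimes> s) \<in> S" using * S_mult by auto
    show "(v \<otimes> s \<otimes> (w \<otimes> s)) \<odot>\<^bsub>M\<^esub> ((w \<otimes> p \<oplus> v \<otimes> q) \<odot>\<^bsub>M\<^esub> e) =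
      (v \<otimes> w \<otimes> s) \<odot>\<^bsub>M\<^esub> ((w \<otimes> s) \<odot>\<^bsub>M\<^esub> (p \<odot>\<^bsub>M\<^esub> e) \<oplus>\<^bsub>M\<^esub> (v \<otimes> s) \<odot>\<^bsub>M\<^esub> (q \<odot>\<^bsub>M\<^esub> e))"
      using * by (simp add: smult_l_distr smult_r_distr r_distr m_ac flip: smult_assoc1)
  qed (use * in auto)
  then show "(a \<oplus>\<^bsub>\<Lambda>\<^esub> b) \<odot>\<^bsub>LM\<^esub> x = a \<odot>\<^bsub>LM\<^esub> x \<oplus>\<^bsub>LM\<^esub> b \<odot>\<^bsub>LM\<^esub> x"
    unfolding *(1,7,10) rfrac_add[OF *(8,9,11,12)] fr_smult[OF *(8,9,2,3)] fr_smult[OF *(11,12,2,3)]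
      fr_smult[OF n1 S_mult[OF *(9,12)] *(2,3)]
      fr_add[OF smult_closed[OF *(8,2)] S_mult[OF *(9,3)] smult_closed[OF *(11,2)] S_mult[OF *(12,3)]] .
  have "fr (p \<odot>\<^bsub>M\<^esub> (t \<odot>\<^bsub>M\<^esub> e \<oplus>\<^bsub>M\<^esub> s \<odot>\<^bsub>M\<^esub> f)) (v \<otimes> (s \<otimes> t)) = fr ((v \<otimes> t) \<odot>\<^bsub>M\<^esub> (p \<odot>\<^bsub>M\<^esub> e) \<oplus>\<^bsub>M\<^esub> (v \<otimes> s) \<odot>\<^bsub>M\<^esub> (p \<odot>\<^bsub>M\<^esub> f)) ((v \<otimes> s) \<otimes> (v \<otimes> t))"
  proof (rule frac_eqI)
    show "v \<otimes> (s \<otimes> t) \<in> S" "(v \<otimes> s) \<otimes> (v \<otimes> t) \<in> S" using * S_mult by auto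
    show "(v \<otimes> s \<otimes> (v \<otimes> t)) \<odot>\<^bsub>M\<^esub> (p \<odot>\<^bsub>M\<^esub> (t \<odot>\<^bsub>M\<^esub> e \<oplus>\<^bsub>M\<^esub> s \<odot>\<^bsub>M\<^esub> f)) =
      (v \<otimes> (s \<otimes> t)) \<odot>\<^bsub>M\<^esub> ((v \<otimes> t) \<odot>\<^bsub>M\<^esub> (p \<odot>\<^bsub>M\<^esub> e) \<oplus>\<^bsub>M\<^esub> (v \<otimes> s) \<odot>\<^bsub>M\<^esub> (p \<odot>\<^bsub>M\<^esub> f))"
      using * by (simp add: smult_r_distr m_ac flip: smult_assoc1)
  qed (use * in auto)
  then show "a \<odot>\<^bsub>LM\<^esub> (x \<oplus>\<^bsub>LM\<^esub> y) = a \<odot>\<^bsub>LM\<^esub> x \<oplus>\<^bsub>LM\<^esub> a \<odot>\<^bsub>LM\<^esub> y"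
    unfolding *(1,4,7) fr_add[OF *(2,3,5,6)] fr_smult[OF *(8,9,2,3)] fr_smult[OF *(8,9,5,6)]
      fr_smult[OF *(8,9) n2 S_mult[OF *(3,6)]]
      fr_add[OF smult_closed[OF *(8,2)] S_mult[OF *(9,3)] smult_closed[OF *(8,5)] S_mult[OF *(9,6)]] .
qed

text \<open>The product of the finitely many units belonging to generators of \<open>Q\<close>
  works: each factor kills its own generator, and the \<open>q\<close> killed with a fixed
  \<open>u\<close> form an ideal. Finite generation is what merges pointwise denominators into
  one.\<close>

lemma annihilated_by_unit:
  assumes "noetherian_ring R" "ideal Q R" "e \<in> carrier M"
    and "\<And>q. q \<in> Q \<Longrightarrow> \<exists>u\<in>S. u \<odot>\<^bsub>M\<^esub> (q \<odot>\<^bsub>M\<^esub> e) = \<zero>\<^bsub>M\<^esub>"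
  shows "\<exists>u\<in>S. \<forall>q\<in>Q. u \<odot>\<^bsub>M\<^esub> (q \<odot>\<^bsub>M\<^esub> e) = \<zero>\<^bsub>M\<^esub>"
proof -
  obtain H where H: "finite H" "H \<subseteq> carrier R" "Q = Idl H"
    using noetherian_ring.finetely_gen[OF assms(1,2)] by auto
  have HQ: "H \<subseteq> Q" using genideal_self[OF H(2)] H(3) by simp
  from H(1) H(2) HQ have "\<exists>u\<in>S. \<forall>q\<in>H. u \<odot>\<^bsub>M\<^esub> (q \<odot>\<^bsub>M\<^esub> e) = \<zero>\<^bsub>M\<^esub>"
  proof (induction rule: finite_induct)
    case empty then show ?case using S_one by blast
  next
    case (insert x F)
    obtain u where u: "u \<in> S" "\<And>q. q \<in> F \<Longrightarrow> u \<odot>\<^bsub>M\<^esub> (q \<odot>\<^bsub>M\<^esub> e) = \<zero>\<^bsub>M\<^esub>" using insert by auto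
    obtain v where v: "v \<in> S" "v \<odot>\<^bsub>M\<^esub> (x \<odot>\<^bsub>M\<^esub> e) = \<zero>\<^bsub>M\<^esub>" using assms(4)[of x] insert.prems by blast
    have "(u \<otimes> v) \<odot>\<^bsub>M\<^esub> (q \<odot>\<^bsub>M\<^esub> e) = \<zero>\<^bsub>M\<^esub>" if "q \<in> insert x F" for q
    proof (cases "q = x")
      case True
      then show ?thesis using u v insert assms(3) by (simp add: smult_assoc1)
    next
      case False
      then have "q \<in> F" using that by auto
      then show ?thesis using u(2)[of q] u(1) v(1) insert assms(3)
        by (simp add: m_comm[of u v] smult_assoc1 subset_iff)
    qed
    then show ?case using S_mult[OF u(1) v(1)] by blast
  qed
  then obtain u where u: "u \<in> S" "\<And>q. q \<in> H \<Longrightarrow> u \<odot>\<^bsub>M\<^esub> (q \<odot>\<^bsub>M\<^esub> e) = \<zero>\<^bsub>M\<^esub>" by blast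
  have "ideal {q \<in> carrier R. u \<odot>\<^bsub>M\<^esub> (q \<odot>\<^bsub>M\<^esub> e) = \<zero>\<^bsub>M\<^esub>} R"
  proof (rule ideal_if_closed)
    fix a x assume "a \<in> carrier R" "x \<in> {q \<in> carrier R. u \<odot>\<^bsub>M\<^esub> (q \<odot>\<^bsub>M\<^esub> e) = \<zero>\<^bsub>M\<^esub>}"
    then have ax: "a \<in> carrier R" "x \<in> carrier R" "u \<odot>\<^bsub>M\<^esub> (x \<odot>\<^bsub>M\<^esub> e) = \<zero>\<^bsub>M\<^esub>" by auto
    have "u \<odot>\<^bsub>M\<^esub> ((a \<otimes> x) \<odot>\<^bsub>M\<^esub> e) = a \<odot>\<^bsub>M\<^esub> (u \<odot>\<^bsub>M\<^esub> (x \<odot>\<^bsub>M\<^esub> e))"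
      using ax(1,2) u(1) assms(3) by (simp add: m_ac flip: smult_assoc1)
    then show "a \<otimes> x \<in> {q \<in> carrier R. u \<odot>\<^bsub>M\<^esub> (q \<odot>\<^bsub>M\<^esub> e) = \<zero>\<^bsub>M\<^esub>}"
      using ax by simp
  qed (use u assms(3) in \<open>auto simp: smult_l_distr smult_r_distr\<close>)
  from genideal_minimal[OF this, of H] have "Q \<subseteq> {q \<in> carrier R. u \<odot>\<^bsub>M\<^esub> (q \<odot>\<^bsub>M\<^esub> e) = \<zero>\<^bsub>M\<^esub>}"
    using u(2) H by auto
  then show ?thesis using u(1) by blast
qed

text \<open>
  The inductive step for a finitely generated ideal \<open>I + (x)\<close>: a map that vanishes on \<open>I\<close> and sends
  \<open>x\<close> to \<open>f\<close> is well defined once \<open>(I : x)\<close> annihilates \<open>f\<close>. In the localization this can be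
  arranged with a single denominator because \<open>(I : x)\<close> is finitely generated.
\<close>

lemma baer_two_step:
  assumes "baer_injective R M" "ideal I R" "x \<in> carrier R" "f \<in> carrier M"
    and ann: "\<And>q. q \<in> carrier R \<Longrightarrow> q \<otimes> x \<in> I \<Longrightarrow> q \<odot>\<^bsub>M\<^esub> f = \<zero>\<^bsub>M\<^esub>"
  shows "\<exists>\<xi>\<in>carrier M. x \<odot>\<^bsub>M\<^esub> \<xi> = f \<and> (\<forall>z\<in>I. z \<odot>\<^bsub>M\<^esub> \<xi> = \<zero>\<^bsub>M\<^esub>)"
proof -
  interpret I: ideal I R by fact
  define J where "J = {z \<oplus> c \<otimes> x | z c. z \<in> I \<and> c \<in> carrier R}"
  define g where "g w = (THE v. \<exists>z c. z \<in> I \<and> c \<in> carrier R \<and> w = z \<oplus> c \<otimes> x \<and> v = c \<odot>\<^bsub>M\<^esub> f)" for w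
  have IC: "z \<in> carrier R" if "z \<in> I" for z using that I.a_subset by auto
  have uniq: "c \<odot>\<^bsub>M\<^esub> f = d \<odot>\<^bsub>M\<^esub> f"
    if "z \<in> I" "c \<in> carrier R" "y \<in> I" "d \<in> carrier R" "z \<oplus> c \<otimes> x = y \<oplus> d \<otimes> x" for z c y d
  proof -
    have "(c \<ominus> d) \<otimes> x = y \<ominus> z"
    proof -
      have zc: "z \<in> carrier R" "y \<in> carrier R" using that IC by auto
      have "(c \<ominus> d) \<otimes> x = (z \<oplus> c \<otimes> x) \<oplus> \<ominus> z \<oplus> \<ominus> (d \<otimes> x)"
        using that(2,4) zc assms(3) by algebra
      also have "\<dots> = (y \<oplus> d \<otimes> x) \<oplus> \<ominus> z \<oplus> \<ominus> (d \<otimes> x)" using that(5) by simp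
      also have "\<dots> = y \<ominus> z" using that(2,4) zc assms(3) by algebra
      finally show ?thesis .
    qed
    moreover have "y \<ominus> z \<in> I" using that by (simp add: R.minus_eq)
    ultimately have "(c \<ominus> d) \<odot>\<^bsub>M\<^esub> f = \<zero>\<^bsub>M\<^esub>" using ann[of "c \<ominus> d"] that by simp
    then have "c \<odot>\<^bsub>M\<^esub> f \<oplus>\<^bsub>M\<^esub> \<ominus>\<^bsub>M\<^esub> (d \<odot>\<^bsub>M\<^esub> f) = \<zero>\<^bsub>M\<^esub>"
      using that assms(4) by (simp add: R.minus_eq smult_l_distr smult_l_minus)
    then show ?thesis
      using that assms(4) by (metis M.minus_equality M.minus_minus M.add.inv_closed smult_closed)
  qed
  have g: "g (z \<oplus> c \<otimes> x) = c \<odot>\<^bsub>M\<^esub> f" if "z \<in> I" "c \<in> carrier R" for z c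
    unfolding g_def
  proof (rule the_equality)
    show "\<exists>z' c'. z' \<in> I \<and> c' \<in> carrier R \<and> z \<oplus> c \<otimes> x = z' \<oplus> c' \<otimes> x \<and> c \<odot>\<^bsub>M\<^esub> f = c' \<odot>\<^bsub>M\<^esub> f"
      using that by blast
    show "v = c \<odot>\<^bsub>M\<^esub> f"
      if v: "\<exists>z' c'. z' \<in> I \<and> c' \<in> carrier R \<and> z \<oplus> c \<otimes> x = z' \<oplus> c' \<otimes> x \<and> v = c' \<odot>\<^bsub>M\<^esub> f" for v
    proof -
      obtain z' c' where "z' \<in> I" "c' \<in> carrier R" "z \<oplus> c \<otimes> x = z' \<oplus> c' \<otimes> x" "v = c' \<odot>\<^bsub>M\<^esub> f"
        using v by blast
      then show ?thesis using uniq[of z c z' c'] \<open>z \<in> I\<close> \<open>c \<in> carrier R\<close> by simp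
    qed
  qed
  have JI: "z \<oplus> c \<otimes> x \<in> J" if "z \<in> I" "c \<in> carrier R" for z c using that by (auto simp: J_def)
  have add: "x' \<oplus> y' \<in> J \<and> g (x' \<oplus> y') = g x' \<oplus>\<^bsub>M\<^esub> g y'" if J: "x' \<in> J" "y' \<in> J" for x' y'
  proof -
    obtain z c y d where *: "x' = z \<oplus> c \<otimes> x" "y' = y \<oplus> d \<otimes> x" "z \<in> I" "c \<in> carrier R" "y \<in> I" "d \<in> carrier R"
      using J by (auto simp: J_def)
    have "x' \<oplus> y' = (z \<oplus> y) \<oplus> (c \<oplus> d) \<otimes> x" using * assms(3) IC by (simp add: l_distr R.a_ac)
    then show ?thesis using JI[of "z \<oplus> y" "c \<oplus> d"] g * assms(4) by (simp add: smult_l_distr)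
  qed
  have mult: "a \<otimes> x' \<in> J \<and> g (a \<otimes> x') = a \<odot>\<^bsub>M\<^esub> g x'" if J: "x' \<in> J" "a \<in> carrier R" for a x'
  proof -
    obtain z c where *: "x' = z \<oplus> c \<otimes> x" "z \<in> I" "c \<in> carrier R" using J by (auto simp: J_def)
    have "a \<otimes> x' = (a \<otimes> z) \<oplus> (a \<otimes> c) \<otimes> x" using * J assms(3) IC by (simp add: r_distr m_assoc)
    then show ?thesis using JI[of "a \<otimes> z" "a \<otimes> c"] g * J assms(4) I.I_l_closed by (simp add: smult_assoc1)
  qed
  have IJ: "z \<in> J" "g z = \<zero>\<^bsub>M\<^esub>" if "z \<in> I" for z
    using JI[OF that, of \<zero>] g[OF that, of \<zero>] that IC assms(3,4) by auto
  have "ideal J R"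
  proof (rule ideal_if_closed)
    show "J \<subseteq> carrier R" using IC assms(3) by (auto simp: J_def)
    show "\<zero> \<in> J" using IJ(1)[OF I.zero_closed] .
  qed (use add mult in blast)+
  moreover have gC: "g w \<in> carrier M" if "w \<in> J" for w using that g assms(4) by (auto simp: J_def)
  ultimately obtain \<xi> where \<xi>: "\<xi> \<in> carrier M" "\<And>w. w \<in> J \<Longrightarrow> g w = w \<odot>\<^bsub>M\<^esub> \<xi>"
    using baer_injectiveE[OF assms(1), of J g] add mult by metis
  have "x \<in> J" "g x = f" using JI[of \<zero> \<one>] g[of \<zero> \<one>] assms(3,4) by auto
  then show ?thesis using \<xi> IJ by metis
qed

text \<open>The contraction \<open>J0\<close> of \<open>J\<close> is finitely generated, and
  \<open>J\<close> consists of its elements divided by units, so it suffices to represent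
  \<open>h\<close> on generators of \<open>J0\<close>. This is done one generator at a time: the
  error at the new generator is corrected by a fraction that vanishes on the earlier ones.\<close>

lemma baer_injective_localization:
  assumes "baer_injective R M" "noetherian_ring R"
  shows "baer_injective \<Lambda> LM"
  unfolding baer_injective_def
proof (intro conjI allI impI; (elim conjE)?)
  show "module \<Lambda> LM" by (rule module_LM)
  then interpret L: Module.module "localization R P" "loc_module R P M" .
  fix J h assume J: "ideal J \<Lambda>" and h: "h \<in> J \<rightarrow> carrier LM"
    and hadd: "\<forall>x\<in>J. \<forall>y\<in>J. h (x \<oplus>\<^bsub>\<Lambda>\<^esub> y) = h x \<oplus>\<^bsub>LM\<^esub> h y"
    and hmult: "\<forall>a\<in>carrier \<Lambda>. \<forall>x\<in>J. h (a \<otimes>\<^bsub>\<Lambda>\<^esub> x) = a \<odot>\<^bsub>LM\<^esub> h x"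
  interpret J: ideal J \<Lambda> by fact
  define i where "i a = rfrac a \<one>" for a
  have i_carrier: "i a \<in> carrier \<Lambda>" if "a \<in> carrier R" for a
    unfolding i_def using that S_one by (rule rfrac_carrier)
  have i_add: "i (a \<oplus> b) = i a \<oplus>\<^bsub>\<Lambda>\<^esub> i b" if "a \<in> carrier R" "b \<in> carrier R" for a b
    unfolding i_def using rfrac_add[OF that(1) S_one that(2) S_one] that by simp
  have i_mult: "i (a \<otimes> b) = i a \<otimes>\<^bsub>\<Lambda>\<^esub> i b" if "a \<in> carrier R" "b \<in> carrier R" for a b
    unfolding i_def using rfrac_mult[OF that(1) S_one that(2) S_one] that by simp
  have i_smult: "i a \<odot>\<^bsub>LM\<^esub> fr e s = fr (a \<odot>\<^bsub>M\<^esub> e) s" if "a \<in> carrier R" "e \<in> carrier M" "s \<in> S" for a e s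
    unfolding i_def using fr_smult[OF that(1) S_one that(2,3)] that by simp
  define J0 where "J0 = {a \<in> carrier R. i a \<in> J}"
  have J0: "ideal J0 R"
  proof (rule ideal_if_closed)
    show "\<zero> \<in> J0" using J.zero_closed by (simp add: J0_def i_def zero_\<Lambda>)
    show "a \<otimes> x \<in> J0" if "a \<in> carrier R" "x \<in> J0" for a x
      using that J.I_l_closed i_carrier by (simp add: J0_def i_mult)
  qed (auto simp: J0_def i_add)
  have J0_zero: "\<zero> \<in> J0" by (rule additive_subgroup.zero_closed[OF ideal.axioms(1)[OF J0]])
  obtain G where G: "finite G" "G \<subseteq> carrier R" "J0 = Idl G"
    using noetherian_ring.finetely_gen[OF assms(2) J0] by auto
  have hC: "h x \<in> carrier LM" if "x \<in> J" for x using h that by auto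
  have JC: "x \<in> carrier \<Lambda>" if "x \<in> J" for x using that J.a_subset by auto
  \<comment> \<open>Agreement with multiplication by \<open>\<xi>\<close> holds on an ideal, so it
    need only be tested on generators; this serves both the partial lists \<open>F\<close> and the
    full list \<open>G\<close>.\<close>
  have mult_ideal: "ideal {a \<in> J0. h (i a) = i a \<odot>\<^bsub>LM\<^esub> \<xi>} R" if \<xi>: "\<xi> \<in> carrier LM" for \<xi>
  proof (rule ideal_if_closed)
    have "h (i \<zero>) = \<zero>\<^bsub>\<Lambda>\<^esub> \<odot>\<^bsub>LM\<^esub> h (i \<zero>)"
      using hmult[rule_format, of "\<zero>\<^bsub>\<Lambda>\<^esub>" "i \<zero>"] J.zero_closed by (simp add: i_def flip: zero_\<Lambda>)
    also have "\<dots> = i \<zero> \<odot>\<^bsub>LM\<^esub> \<xi>"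
      using hC[OF J.zero_closed] \<xi> by (simp add: i_def flip: zero_\<Lambda>)
    finally show "\<zero> \<in> {a \<in> J0. h (i a) = i a \<odot>\<^bsub>LM\<^esub> \<xi>}" using J0_zero by simp
    show "x \<oplus> y \<in> {a \<in> J0. h (i a) = i a \<odot>\<^bsub>LM\<^esub> \<xi>}"
      if "x \<in> {a \<in> J0. h (i a) = i a \<odot>\<^bsub>LM\<^esub> \<xi>}" "y \<in> {a \<in> J0. h (i a) = i a \<odot>\<^bsub>LM\<^esub> \<xi>}" for x y
    proof -
      have xy: "x \<in> carrier R" "y \<in> carrier R" "i x \<in> J" "i y \<in> J"
        "h (i x) = i x \<odot>\<^bsub>LM\<^esub> \<xi>" "h (i y) = i y \<odot>\<^bsub>LM\<^esub> \<xi>"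
        using that by (auto simp: J0_def)
      have "i x \<oplus>\<^bsub>\<Lambda>\<^esub> i y \<in> J" by (rule J.a_closed[OF xy(3,4)])
      moreover have "h (i x \<oplus>\<^bsub>\<Lambda>\<^esub> i y) = (i x \<oplus>\<^bsub>\<Lambda>\<^esub> i y) \<odot>\<^bsub>LM\<^esub> \<xi>"
        using L.smult_l_distr[OF i_carrier[OF xy(1)] i_carrier[OF xy(2)] \<xi>]
          hadd[rule_format, OF xy(3,4)] xy(5,6) by metis
      ultimately show ?thesis using xy(1,2) by (simp add: J0_def i_add)
    qed
    show "a \<otimes> x \<in> {a \<in> J0. h (i a) = i a \<odot>\<^bsub>LM\<^esub> \<xi>}"
      if "x \<in> {a \<in> J0. h (i a) = i a \<odot>\<^bsub>LM\<^esub> \<xi>}" "a \<in> carrier R" for a x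
    proof -
      have x: "x \<in> carrier R" "i x \<in> J" "h (i x) = i x \<odot>\<^bsub>LM\<^esub> \<xi>"
        using that by (auto simp: J0_def)
      have "i a \<otimes>\<^bsub>\<Lambda>\<^esub> i x \<in> J" by (rule J.I_l_closed[OF x(2) i_carrier[OF that(2)]])
      moreover have "h (i a \<otimes>\<^bsub>\<Lambda>\<^esub> i x) = (i a \<otimes>\<^bsub>\<Lambda>\<^esub> i x) \<odot>\<^bsub>LM\<^esub> \<xi>"
        using L.smult_assoc1[OF i_carrier[OF that(2)] i_carrier[OF x(1)] \<xi>]
          hmult[rule_format, OF i_carrier[OF that(2)] x(2)] x(3) by metis
      ultimately show ?thesis using x(1) that(2) by (simp add: J0_def i_mult)
    qed
  qed (auto simp: J0_def)
  have GJ0: "G \<subseteq> J0" using genideal_self[OF G(2)] G(3) by simp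
  from G(1) this have "\<exists>\<xi>\<in>carrier LM. \<forall>x\<in>G. h (i x) = i x \<odot>\<^bsub>LM\<^esub> \<xi>"
  proof (induction rule: finite_induct)
    case empty then show ?case using L.M.zero_closed by blast
  next
    case (insert x F)
    then obtain \<xi> where \<xi>: "\<xi> \<in> carrier LM" "\<And>y. y \<in> F \<Longrightarrow> h (i y) = i y \<odot>\<^bsub>LM\<^esub> \<xi>" by auto
    have F: "F \<subseteq> J0" "F \<subseteq> carrier R" and x: "x \<in> J0" "x \<in> carrier R" "i x \<in> J"
      using insert by (auto simp: J0_def)
    have idl: "ideal (Idl F) R" by (rule genideal_ideal[OF F(2)])
    have "F \<subseteq> {a \<in> J0. h (i a) = i a \<odot>\<^bsub>LM\<^esub> \<xi>}" using \<xi>(2) F(1) by blast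
    from genideal_minimal[OF mult_ideal[OF \<xi>(1)] this]
    have IF: "h (i y) = i y \<odot>\<^bsub>LM\<^esub> \<xi>" "y \<in> carrier R" if "y \<in> Idl F" for y
      using that unfolding J0_def by blast+
    have "h (i x) \<ominus>\<^bsub>LM\<^esub> i x \<odot>\<^bsub>LM\<^esub> \<xi> \<in> carrier LM" using hC x \<xi>(1) i_carrier by simp
    then obtain e s where e: "h (i x) \<ominus>\<^bsub>LM\<^esub> i x \<odot>\<^bsub>LM\<^esub> \<xi> = fr e s" "e \<in> carrier M" "s \<in> S"
      by (rule LM_cases)
    \<comment> \<open>The colon ideal of \<open>Idl F\<close> by \<open>x\<close>. Each of its
      elements kills the error \<open>e/s\<close> in the localization, because
      \<open>q \<otimes> x\<close> lies where \<open>h\<close> is already multiplication by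
      \<open>\<xi>\<close>; one common \<open>u\<close> then makes \<open>Q\<close> annihilate
      \<open>u e\<close> over the ring itself.\<close>
    define Q where "Q = {q \<in> carrier R. q \<otimes> x \<in> Idl F}"
    have "ideal Q R"
    proof (rule ideal_if_closed)
      interpret idl: ideal "Idl F" R by fact
      show "\<zero> \<in> Q" using x by (simp add: Q_def idl.zero_closed)
      show "a \<oplus> b \<in> Q" if "a \<in> Q" "b \<in> Q" for a b
        using that x by (simp add: Q_def l_distr)
      show "a \<otimes> b \<in> Q" if "a \<in> carrier R" "b \<in> Q" for a b
        using that x idl.I_l_closed by (simp add: Q_def m_assoc)
    qed (auto simp: Q_def)
    moreover have "\<exists>u\<in>S. u \<odot>\<^bsub>M\<^esub> (q \<odot>\<^bsub>M\<^esub> e) = \<zero>\<^bsub>M\<^esub>" if "q \<in> Q" for q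
    proof -
      have q: "q \<in> carrier R" "q \<otimes> x \<in> Idl F" using that by (auto simp: Q_def)
      have "fr (q \<odot>\<^bsub>M\<^esub> e) s = i q \<odot>\<^bsub>LM\<^esub> (h (i x) \<ominus>\<^bsub>LM\<^esub> i x \<odot>\<^bsub>LM\<^esub> \<xi>)"
        using i_smult[OF q(1) e(2,3)] e(1) by simp
      also have "\<dots> = h (i (q \<otimes> x)) \<ominus>\<^bsub>LM\<^esub> i (q \<otimes> x) \<odot>\<^bsub>LM\<^esub> \<xi>"
        using hmult x q(1) \<xi>(1) hC i_carrier
        by (simp add: i_mult L.M.minus_eq L.smult_r_distr L.smult_r_minus L.smult_assoc1)
      also have "\<dots> = \<zero>\<^bsub>LM\<^esub>"
        using IF(1)[OF q(2)] i_carrier[OF IF(2)[OF q(2)]] \<xi>(1) by (simp add: L.M.minus_eq L.M.r_neg)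
      finally show ?thesis using fr_eq_zero_iff[of "q \<odot>\<^bsub>M\<^esub> e" s] q e by simp
    qed
    ultimately obtain u where u: "u \<in> S" "\<And>q. q \<in> Q \<Longrightarrow> u \<odot>\<^bsub>M\<^esub> (q \<odot>\<^bsub>M\<^esub> e) = \<zero>\<^bsub>M\<^esub>"
      using annihilated_by_unit[OF assms(2) _ e(2)] by blast
    have "\<exists>\<eta>\<in>carrier M. x \<odot>\<^bsub>M\<^esub> \<eta> = u \<odot>\<^bsub>M\<^esub> e \<and> (\<forall>z\<in>Idl F. z \<odot>\<^bsub>M\<^esub> \<eta> = \<zero>\<^bsub>M\<^esub>)"
    proof (rule baer_two_step[OF assms(1) idl x(2)])
      show "u \<odot>\<^bsub>M\<^esub> e \<in> carrier M" using u e by simp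
      fix q assume "q \<in> carrier R" "q \<otimes> x \<in> Idl F"
      then show "q \<odot>\<^bsub>M\<^esub> (u \<odot>\<^bsub>M\<^esub> e) = \<zero>\<^bsub>M\<^esub>"
        using u(2)[of q] u(1) e(2) by (simp add: Q_def m_comm[of u q] flip: smult_assoc1)
    qed
    then obtain \<eta> where \<eta>: "\<eta> \<in> carrier M" "x \<odot>\<^bsub>M\<^esub> \<eta> = u \<odot>\<^bsub>M\<^esub> e" "\<And>z. z \<in> Idl F \<Longrightarrow> z \<odot>\<^bsub>M\<^esub> \<eta> = \<zero>\<^bsub>M\<^esub>" by blast
    have us: "u \<otimes> s \<in> S" using S_mult u(1) e(3) by blast
    note frc = fr_carrier[OF \<eta>(1) us]
    \<comment> \<open>The correction is \<open>\<eta>/(u s)\<close>: since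
      \<open>x \<eta> = u e\<close>, it contributes exactly \<open>e/s\<close> at \<open>x\<close>,
      and nothing on \<open>Idl F\<close>.\<close>
    show ?case
    proof (rule bexI[of _ "\<xi> \<oplus>\<^bsub>LM\<^esub> fr \<eta> (u \<otimes> s)"], rule ballI)
      show "\<xi> \<oplus>\<^bsub>LM\<^esub> fr \<eta> (u \<otimes> s) \<in> carrier LM" using \<xi> frc by simp
      fix y assume y: "y \<in> insert x F"
      then have yR: "y \<in> carrier R" using x F by auto
      have *: "i y \<odot>\<^bsub>LM\<^esub> (\<xi> \<oplus>\<^bsub>LM\<^esub> fr \<eta> (u \<otimes> s)) = i y \<odot>\<^bsub>LM\<^esub> \<xi> \<oplus>\<^bsub>LM\<^esub> fr (y \<odot>\<^bsub>M\<^esub> \<eta>) (u \<otimes> s)"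
        using L.smult_r_distr[OF i_carrier[OF yR] \<xi>(1) frc] i_smult[OF yR \<eta>(1) us] by simp
      show "h (i y) = i y \<odot>\<^bsub>LM\<^esub> (\<xi> \<oplus>\<^bsub>LM\<^esub> fr \<eta> (u \<otimes> s))"
      proof (cases "y = x")
        case True
        have "fr (y \<odot>\<^bsub>M\<^esub> \<eta>) (u \<otimes> s) = h (i x) \<ominus>\<^bsub>LM\<^esub> i x \<odot>\<^bsub>LM\<^esub> \<xi>"
          using True \<eta>(2) frac_cancel[OF e(2,3) u(1)] e(1) by simp
        then show ?thesis unfolding * using True hC[OF x(3)] \<xi>(1) i_carrier[OF x(2)]
          by (simp add: L.M.minus_eq L.M.a_ac L.M.r_neg L.M.r_neg1 L.M.r_neg2)
      next
        case False
        then have "y \<in> F" using y by auto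
        moreover from this have "y \<in> Idl F" using genideal_self[OF F(2)] by auto
        moreover have "fr \<zero>\<^bsub>M\<^esub> (u \<otimes> s) = \<zero>\<^bsub>LM\<^esub>" using fr_eq_zero_iff[OF _ us, of "\<zero>\<^bsub>M\<^esub>"] u by auto
        ultimately show ?thesis unfolding * using \<eta>(3) \<xi> i_carrier[OF yR] by simp
      qed
    qed
  qed
  then obtain \<xi> where \<xi>: "\<xi> \<in> carrier LM" "\<And>y. y \<in> G \<Longrightarrow> h (i y) = i y \<odot>\<^bsub>LM\<^esub> \<xi>" by auto
  have "G \<subseteq> {a \<in> J0. h (i a) = i a \<odot>\<^bsub>LM\<^esub> \<xi>}" using \<xi>(2) GJ0 by blast
  from genideal_minimal[OF mult_ideal[OF \<xi>(1)] this]
  have IF: "h (i y) = i y \<odot>\<^bsub>LM\<^esub> \<xi>" if "y \<in> J0" for y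
    using that unfolding G(3) by blast
  have "h X = X \<odot>\<^bsub>LM\<^esub> \<xi>" if X: "X \<in> J" for X
  proof -
    obtain a s where a: "X = rfrac a s" "a \<in> carrier R" "s \<in> S" using JC[OF X] by (rule \<Lambda>_cases)
    have inv: "rfrac \<one> s \<in> carrier \<Lambda>" using a by (intro rfrac_carrier) auto
    have ia: "i a = i s \<otimes>\<^bsub>\<Lambda>\<^esub> X"
      unfolding i_def a(1) using rfrac_mult[OF S_carrier[OF a(3)] S_one a(2,3)] rfrac_eqI[of "s \<otimes> a" s a \<one>] a S_one by simp
    then have "i a \<in> J" using J.I_l_closed X i_carrier[OF S_carrier[OF a(3)]] by simp
    then have ia': "a \<in> J0" using a by (simp add: J0_def)
    have Xe: "X = rfrac \<one> s \<otimes>\<^bsub>\<Lambda>\<^esub> i a"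
      unfolding i_def a(1) using rfrac_mult[OF one_closed a(3,2) S_one] a by simp
    have "h X = rfrac \<one> s \<odot>\<^bsub>LM\<^esub> h (i a)" unfolding Xe using hmult inv \<open>i a \<in> J\<close> by simp
    also have "\<dots> = X \<odot>\<^bsub>LM\<^esub> \<xi>" unfolding IF[OF ia'] Xe using L.smult_assoc1[OF inv i_carrier[OF a(2)] \<xi>(1)] by simp
    finally show ?thesis .
  qed
  then show "\<exists>\<xi>\<in>carrier LM. \<forall>x\<in>J. h x = x \<odot>\<^bsub>LM\<^esub> \<xi>" using \<xi>(1) by blast
qed

end

section \<open>Localization of homomorphisms and its exactness\<close>

lemma loc_map_fr:
  assumes "localized_module P A M" "localized_module P A N" "f \<in> mod_hom A M N" "x \<in> carrier M" "s \<in> carrier A - P"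
  shows "loc_map A P N f (mfrac A M P x s) = mfrac A N P (f x) s"
proof -
  interpret M: localized_module P A M by fact
  interpret N: localized_module P A N by fact
  note f = mod_homD[OF assms(3)]
  show ?thesis unfolding loc_map_def
  proof (rule UN_pair_const[OF M.frac_refl[OF assms(4,5)]])
    fix y t assume "(y, t) \<in> mfrac A M P x s"
    note D = M.frac_memD[OF this]
    obtain u where u: "u \<in> carrier A - P" "u \<odot>\<^bsub>M\<^esub> (t \<odot>\<^bsub>M\<^esub> x) = u \<odot>\<^bsub>M\<^esub> (s \<odot>\<^bsub>M\<^esub> y)" using D by blast
    have c: "u \<in> carrier A" "t \<in> carrier A" "s \<in> carrier A" using u(1) D(2) assms(5) by auto
    have "u \<odot>\<^bsub>N\<^esub> (s \<odot>\<^bsub>N\<^esub> f y) = f (u \<odot>\<^bsub>M\<^esub> (s \<odot>\<^bsub>M\<^esub> y))"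
      using c D(1) by (simp add: f)
    also have "\<dots> = u \<odot>\<^bsub>N\<^esub> (t \<odot>\<^bsub>N\<^esub> f x)"
      unfolding u(2)[symmetric] using c assms(4) by (simp add: f)
    finally have "u \<odot>\<^bsub>N\<^esub> (s \<odot>\<^bsub>N\<^esub> f y) = u \<odot>\<^bsub>N\<^esub> (t \<odot>\<^bsub>N\<^esub> f x)" .
    then show "mfrac A N P (f y) t = mfrac A N P (f x) s"
      using N.frac_eq_iff[of "f y" t "f x" s] D assms(4,5) f(1) u(1) by blast
  qed
qed

lemma loc_map_hom:
  assumes "localized_module P A M" "localized_module P A N" "f \<in> mod_hom A M N"
  shows "loc_map A P N f \<in> mod_hom (localization A P) (loc_module A P M) (loc_module A P N)"
proof -
  interpret M: localized_module P A M by fact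
  interpret N: localized_module P A N by fact
  note f = mod_homD[OF assms(3)] and fr = loc_map_fr[OF assms]
  show ?thesis unfolding mod_hom_def
  proof (intro CollectI conjI ballI funcsetI)
    fix U assume "U \<in> carrier (loc_module A P M)"
    then obtain x s where x: "U = mfrac A M P x s" "x \<in> carrier M" "s \<in> carrier A - P" by (rule M.LM_cases)
    show "loc_map A P N f U \<in> carrier (loc_module A P N)"
      unfolding x(1) fr[OF x(2,3)] using N.fr_carrier f(1) x(2,3) by blast
    { fix V assume "V \<in> carrier (loc_module A P M)"
      then obtain y t where y: "V = mfrac A M P y t" "y \<in> carrier M" "t \<in> carrier A - P" by (rule M.LM_cases)
      have st: "s \<otimes>\<^bsub>A\<^esub> t \<in> carrier A - P" by (rule M.S_mult[OF x(3) y(3)])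
      have n: "t \<odot>\<^bsub>M\<^esub> x \<oplus>\<^bsub>M\<^esub> s \<odot>\<^bsub>M\<^esub> y \<in> carrier M" using x y by simp
      show "loc_map A P N f (U \<oplus>\<^bsub>loc_module A P M\<^esub> V) = loc_map A P N f U \<oplus>\<^bsub>loc_module A P N\<^esub> loc_map A P N f V"
        unfolding x(1) y(1) fr[OF x(2,3)] fr[OF y(2,3)] M.fr_add[OF x(2,3) y(2,3)] fr[OF n st]
          N.fr_add[OF f(1)[OF x(2)] x(3) f(1)[OF y(2)] y(3)]
        using x y by (simp add: f) }
    fix B assume "B \<in> carrier (localization A P)"
    then obtain b t where b: "B = loc_frac A P b t" "b \<in> carrier A" "t \<in> carrier A - P" by (rule M.\<Lambda>_cases)
    have st: "t \<otimes>\<^bsub>A\<^esub> s \<in> carrier A - P" by (rule M.S_mult[OF b(3) x(3)])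
    have n: "b \<odot>\<^bsub>M\<^esub> x \<in> carrier M" using x b by simp
    show "loc_map A P N f (B \<odot>\<^bsub>loc_module A P M\<^esub> U) = B \<odot>\<^bsub>loc_module A P N\<^esub> loc_map A P N f U"
      unfolding x(1) b(1) fr[OF x(2,3)] M.fr_smult[OF b(2,3) x(2,3)] fr[OF n st]
          N.fr_smult[OF b(2,3) f(1)[OF x(2)] x(3)]
      using x b by (simp add: f)
  qed
qed

text \<open>If \<open>g y / s\<close> vanishes, some \<open>u\<close> outside \<open>P\<close> gives
  \<open>g (u y) = 0\<close>, hence \<open>u y = f x\<close>, and
  \<open>y / s = f x / (u s)\<close>.\<close>

lemma loc_map_exact:
  assumes "localized_module P A M" "localized_module P A N" "localized_module P A Q"
    "f \<in> mod_hom A M N" "g \<in> mod_hom A N Q"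
    and exact: "f ` carrier M = {x \<in> carrier N. g x = \<zero>\<^bsub>Q\<^esub>}"
  shows "loc_map A P N f ` carrier (loc_module A P M) =
    {U \<in> carrier (loc_module A P N). loc_map A P Q g U = \<zero>\<^bsub>loc_module A P Q\<^esub>}"
proof -
  interpret M: localized_module P A M by fact
  interpret N: localized_module P A N by fact
  interpret Q: localized_module P A Q by fact
  note fD = mod_homD[OF assms(4)] and ffr = loc_map_fr[OF assms(1,2,4)]
  note gD = mod_homD[OF assms(5)] and gfr = loc_map_fr[OF assms(2,3,5)]
  show ?thesis
  proof (intro subset_antisym subsetI)
    fix V assume "V \<in> loc_map A P N f ` carrier (loc_module A P M)"
    then obtain U where U: "U \<in> carrier (loc_module A P M)" "V = loc_map A P N f U" by blast
    from U(1) obtain x s where x: "U = mfrac A M P x s" "x \<in> carrier M" "s \<in> carrier A - P" by (rule M.LM_cases)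
    have V: "V = mfrac A N P (f x) s" unfolding U x(1) ffr[OF x(2,3)] ..
    have "g (f x) = \<zero>\<^bsub>Q\<^esub>" using exact x(2) by blast
    then have "loc_map A P Q g V = \<zero>\<^bsub>loc_module A P Q\<^esub>"
      unfolding V gfr[OF fD(1)[OF x(2)] x(3)] using Q.fr_eq_zero_iff[OF _ x(3), of "\<zero>\<^bsub>Q\<^esub>"] x(3) by auto
    then show "V \<in> {U \<in> carrier (loc_module A P N). loc_map A P Q g U = \<zero>\<^bsub>loc_module A P Q\<^esub>}"
      using N.fr_carrier[OF fD(1)[OF x(2)] x(3)] V by simp
  next
    fix V assume V: "V \<in> {U \<in> carrier (loc_module A P N). loc_map A P Q g U = \<zero>\<^bsub>loc_module A P Q\<^esub>}"
    then have "V \<in> carrier (loc_module A P N)" by simp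
    then obtain y s where y: "V = mfrac A N P y s" "y \<in> carrier N" "s \<in> carrier A - P" by (rule N.LM_cases)
    have "mfrac A Q P (g y) s = \<zero>\<^bsub>loc_module A P Q\<^esub>" using V gfr[OF y(2,3)] y(1) by simp
    then obtain u where u: "u \<in> carrier A - P" "u \<odot>\<^bsub>Q\<^esub> g y = \<zero>\<^bsub>Q\<^esub>"
      using Q.fr_eq_zero_iff[OF gD(1)[OF y(2)] y(3)] by blast
    then have "g (u \<odot>\<^bsub>N\<^esub> y) = \<zero>\<^bsub>Q\<^esub>" using gD(3)[of u y] y by simp
    moreover have "u \<odot>\<^bsub>N\<^esub> y \<in> carrier N" using u y by simp
    ultimately have "u \<odot>\<^bsub>N\<^esub> y \<in> f ` carrier M" using exact by simp
    then obtain x where x: "x \<in> carrier M" "f x = u \<odot>\<^bsub>N\<^esub> y" by auto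
    have us: "u \<otimes>\<^bsub>A\<^esub> s \<in> carrier A - P" by (rule M.S_mult[OF u(1) y(3)])
    have "V = loc_map A P N f (mfrac A M P x (u \<otimes>\<^bsub>A\<^esub> s))"
      unfolding ffr[OF x(1) us] x(2) N.frac_cancel[OF y(2,3) u(1)] y(1) ..
    then show "V \<in> loc_map A P N f ` carrier (loc_module A P M)" using M.fr_carrier[OF x(1) us] by blast
  qed
qed

lemma loc_map_inj:
  assumes "localized_module P A M" "localized_module P A N" "f \<in> mod_hom A M N" "inj_on f (carrier M)"
  shows "inj_on (loc_map A P N f) (carrier (loc_module A P M))"
proof (rule inj_onI)
  interpret M: localized_module P A M by fact
  interpret N: localized_module P A N by fact
  note f = mod_homD[OF assms(3)] and fr = loc_map_fr[OF assms(1-3)]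
  fix U V assume "U \<in> carrier (loc_module A P M)" "V \<in> carrier (loc_module A P M)" and eq: "loc_map A P N f U = loc_map A P N f V"
  then obtain x s y t where x: "U = mfrac A M P x s" "x \<in> carrier M" "s \<in> carrier A - P"
    and y: "V = mfrac A M P y t" "y \<in> carrier M" "t \<in> carrier A - P" by (elim M.LM_cases)
  have "mfrac A N P (f x) s = mfrac A N P (f y) t" using eq fr x y by simp
  then obtain u where u: "u \<in> carrier A - P" "u \<odot>\<^bsub>N\<^esub> (t \<odot>\<^bsub>N\<^esub> f x) = u \<odot>\<^bsub>N\<^esub> (s \<odot>\<^bsub>N\<^esub> f y)"
    using N.frac_eq_iff[OF f(1)[OF x(2)] x(3) f(1)[OF y(2)] y(3)] by blast
  then have "f (u \<odot>\<^bsub>M\<^esub> (t \<odot>\<^bsub>M\<^esub> x)) = f (u \<odot>\<^bsub>M\<^esub> (s \<odot>\<^bsub>M\<^esub> y))" using x y by (simp add: f)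
  then have "u \<odot>\<^bsub>M\<^esub> (t \<odot>\<^bsub>M\<^esub> x) = u \<odot>\<^bsub>M\<^esub> (s \<odot>\<^bsub>M\<^esub> y)"
    using assms(4) u x y by (intro inj_onD[OF assms(4)]) simp_all
  then show "U = V" unfolding x(1) y(1) using M.frac_eq_iff[OF x(2,3) y(2,3)] u(1) by blast
qed

text \<open>Transport of structure along an injection of element types.
  \<open>finite_injective_dimension\<close> fixes the element type of the terms of a resolution,
  while the terms constructed here consist of fractions whose numerators are functions.\<close>

definition module_image :: "('z \<Rightarrow> 'w) \<Rightarrow> ('a, 'z, 'd) module_scheme \<Rightarrow> ('a, 'w) module" where
  "module_image \<iota> M = \<lparr>carrier = \<iota> ` carrier M, monoid.mult = undefined, one = undefined, ring.zero = \<iota> \<zero>\<^bsub>M\<^esub>,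
     add = (\<lambda>x y. \<iota> (inv_into UNIV \<iota> x \<oplus>\<^bsub>M\<^esub> inv_into UNIV \<iota> y)), smult = (\<lambda>a x. \<iota> (a \<odot>\<^bsub>M\<^esub> inv_into UNIV \<iota> x))\<rparr>"

lemma injective_module_image:
  fixes A :: "('a, 'c) ring_scheme"
  assumes "inj \<iota>" "injective_module A E"
  shows "injective_module A (module_image \<iota> E)"
  unfolding injective_module_def
proof (intro conjI allI impI; (elim conjE)?)
  note [simp] = inv_f_f[OF assms(1)]
  have "module A E" using assms(2) by (simp add: injective_module_def)
  then interpret E: Module.module A E .
  show mod: "module A (module_image \<iota> E)"
  proof (rule moduleI)
    show "cring A" by unfold_locales
    show "abelian_group (module_image \<iota> E)"
    proof (rule abelian_groupI)
      show "\<exists>y\<in>carrier (module_image \<iota> E). y \<oplus>\<^bsub>module_image \<iota> E\<^esub> x = \<zero>\<^bsub>module_image \<iota> E\<^esub>"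
        if "x \<in> carrier (module_image \<iota> E)" for x
        using that by (auto simp: module_image_def E.M.l_neg intro!: bexI[of _ "\<ominus>\<^bsub>E\<^esub> _"])
    qed (auto simp: module_image_def E.M.a_ac)
  qed (auto simp: module_image_def E.smult_l_distr E.smult_r_distr E.smult_assoc1)
  fix M N :: "('a, 'a) module" and i f
  assume *: "module A M" "module A N" "i \<in> mod_hom A M N" "inj_on i (carrier M)" "f \<in> mod_hom A M (module_image \<iota> E)"
  have "(\<lambda>x. inv_into UNIV \<iota> (f x)) \<in> mod_hom A M E"
    using *(5) unfolding mod_hom_def module_image_def by (auto simp: Pi_def)
  then have "\<exists>g \<in> mod_hom A N E. \<forall>x\<in>carrier M. g (i x) = inv_into UNIV \<iota> (f x)"
    using assms(2)[unfolded injective_module_def, THEN conjunct2, rule_format,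
        of M N i "\<lambda>x. inv_into UNIV \<iota> (f x)"] * by simp
  then obtain g where g: "g \<in> mod_hom A N E" "\<And>x. x \<in> carrier M \<Longrightarrow> g (i x) = inv_into UNIV \<iota> (f x)"
    by blast
  show "\<exists>g\<in>mod_hom A N (module_image \<iota> E). \<forall>x\<in>carrier M. g (i x) = f x"
  proof (rule bexI[of _ "\<lambda>x. \<iota> (g x)"])
    show "(\<lambda>x. \<iota> (g x)) \<in> mod_hom A N (module_image \<iota> E)"
      using g(1) unfolding mod_hom_def module_image_def by auto
    show "\<forall>x\<in>carrier M. \<iota> (g (i x)) = f x"
      using g(2) mod_homD(1)[OF *(5)] by (auto simp: module_image_def) (metis assms(1) imageE inv_f_f)
  qed
qed

lemma finite_injective_dimensionI:
  fixes E :: "nat \<Rightarrow> ('a, 'z, 'd) module_scheme" and \<iota> :: "'z \<Rightarrow> ('a \<Rightarrow> 'a) set"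
  assumes "inj \<iota>" "\<And>i. injective_module A (E i)" "\<And>i. i > n \<Longrightarrow> carrier (E i) = {\<zero>\<^bsub>E i\<^esub>}"
    "e \<in> mod_hom A M (E 0)" "inj_on e (carrier M)" "\<And>i. d i \<in> mod_hom A (E i) (E (Suc i))"
    "e ` carrier M = {x \<in> carrier (E 0). d 0 x = \<zero>\<^bsub>E 1\<^esub>}"
    "\<And>i. d i ` carrier (E i) = {x \<in> carrier (E (Suc i)). d (Suc i) x = \<zero>\<^bsub>E (Suc (Suc i))\<^esub>}"
  shows "finite_injective_dimension A M"
  unfolding finite_injective_dimension_def
proof (intro exI conjI allI impI)
  note [simp] = inv_f_f[OF assms(1)] inj_eq[OF assms(1)]
  let ?E = "\<lambda>i. module_image \<iota> (E i)" and ?d = "\<lambda>i x. \<iota> (d i (inv_into UNIV \<iota> x))"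
  show "injective_module A (?E i)" for i by (rule injective_module_image[OF assms(1,2)])
  show "carrier (?E i) = {\<zero>\<^bsub>?E i\<^esub>}" if "i > n" for i using assms(3)[OF that] by (simp add: module_image_def)
  show "(\<lambda>x. \<iota> (e x)) \<in> mod_hom A M (?E 0)"
    using assms(4) unfolding mod_hom_def module_image_def by auto
  show "inj_on (\<lambda>x. \<iota> (e x)) (carrier M)" using assms(5) by (auto simp: inj_on_def)
  show "?d i \<in> mod_hom A (?E i) (?E (Suc i))" for i
    using assms(6)[of i] unfolding mod_hom_def module_image_def by auto
  have "(\<lambda>x. \<iota> (e x)) ` carrier M = \<iota> ` (e ` carrier M)" by (simp add: image_image)
  then show "(\<lambda>x. \<iota> (e x)) ` carrier M = {x \<in> carrier (?E 0). ?d 0 x = \<zero>\<^bsub>?E 1\<^esub>}"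
    unfolding assms(7) by (auto simp: module_image_def)
  have "?d i ` carrier (?E i) = \<iota> ` (d i ` carrier (E i))" for i by (auto simp: module_image_def image_image)
  then show "?d i ` carrier (?E i) = {x \<in> carrier (?E (Suc i)). ?d (Suc i) x = \<zero>\<^bsub>?E (Suc (Suc i))\<^esub>}" for i
    unfolding assms(8) by (auto simp: module_image_def)
qed

text \<open>Injectivity passes to fractions by the Noetherian hypothesis, exactness always does. The
  embedding \<open>\<iota>\<close> places fractions with numerators in the terms \<open>E i\<close>
  into the element type demanded by \<open>finite_injective_dimension\<close>.\<close>

theorem finite_injective_dimension_localization:
  fixes A :: "('a, 'c) ring_scheme" and E :: "nat \<Rightarrow> ('a, 'e, 'd) module_scheme"
    and \<iota> :: "('e \<times> 'a) set \<Rightarrow> (('a \<times> 'a) set \<Rightarrow> ('a \<times> 'a) set) set"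
  assumes P: "primeideal P A" and noeth: "noetherian_ring A" and \<iota>: "inj \<iota>"
    and inj: "\<And>i. baer_injective A (E i)" and fin: "\<And>i. i > n \<Longrightarrow> carrier (E i) = {\<zero>\<^bsub>E i\<^esub>}"
    and e: "e \<in> mod_hom A (self_module A) (E 0)" "inj_on e (carrier A)"
    and d: "\<And>i. d i \<in> mod_hom A (E i) (E (Suc i))"
    and exact: "e ` carrier A = {x \<in> carrier (E 0). d 0 x = \<zero>\<^bsub>E 1\<^esub>}"
      "\<And>i. d i ` carrier (E i) = {x \<in> carrier (E (Suc i)). d (Suc i) x = \<zero>\<^bsub>E (Suc (Suc i))\<^esub>}"
  shows "finite_injective_dimension (localization A P) (self_module (localization A P))"
proof -
  interpret P: primeideal P A by fact
  have L: "localized_module P A M" if "module A M" for M :: "('a, 'f, 'g) module_scheme"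
    by (intro localized_module.intro fraction_module.intro localized_ring.intro that P)
  have LE: "localized_module P A (E i)" for i using inj[of i] by (intro L) (simp add: baer_injective_def)
  have LS: "localized_module P A (self_module A)" by (rule L[OF P.module_self_module])
  interpret S: localized_module P A "self_module A" by (rule LS)
  let ?E = "\<lambda>i. loc_module A P (E i)" and ?d = "\<lambda>i. loc_map A P (E (Suc i)) (d i)" and ?e = "loc_map A P (E 0) e"
  have cS: "carrier (loc_module A P (self_module A)) = carrier (localization A P)"
    unfolding S.carrier_LM S.carrier_\<Lambda> 
    by (intro Collect_cong ex_cong1) (auto simp: S.rfrac_eq)
  \<comment> \<open>The localized \<open>self_module\<close> and the \<open>self_module\<close> of
    the local ring are different records. They share the carrier, and addition and scalar
    multiplication agree on it, which is all that \<open>mod_hom\<close> sees.\<close>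
  have eH: "?e \<in> mod_hom (localization A P) (self_module (localization A P)) (?E 0)"
  proof -
    note h = mod_homD[OF loc_map_hom[OF LS LE e(1)], unfolded cS]
    have fr: "mfrac A (self_module A) P a s = loc_frac A P a s" if "a \<in> carrier A" "s \<in> carrier A - P" for a s
      using S.rfrac_eq that by simp
    have add: "U \<oplus>\<^bsub>loc_module A P (self_module A)\<^esub> V = U \<oplus>\<^bsub>localization A P\<^esub> V"
      and mult: "U \<odot>\<^bsub>loc_module A P (self_module A)\<^esub> V = U \<otimes>\<^bsub>localization A P\<^esub> V"
      if UV: "U \<in> carrier (localization A P)" "V \<in> carrier (localization A P)" for U V
    proof -
      obtain a s b t where *: "U = loc_frac A P a s" "a \<in> carrier A" "s \<in> carrier A - P"
        "V = loc_frac A P b t" "b \<in> carrier A" "t \<in> carrier A - P" using UV by (elim S.\<Lambda>_cases)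
      have st: "s \<otimes>\<^bsub>A\<^esub> t \<in> carrier A - P" using S.S_mult * by blast
      have c: "s \<in> carrier A" "t \<in> carrier A" using * by auto
      show "U \<oplus>\<^bsub>loc_module A P (self_module A)\<^esub> V = U \<oplus>\<^bsub>localization A P\<^esub> V"
        unfolding *(1,4) S.rfrac_add[OF *(2,3,5,6)] using S.fr_add[of a s b t] * st c by (simp add: fr)
      show "U \<odot>\<^bsub>loc_module A P (self_module A)\<^esub> V = U \<otimes>\<^bsub>localization A P\<^esub> V"
        unfolding *(1,4) S.rfrac_mult[OF *(2,3,5,6)] using S.fr_smult[of a s b t] * st c by (simp add: fr)
    qed
    show ?thesis unfolding mod_hom_def using h add mult by auto
  qed
  show ?thesis
  proof (rule finite_injective_dimensionI[where E = ?E and d = ?d and e = ?e and n = n, OF \<iota>])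
    show "injective_module (localization A P) (?E i)" for i
    proof -
      interpret localized_module P A "E i" by (rule LE)
      show ?thesis by (rule baer_criterion[OF baer_injective_localization[OF inj noeth]])
    qed
    show "carrier (?E i) = {\<zero>\<^bsub>?E i\<^esub>}" if "n < i" for i
    proof -
      interpret I: localized_module P A "E i" by (rule LE)
      have "mfrac A (E i) P \<zero>\<^bsub>E i\<^esub> s = \<zero>\<^bsub>?E i\<^esub>" if "s \<in> carrier A - P" for s
        using I.fr_eq_zero_iff[OF I.M.zero_closed that] that by auto
      then show ?thesis unfolding I.carrier_LM fin[OF that] using S.S_one by auto
    qed
    show "?e \<in> mod_hom (localization A P) (self_module (localization A P)) (?E 0)" by (rule eH)
    show "inj_on ?e (carrier (self_module (localization A P)))"
      using loc_map_inj[OF LS LE e(1)] e(2) by (simp add: cS)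
    show "?d i \<in> mod_hom (localization A P) (?E i) (?E (Suc i))" for i by (rule loc_map_hom[OF LE LE d])
    show "?e ` carrier (self_module (localization A P)) = {x \<in> carrier (?E 0). ?d 0 x = \<zero>\<^bsub>?E 1\<^esub>}"
      using loc_map_exact[OF LS LE LE e(1) d] exact(1) by (simp add: cS)
    show "?d i ` carrier (?E i) = {x \<in> carrier (?E (Suc i)). ?d (Suc i) x = \<zero>\<^bsub>?E (Suc (Suc i))\<^esub>}" for i
      by (rule loc_map_exact[OF LE LE LE d d exact(2)])
  qed
qed

section \<open>Hilbert's basis theorem\<close>

hide_const (open) up_ring.coeff up_ring.monom module.smult Poly_Mapping.degree

text \<open>Rings are here subsets of a type in a ring class, so that univariate polynomials over
  that type and their evaluation are available; \<open>noetherian_A\<close> carries the result over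
  to the quotient ring as a record.\<close>

definition is_subring :: "'a::comm_ring_1 set \<Rightarrow> bool" where
  "is_subring S \<longleftrightarrow> 1 \<in> S \<and> (\<forall>x\<in>S. \<forall>y\<in>S. x - y \<in> S) \<and> (\<forall>x\<in>S. \<forall>y\<in>S. x * y \<in> S)"

definition is_ideal :: "'a::comm_ring_1 set \<Rightarrow> 'a set \<Rightarrow> bool" where
  "is_ideal S J \<longleftrightarrow> J \<subseteq> S \<and> 0 \<in> J \<and> (\<forall>x\<in>J. \<forall>y\<in>J. x + y \<in> J) \<and> (\<forall>a\<in>S. \<forall>x\<in>J. a * x \<in> J)"

definition ideal_gen :: "'a::comm_ring_1 set \<Rightarrow> 'a set \<Rightarrow> 'a set" where
  "ideal_gen S G = \<Inter>{J. is_ideal S J \<and> G \<subseteq> J}"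

definition is_noetherian :: "'a::comm_ring_1 set \<Rightarrow> bool" where
  "is_noetherian S \<longleftrightarrow> (\<forall>J. is_ideal S J \<longrightarrow> (\<exists>G\<subseteq>J. finite G \<and> J \<subseteq> ideal_gen S G))"

definition adjoin :: "'a::comm_ring_1 set \<Rightarrow> 'a \<Rightarrow> 'a set" where
  "adjoin S x = {poly p x | p. \<forall>i. coeff p i \<in> S}"

lemma is_subringD:
  assumes "is_subring S"
  shows "0 \<in> S" "1 \<in> S" "\<And>x y. x \<in> S \<Longrightarrow> y \<in> S \<Longrightarrow> x - y \<in> S" "\<And>x. x \<in> S \<Longrightarrow> - x \<in> S"
    "\<And>x y. x \<in> S \<Longrightarrow> y \<in> S \<Longrightarrow> x + y \<in> S" "\<And>x y. x \<in> S \<Longrightarrow> y \<in> S \<Longrightarrow> x * y \<in> S"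
proof -
  show 1: "1 \<in> S" and d: "\<And>x y. x \<in> S \<Longrightarrow> y \<in> S \<Longrightarrow> x - y \<in> S" "\<And>x y. x \<in> S \<Longrightarrow> y \<in> S \<Longrightarrow> x * y \<in> S"
    using assms unfolding is_subring_def by blast+
  show 0: "0 \<in> S" using d(1)[OF 1 1] by simp
  show m: "\<And>x. x \<in> S \<Longrightarrow> - x \<in> S" using d(1)[OF 0] by simp
  show "\<And>x y. x \<in> S \<Longrightarrow> y \<in> S \<Longrightarrow> x + y \<in> S" using d(1) m by fastforce
qed

lemma is_subring_sum: "is_subring S \<Longrightarrow> (\<And>i. i \<in> A \<Longrightarrow> f i \<in> S) \<Longrightarrow> sum f A \<in> S"
  by (induction A rule: infinite_finite_induct) (auto intro: is_subringD)

lemma is_idealD: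
  assumes "is_ideal S J"
  shows "\<And>x. x \<in> J \<Longrightarrow> x \<in> S" "0 \<in> J" "\<And>x y. x \<in> J \<Longrightarrow> y \<in> J \<Longrightarrow> x + y \<in> J"
    "\<And>a x. a \<in> S \<Longrightarrow> x \<in> J \<Longrightarrow> a * x \<in> J"
  using assms unfolding is_ideal_def by blast+

lemma is_ideal_diff:
  assumes "is_subring S" "is_ideal S J" "x \<in> J" "y \<in> J"
  shows "x - y \<in> J"
  using is_idealD(3)[OF assms(2,3) is_idealD(4)[OF assms(2) is_subringD(4)[OF assms(1) is_subringD(2)[OF assms(1)]] assms(4)]]
  by simp

lemma ideal_gen_superset: "G \<subseteq> ideal_gen S G"
  and ideal_gen_minimal: "is_ideal S J \<Longrightarrow> G \<subseteq> J \<Longrightarrow> ideal_gen S G \<subseteq> J"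
  unfolding ideal_gen_def by blast+

lemma is_ideal_gen:
  assumes "is_subring S" "G \<subseteq> S"
  shows "is_ideal S (ideal_gen S G)"
proof -
  have "is_ideal S S" by (simp add: is_ideal_def is_subringD[OF assms(1)])
  then have "ideal_gen S G \<subseteq> S" using assms(2) by (rule ideal_gen_minimal)
  moreover have "0 \<in> ideal_gen S G" unfolding ideal_gen_def using is_idealD(2) by blast
  moreover have "x + y \<in> ideal_gen S G" if "x \<in> ideal_gen S G" "y \<in> ideal_gen S G" for x y
    using that unfolding ideal_gen_def by (auto intro: is_idealD(3))
  moreover have "a * x \<in> ideal_gen S G" if "a \<in> S" "x \<in> ideal_gen S G" for a x
    using that unfolding ideal_gen_def by (auto intro: is_idealD(4))
  ultimately show ?thesis unfolding is_ideal_def by blast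
qed

lemma adjoinI: "\<forall>i. coeff p i \<in> S \<Longrightarrow> poly p x \<in> adjoin S x"
  unfolding adjoin_def by blast

lemma adjoin_const: "is_subring S \<Longrightarrow> s \<in> S \<Longrightarrow> s \<in> adjoin S x"
  using adjoinI[of "[:s:]" S x] by (auto simp: coeff_pCons is_subringD split: nat.splits)

lemma adjoin_self: "is_subring S \<Longrightarrow> x \<in> adjoin S x"
  using adjoinI[of "[:0, 1:]" S x] by (auto simp: coeff_pCons is_subringD split: nat.splits)

lemma is_subring_adjoin:
  assumes "is_subring S"
  shows "is_subring (adjoin S x)"
proof -
  note D = is_subringD[OF assms]
  have "u - v \<in> adjoin S x" "u * v \<in> adjoin S x" if uv: "u \<in> adjoin S x" "v \<in> adjoin S x" for u v
  proof -
    obtain p q where *: "u = poly p x" "v = poly q x" "\<forall>i. coeff p i \<in> S" "\<forall>i. coeff q i \<in> S"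
      using uv unfolding adjoin_def by blast
    show "u - v \<in> adjoin S x" using adjoinI[of "p - q" S x] * D by simp
    show "u * v \<in> adjoin S x"
      using adjoinI[of "p * q" S x] * D by (simp add: coeff_mult is_subring_sum[OF assms])
  qed
  then show ?thesis using adjoin_const[OF assms D(2)] unfolding is_subring_def by blast
qed

text \<open>The classical argument with leading coefficients, except that elements of
  \<open>adjoin S x\<close> are values of polynomials at \<open>x\<close> and have no degree of
  their own, as \<open>x\<close> may satisfy relations. Therefore \<open>reps\<close> collects the
  polynomials of degree at most \<open>d\<close> with value in the ideal, and \<open>L\<close> takes
  their coefficients at \<open>d\<close>, zero included.\<close>

theorem hilbert_basis:
  assumes S: "is_subring S" and noeth: "is_noetherian S"
  shows "is_noetherian (adjoin S x)"
  unfolding is_noetherian_def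
proof (intro allI impI)
  note SD = is_subringD[OF S]
  let ?A = "adjoin S x"
  have A: "is_subring ?A" by (rule is_subring_adjoin[OF S])
  fix J assume J: "is_ideal ?A J"
  note JD = is_idealD[OF J]
  define reps where "reps K d = {p. (\<forall>i. coeff p i \<in> S) \<and> (\<forall>i>d. coeff p i = 0) \<and> poly p x \<in> K}" for K d
  define L where "L K d = (\<lambda>p. coeff p d) ` reps K d" for K d
  have xA: "x ^ n \<in> ?A" for n
    by (induction n) (auto intro: is_subringD[OF A] adjoin_self[OF S])
  have L_ideal: "is_ideal S (L K d)" if K: "is_ideal ?A K" for K d
    unfolding is_ideal_def
  proof (intro conjI ballI)
    note KD = is_idealD[OF K]
    show "L K d \<subseteq> S" by (auto simp: L_def reps_def)
    have "0 \<in> reps K d" using SD KD by (auto simp: reps_def)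
    then show "0 \<in> L K d" unfolding L_def by force
    fix u v assume "u \<in> L K d" "v \<in> L K d"
    then obtain p q where "u = coeff p d" "v = coeff q d" "p \<in> reps K d" "q \<in> reps K d" by (auto simp: L_def)
    moreover from this have "p + q \<in> reps K d" using SD KD by (auto simp: reps_def)
    ultimately show "u + v \<in> L K d" unfolding L_def by (metis coeff_add image_eqI)
  next
    note KD = is_idealD[OF K]
    fix a u assume "a \<in> S" "u \<in> L K d"
    then obtain p where "u = coeff p d" "p \<in> reps K d" by (auto simp: L_def)
    moreover from this have "smult a p \<in> reps K d" using SD KD adjoin_const[OF S] \<open>a \<in> S\<close> by (auto simp: reps_def)
    ultimately show "a * u \<in> L K d" unfolding L_def by (metis coeff_smult image_eqI)
  qed
  have shift: "monom 1 k * p \<in> reps K (d + k)" if "is_ideal ?A K" "p \<in> reps K d" for K p d k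
    using that SD xA is_idealD[OF that(1)] by (auto simp: reps_def coeff_monom_mult poly_monom)
  have L_mono: "L J d \<subseteq> L J e" if "d \<le> e" for d e
  proof
    fix u assume "u \<in> L J d"
    then obtain p where "u = coeff p d" "p \<in> reps J d" by (auto simp: L_def)
    then have "u = coeff (monom 1 (e - d) * p) e" "monom 1 (e - d) * p \<in> reps J e"
      using shift[OF J, of p d "e - d"] that by (auto simp: coeff_monom_mult)
    then show "u \<in> L J e" unfolding L_def by blast
  qed
  have "is_ideal S (\<Union>d. L J d)"
    unfolding is_ideal_def
  proof (intro conjI ballI)
    show "(\<Union>d. L J d) \<subseteq> S" using is_idealD(1)[OF L_ideal[OF J]] by blast
    show "0 \<in> (\<Union>d. L J d)" using is_idealD(2)[OF L_ideal[OF J]] by blast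
    show "u + v \<in> (\<Union>d. L J d)" if uv: "u \<in> (\<Union>d. L J d)" "v \<in> (\<Union>d. L J d)" for u v
    proof -
      obtain d e where "u \<in> L J d" "v \<in> L J e" using uv by blast
      then have "u \<in> L J (max d e)" "v \<in> L J (max d e)"
        using L_mono[of d "max d e"] L_mono[of e "max d e"] by auto
      then show ?thesis using is_idealD(3)[OF L_ideal[OF J]] by blast
    qed
    show "a * u \<in> (\<Union>d. L J d)" if "a \<in> S" "u \<in> (\<Union>d. L J d)" for a u
      using that is_idealD(4)[OF L_ideal[OF J]] by blast
  qed
  then obtain G where G: "G \<subseteq> (\<Union>d. L J d)" "finite G" "(\<Union>d. L J d) \<subseteq> ideal_gen S G"
    using noeth unfolding is_noetherian_def by blast
  \<comment> \<open>The \<open>L J d\<close> increase with \<open>d\<close>, so a finite generating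
    set of their union already lies in one of them, and no later one is larger.\<close>
  have "\<exists>D. G \<subseteq> L J D" using G(2,1)
  proof (induction rule: finite_induct)
    case (insert a F)
    then obtain D d where "F \<subseteq> L J D" "a \<in> L J d" by auto
    then have "insert a F \<subseteq> L J (max D d)" using L_mono[of D "max D d"] L_mono[of d "max D d"] by auto
    then show ?case by blast
  qed simp
  then obtain D where D: "G \<subseteq> L J D" by blast
  have LD: "L J n \<subseteq> L J D" for n
    using G(3) ideal_gen_minimal[OF L_ideal[OF J] D] by blast
  have "\<forall>d. \<exists>H\<subseteq>reps J d. finite H \<and> L J d \<subseteq> ideal_gen S ((\<lambda>p. coeff p d) ` H)"
  proof
    fix d
    obtain H where "H \<subseteq> L J d" "finite H" "L J d \<subseteq> ideal_gen S H"
      using noeth L_ideal[OF J] unfolding is_noetherian_def by blast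
    then show "\<exists>H\<subseteq>reps J d. finite H \<and> L J d \<subseteq> ideal_gen S ((\<lambda>p. coeff p d) ` H)"
      unfolding L_def by (metis finite_subset_image)
  qed
  then obtain H where H: "\<And>d. H d \<subseteq> reps J d" "\<And>d. finite (H d)"
    "\<And>d. L J d \<subseteq> ideal_gen S ((\<lambda>p. coeff p d) ` H d)" by metis
  define B where "B = (\<Union>d\<le>D. (\<lambda>p. poly p x) ` H d)"
  have BJ: "B \<subseteq> J" using H(1) by (auto simp: B_def reps_def)
  have BA: "B \<subseteq> ?A" using BJ JD(1) by blast
  define K where "K = ideal_gen ?A B"
  have K: "is_ideal ?A K" unfolding K_def by (rule is_ideal_gen[OF A BA])
  have KJ: "K \<subseteq> J" unfolding K_def by (rule ideal_gen_minimal[OF J BJ])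
  have HK: "H d \<subseteq> reps K d" if "d \<le> D" for d
    using H(1)[of d] that ideal_gen_superset[of B ?A] unfolding K_def reps_def B_def by blast
  have LK: "L J d \<subseteq> L K d" if "d \<le> D" for d
    using H(3)[of d] ideal_gen_minimal[OF L_ideal[OF K], of "(\<lambda>p. coeff p d) ` H d" d] HK[OF that]
    unfolding L_def by blast
  have main: "poly p x \<in> K" if "\<forall>i. coeff p i \<in> S" "\<forall>i\<ge>n. coeff p i = 0" "poly p x \<in> J" for p n
    using that
  proof (induction n arbitrary: p)
    case 0
    then have "p = 0" by (auto intro: poly_eqI)
    then show ?case using is_idealD(2)[OF K] by simp
  next
    case (Suc n)
    have "coeff p n \<in> L J n" using Suc.prems unfolding L_def reps_def by (auto simp: Suc_le_eq)
    \<comment> \<open>Beyond \<open>D\<close> no new leading coefficients arise, so a polynomial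
      from \<open>reps K (min n D)\<close>, shifted up to \<open>n\<close>, cancels the top
      coefficient.\<close>
    then have "coeff p n \<in> L J (min n D)" using LD[of n] by (cases "n \<le> D") (auto simp: min_def)
    then have "coeff p n \<in> L K (min n D)" using LK[of "min n D"] by auto
    then obtain q where q: "coeff p n = coeff q (min n D)" "q \<in> reps K (min n D)" by (auto simp: L_def)
    define q' where "q' = monom 1 (n - min n D) * q"
    have "min n D + (n - min n D) = n" by simp
    then have q': "q' \<in> reps K n" using shift[OF K q(2), of "n - min n D"] unfolding q'_def by simp
    have "coeff q' n = coeff p n" unfolding q(1) by (simp add: q'_def coeff_monom_mult)
    moreover have "coeff p i = 0" "coeff q' i = 0" if "n < i" for i
      using Suc.prems(2) q' that by (auto simp: reps_def)
    ultimately have *: "\<forall>i\<ge>n. coeff (p - q') i = 0" by (auto simp: le_less)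
    have qK: "poly q' x \<in> K" using q' by (simp add: reps_def)
    have "poly (p - q') x \<in> K"
    proof (rule Suc.IH[OF _ *])
      show "\<forall>i. coeff (p - q') i \<in> S" using Suc.prems(1) q' SD by (auto simp: reps_def)
      show "poly (p - q') x \<in> J" using is_ideal_diff[OF A J Suc.prems(3)] qK KJ by auto
    qed
    then show ?case using is_idealD(3)[OF K _ qK, of "poly (p - q') x"] by simp
  qed
  show "\<exists>G\<subseteq>J. finite G \<and> J \<subseteq> ideal_gen ?A G"
  proof (intro exI conjI)
    show "B \<subseteq> J" by (rule BJ)
    show "finite B" using H(2) by (auto simp: B_def)
    show "J \<subseteq> ideal_gen ?A B"
    proof
      fix u assume u: "u \<in> J"
      then obtain p where "u = poly p x" "\<forall>i. coeff p i \<in> S" using JD(1) unfolding adjoin_def by blast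
      then show "u \<in> ideal_gen ?A B"
        using main[of p "Suc (degree p)"] u unfolding K_def by (simp add: coeff_eq_0)
    qed
  qed
qed

section \<open>Polynomials\<close>

abbreviation mdeg :: "(nat \<Rightarrow>\<^sub>0 nat) \<Rightarrow> nat" where
  "mdeg m \<equiv> \<Sum>i\<in>Poly_Mapping.keys m. Poly_Mapping.lookup m i"

lemma mdeg_add: "mdeg (m + n) = mdeg m + mdeg n"
  by (rule setsum_keys_plus_distrib) simp_all

lemma mdeg_single [simp]: "mdeg (Poly_Mapping.single i k) = k"
  by (cases "k = 0") simp_all

lemma sum_single_lookup: "p = (\<Sum>m\<in>Poly_Mapping.keys p. Poly_Mapping.single m (Poly_Mapping.lookup p m))"
proof (rule poly_mapping_eqI)
  fix k
  show "Poly_Mapping.lookup p k = Poly_Mapping.lookup (\<Sum>m\<in>Poly_Mapping.keys p. Poly_Mapping.single m (Poly_Mapping.lookup p m)) k"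
    by (cases "k \<in> Poly_Mapping.keys p") (auto simp: lookup_sum lookup_single when_def in_keys_iff)
qed

lemma Const_0 [simp]: "Const 0 = 0" and Const_1 [simp]: "Const 1 = 1"
  and Const_add: "Const (a + b) = Const a + Const b" and Const_mult: "Const (a * b) = Const a * Const b"
  and Const_minus: "Const (- a) = - Const a"
  by (simp_all add: Const_def single_add mult_single single_diff single_uminus)

lemma Const_mult_single: "Const a * Poly_Mapping.single m b = Poly_Mapping.single m (a * b)"
  by (simp add: Const_def mult_single)

lemma lookup_Const_mult: "Poly_Mapping.lookup (Const a * p) m = a * Poly_Mapping.lookup p m"
  unfolding Const_def mult_map_scale_conv_mult[symmetric] by (simp add: Poly_Mapping.map.rep_eq when_def)

lemma mpoly_induct [case_names zero single add]:
  fixes p :: "'m \<Rightarrow>\<^sub>0 'a::comm_monoid_add"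
  assumes "P 0" "\<And>m c. P (Poly_Mapping.single m c)" "\<And>p q. P p \<Longrightarrow> P q \<Longrightarrow> P (p + q)"
  shows "P p"
proof -
  have "P (\<Sum>m\<in>A. Poly_Mapping.single m (f m))" if "finite A" for A f
    using that by (induction A rule: finite_induct) (auto intro: assms)
  then show ?thesis using sum_single_lookup[of p] by (metis finite_keys)
qed

lemma Var_power: "Var i ^ k = Poly_Mapping.single (Poly_Mapping.single i k) 1"
  by (induction k) (simp_all add: Var_def mult_single flip: single_add single_one)

lemma prod_Var_power:
  "finite A \<Longrightarrow> (\<Prod>i\<in>A. Var i ^ f i) = Poly_Mapping.single (\<Sum>i\<in>A. Poly_Mapping.single i (f i)) 1"
  by (induction A rule: finite_induct) (simp_all add: Var_power mult_single flip: single_one)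

lemma single_eq_prod:
  "Poly_Mapping.single m c = Const c * (\<Prod>i\<in>Poly_Mapping.keys m. Var i ^ Poly_Mapping.lookup m i)"
  by (simp add: prod_Var_power Const_mult_single flip: sum_single_lookup)

lemma polys_singleI: "Poly_Mapping.keys m \<subseteq> {..<N} \<Longrightarrow> Poly_Mapping.single m c \<in> polys N"
  by (auto simp: polys_def)

lemma polys_add: "p \<in> polys N \<Longrightarrow> q \<in> polys N \<Longrightarrow> p + q \<in> polys N"
  using keys_add[of p q] by (fastforce simp: polys_def)

lemma polys_mult: "p \<in> polys N \<Longrightarrow> q \<in> polys N \<Longrightarrow> p * q \<in> polys N"
proof -
  assume pq: "p \<in> polys N" "q \<in> polys N"
  have "Poly_Mapping.keys m \<subseteq> {..<N}" if m: "m \<in> Poly_Mapping.keys (p * q)" for m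
  proof -
    obtain a b where "m = a + b" "a \<in> Poly_Mapping.keys p" "b \<in> Poly_Mapping.keys q"
      using keys_mult[of p q] m by blast
    then show ?thesis using keys_add[of a b] pq unfolding polys_def by blast
  qed
  then show ?thesis unfolding polys_def by blast
qed

lemma polys_Const [simp]: "Const c \<in> polys N" by (simp add: Const_def polys_singleI)

lemma polys_Var: "i < N \<Longrightarrow> Var i \<in> polys N" by (simp add: Var_def polys_singleI)

lemma polys_0 [simp]: "0 \<in> polys N" and polys_1 [simp]: "1 \<in> polys N"
  using polys_Const[of 0 N] polys_Const[of 1 N] by simp_all

lemma polys_minus: "p \<in> polys N \<Longrightarrow> - p \<in> polys N"
  using polys_mult[OF polys_Const[of "- 1" N], of p] by (simp add: Const_minus)

lemma polys_diff: "p \<in> polys N \<Longrightarrow> q \<in> polys N \<Longrightarrow> p - q \<in> polys N"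
  using polys_add[OF _ polys_minus] by fastforce

lemma polys_power: "p \<in> polys N \<Longrightarrow> p ^ k \<in> polys N"
  by (induction k) (auto intro: polys_mult)

lemma polys_sum: "(\<And>i. i \<in> A \<Longrightarrow> f i \<in> polys N) \<Longrightarrow> sum f A \<in> polys N"
  by (induction A rule: infinite_finite_induct) (auto intro: polys_add)

lemma polys_prod: "(\<And>i. i \<in> A \<Longrightarrow> f i \<in> polys N) \<Longrightarrow> prod f A \<in> polys N"
  by (induction A rule: infinite_finite_induct) (auto intro: polys_mult)

lemma is_subring_polys: "is_subring (polys N)"
  by (simp add: is_subring_def polys_diff polys_mult)

lemma polys_induct [consumes 1, case_names Const add Var_mult]:
  assumes "p \<in> polys N" and C: "\<And>c. P (Const c)" and add: "\<And>p q. P p \<Longrightarrow> P q \<Longrightarrow> P (p + q)"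
    and V: "\<And>i p. i < N \<Longrightarrow> p \<in> polys N \<Longrightarrow> P p \<Longrightarrow> P (Var i * p)"
  shows "P p"
proof -
  have pow: "P (Var i ^ k * q) \<and> Var i ^ k * q \<in> polys N" if "i < N" "P q" "q \<in> polys N" for i k q
    using that by (induction k) (auto simp: mult.assoc intro: V polys_mult polys_Var)
  have "P (Const c * (\<Prod>i\<in>A. Var i ^ f i)) \<and> Const c * (\<Prod>i\<in>A. Var i ^ f i) \<in> polys N"
    if "finite A" "A \<subseteq> {..<N}" for A c f
    using that
  proof (induction A rule: finite_induct)
    case (insert i A)
    then show ?case using pow[of i "Const c * (\<Prod>i\<in>A. Var i ^ f i)" "f i"] by (simp add: mult.left_commute)
  qed (simp add: C)
  then have single: "P (Poly_Mapping.single m c)" if "Poly_Mapping.keys m \<subseteq> {..<N}" for m c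
    using that by (simp add: single_eq_prod)
  have "P (\<Sum>m\<in>A. Poly_Mapping.single m (Poly_Mapping.lookup p m))" if "finite A" "A \<subseteq> Poly_Mapping.keys p" for A
    using that
  proof (induction A rule: finite_induct)
    case empty then show ?case using C[of 0] by simp
  next
    case (insert m A)
    then show ?case using assms(1) by (auto intro!: add single simp: polys_def)
  qed
  then show ?thesis using sum_single_lookup[of p] by (metis finite_keys order_refl)
qed

lemma formsD: "p \<in> forms N d \<Longrightarrow> p \<in> polys N" by (simp add: forms_def)

lemma forms_add: "p \<in> forms N d \<Longrightarrow> q \<in> forms N d \<Longrightarrow> p + q \<in> forms N d"
  using keys_add[of p q] polys_add by (fastforce simp: forms_def)

lemma forms_mult: "p \<in> forms N d \<Longrightarrow> q \<in> forms N e \<Longrightarrow> p * q \<in> forms N (d + e)"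
proof -
  assume pq: "p \<in> forms N d" "q \<in> forms N e"
  have "mdeg m = d + e" if m: "m \<in> Poly_Mapping.keys (p * q)" for m
  proof -
    obtain a b where "m = a + b" "a \<in> Poly_Mapping.keys p" "b \<in> Poly_Mapping.keys q"
      using keys_mult[of p q] m by blast
    then show ?thesis using pq by (simp add: forms_def mdeg_add)
  qed
  then show ?thesis using pq polys_mult unfolding forms_def by blast
qed

lemma forms_0 [simp]: "0 \<in> forms N d" by (simp add: forms_def)

lemma forms_Const [simp]: "Const c \<in> forms N 0" by (simp add: forms_def) (simp add: Const_def)

lemma forms_Const_mult: "p \<in> forms N d \<Longrightarrow> Const c * p \<in> forms N d"
  using forms_mult[OF forms_Const] by fastforce

lemma forms_minus: "p \<in> forms N d \<Longrightarrow> - p \<in> forms N d"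
  using forms_Const_mult[of p N d "- 1"] by (simp add: Const_minus)

lemma forms_diff: "p \<in> forms N d \<Longrightarrow> q \<in> forms N d \<Longrightarrow> p - q \<in> forms N d"
  using forms_add[OF _ forms_minus] by fastforce

lemma forms_sum: "(\<And>i. i \<in> A \<Longrightarrow> f i \<in> forms N d) \<Longrightarrow> sum f A \<in> forms N d"
  by (induction A rule: infinite_finite_induct) (auto intro: forms_add)

lemma forms_Var: "i < N \<Longrightarrow> Var i \<in> forms N 1"
  by (simp add: forms_def polys_Var) (simp add: Var_def)

lemma forms_1 [simp]: "1 \<in> forms N 0" using forms_Const[of 1] by simp

lemma forms_power: "p \<in> forms N d \<Longrightarrow> p ^ k \<in> forms N (k * d)"
  by (induction k) (auto intro: forms_mult)

text \<open>Extension of a map on monomials to polynomials, with coefficients passed through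
  \<open>C\<close>. Substitution, first order jets, extraction of exponent classes and division by
  \<open>t^r\<close> are all instances, so additivity and multiplicativity are proved once.\<close>

definition lin :: "('k \<Rightarrow> 'b) \<Rightarrow> ('m \<Rightarrow> 'b) \<Rightarrow> ('m \<Rightarrow>\<^sub>0 'k::comm_ring_1) \<Rightarrow> 'b::comm_ring_1" where
  "lin C g p = (\<Sum>m\<in>Poly_Mapping.keys p. C (Poly_Mapping.lookup p m) * g m)"

definition coeff_hom :: "('k::comm_ring_1 \<Rightarrow> 'b::comm_ring_1) \<Rightarrow> bool" where
  "coeff_hom C \<longleftrightarrow> C 0 = 0 \<and> C 1 = 1 \<and> (\<forall>a b. C (a + b) = C a + C b) \<and> (\<forall>a b. C (a * b) = C a * C b)"

lemma coeff_homD: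
  assumes "coeff_hom C"
  shows "C 0 = 0" "C 1 = 1" "C (a + b) = C a + C b" "C (a * b) = C a * C b"
  using assms by (simp_all add: coeff_hom_def)

lemma coeff_hom_Const: "coeff_hom Const"
  by (simp add: coeff_hom_def Const_add Const_mult)

lemma lin_superset:
  assumes "coeff_hom C" "finite A" "Poly_Mapping.keys p \<subseteq> A"
  shows "lin C g p = (\<Sum>m\<in>A. C (Poly_Mapping.lookup p m) * g m)"
  unfolding lin_def using assms
  by (intro sum.mono_neutral_left) (auto simp: in_keys_iff coeff_homD)

lemma lin_0 [simp]: "lin C g 0 = 0" by (simp add: lin_def)

lemma lin_single: "coeff_hom C \<Longrightarrow> lin C g (Poly_Mapping.single m c) = C c * g m"
  using lin_superset[of C "{m}" "Poly_Mapping.single m c" g] by (simp add: lin_superset)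

lemma lin_add:
  assumes "coeff_hom C"
  shows "lin C g (p + q) = lin C g p + lin C g q"
proof -
  let ?A = "Poly_Mapping.keys p \<union> Poly_Mapping.keys q"
  have "lin C g (p + q) = (\<Sum>m\<in>?A. C (Poly_Mapping.lookup (p + q) m) * g m)"
    using assms keys_add[of p q] by (intro lin_superset) auto
  also have "\<dots> = (\<Sum>m\<in>?A. C (Poly_Mapping.lookup p m) * g m) + (\<Sum>m\<in>?A. C (Poly_Mapping.lookup q m) * g m)"
    using assms by (simp add: lookup_add coeff_homD distrib_right sum.distrib)
  also have "\<dots> = lin C g p + lin C g q"
    using assms by (simp add: lin_superset[of C ?A])
  finally show ?thesis .
qed

lemma lin_Const_mult:
  assumes "coeff_hom C"
  shows "lin C g (Const a * p) = C a * lin C g p"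
  by (induction p rule: mpoly_induct)
    (simp_all add: assms Const_mult_single lin_single lin_add coeff_homD algebra_simps)

lemma lin_mult:
  fixes p q :: "'k::field mpoly"
  assumes "coeff_hom C" "\<And>m n. g (m + n) = g m * g n"
  shows "lin C g (p * q) = lin C g p * lin C g q"
proof (induction p rule: mpoly_induct)
  case (single m c)
  show ?case
    by (induction q rule: mpoly_induct)
      (simp_all add: assms mult_single lin_single lin_add coeff_homD algebra_simps)
qed (simp_all add: assms lin_add algebra_simps)

lemma lin_minus: "coeff_hom C \<Longrightarrow> lin C g (- p) = - lin C g (p :: 'k::field mpoly)"
  using lin_add[of C g "- p" p] by (simp add: eq_neg_iff_add_eq_0)

lemma lin_diff: "coeff_hom C \<Longrightarrow> lin C g (p - q) = lin C g p - lin C g (q :: 'k::field mpoly)"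
  using lin_add[of C g p "- q"] lin_minus[of C g q] by simp

lemma lin_sum: "coeff_hom C \<Longrightarrow> lin C g (sum f A) = (\<Sum>i\<in>A. lin C g (f i))"
  by (induction A rule: infinite_finite_induct) (simp_all add: lin_add)

definition meval :: "(nat \<Rightarrow> 'b) \<Rightarrow> (nat \<Rightarrow>\<^sub>0 nat) \<Rightarrow> 'b::comm_ring_1" where
  "meval c m = (\<Prod>i\<in>Poly_Mapping.keys m. c i ^ Poly_Mapping.lookup m i)"

lemma meval_superset: "finite A \<Longrightarrow> Poly_Mapping.keys m \<subseteq> A \<Longrightarrow> meval c m = (\<Prod>i\<in>A. c i ^ Poly_Mapping.lookup m i)"
  unfolding meval_def by (intro prod.mono_neutral_left) (auto simp: in_keys_iff)

lemma meval_add: "meval c (m + n) = meval c m * meval c n"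
proof -
  let ?A = "Poly_Mapping.keys m \<union> Poly_Mapping.keys n"
  have "meval c (m + n) = (\<Prod>i\<in>?A. c i ^ Poly_Mapping.lookup (m + n) i)"
    using keys_add[of m n] by (intro meval_superset) auto
  then show ?thesis
    by (simp add: meval_superset[of ?A] lookup_add power_add prod.distrib)
qed

lemma meval_single [simp]: "meval c (Poly_Mapping.single i k) = c i ^ k"
  by (simp add: meval_superset[of "{i}"])

lemma meval_0 [simp]: "meval c 0 = 1" by (simp add: meval_def)

lemma subst_eq_lin: "subst c = lin Const (meval c)"
  by (simp add: fun_eq_iff subst_def lin_def meval_def)

lemma subst_0 [simp]: "subst c 0 = 0" and subst_1 [simp]: "subst c 1 = 1"
  and subst_add: "subst c (p + q) = subst c p + subst c q"
  and subst_diff: "subst c (p - q) = subst c p - subst c q"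
  and subst_minus: "subst c (- p) = - subst c p"
  and subst_mult: "subst c (p * q) = subst c p * subst c q"
  and subst_Const [simp]: "subst c (Const a) = Const a"
  and subst_Var [simp]: "subst c (Var i) = c i"
proof -
  show C: "subst c (Const a) = Const a" for a :: 'a
    using lin_single[OF coeff_hom_Const, of "meval c" 0 a] by (simp add: subst_eq_lin flip: Const_def)
  show "subst c 1 = 1" using C[of 1] by simp
  show "subst c (Var i) = c i"
    unfolding subst_eq_lin by (simp add: Var_def lin_single[OF coeff_hom_Const])
qed (simp_all add: subst_eq_lin lin_add lin_diff lin_minus lin_mult coeff_hom_Const meval_add)

lemma subst_power: "subst c (p ^ k) = subst c p ^ k"
  by (induction k) (simp_all add: subst_mult)

lemma subst_sum: "subst c (sum f A) = (\<Sum>i\<in>A. subst c (f i))"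
  unfolding subst_eq_lin by (rule lin_sum[OF coeff_hom_Const])

text \<open>Adjoining \<open>Var N\<close> to \<open>polys N\<close> gives
  \<open>polys (Suc N)\<close>; the induction starts from the constants, where a nonzero element of
  an ideal is a unit.\<close>

lemma is_noetherian_polys: "is_noetherian (polys N :: 'k::field mpoly set)"
proof (induction N)
  case 0
  have P0: "p \<in> range Const" if "p \<in> polys 0" for p :: "'k mpoly"
    using that
  proof (induction p rule: polys_induct)
    case (add p q) then show ?case by (auto simp flip: Const_add)
  qed auto
  show ?case unfolding is_noetherian_def
  proof (intro allI impI)
    fix J :: "'k mpoly set" assume J: "is_ideal (polys 0) J"
    show "\<exists>G\<subseteq>J. finite G \<and> J \<subseteq> ideal_gen (polys 0) G"
    proof (cases "J = {0}")
      case True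
      then show ?thesis using ideal_gen_superset[of "{0}"] by (intro exI[of _ "{0}"]) auto
    next
      case False
      then obtain p where p: "p \<in> J" "p \<noteq> 0" using is_idealD(2)[OF J] by blast
      then obtain c where c: "p = Const c" using P0[OF is_idealD(1)[OF J p(1)]] by auto
      with p(2) have "c \<noteq> 0" by auto
      have "x \<in> ideal_gen (polys 0) {p}" if "x \<in> J" for x
      proof -
        have "x * Const (inverse c) * p \<in> ideal_gen (polys 0) {p}"
          using is_idealD(1)[OF J] that p(1) ideal_gen_superset[of "{p}" "polys 0"]
          by (intro is_idealD(4)[OF is_ideal_gen[OF is_subring_polys]] polys_mult) auto
        then show ?thesis using c \<open>c \<noteq> 0\<close> by (simp add: mult.assoc flip: Const_mult)
      qed
      then show ?thesis using p(1) by (intro exI[of _ "{p}"]) auto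
    qed
  qed
next
  case (Suc N)
  have sub: "is_subring (adjoin (polys N) (Var N) :: 'k mpoly set)"
    by (rule is_subring_adjoin[OF is_subring_polys])
  note D = is_subringD[OF sub]
  have poly_sub: "p \<in> polys (Suc N)" if "p \<in> polys N" for p :: "'k mpoly"
    using that by (force simp: polys_def)
  have "adjoin (polys N) (Var N) = (polys (Suc N) :: 'k mpoly set)"
  proof (intro subset_antisym subsetI)
    fix p :: "'k mpoly" assume "p \<in> adjoin (polys N) (Var N)"
    then obtain q where "p = poly q (Var N)" "\<forall>i. coeff q i \<in> polys N" unfolding adjoin_def by blast
    then show "p \<in> polys (Suc N)"
      by (simp add: poly_altdef) (intro polys_sum polys_mult polys_power polys_Var poly_sub; simp)
  next
    fix p :: "'k mpoly" assume "p \<in> polys (Suc N)"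
    then show "p \<in> adjoin (polys N) (Var N)"
    proof (induction rule: polys_induct)
      case (Const c) show ?case by (rule adjoin_const[OF is_subring_polys]) simp
    next
      case (add p q) then show ?case by (rule D(5))
    next
      case (Var_mult i p)
      have "Var i \<in> adjoin (polys N) (Var N)"
        using adjoin_self[OF is_subring_polys] adjoin_const[OF is_subring_polys polys_Var[of i N]] Var_mult(1)
        by (cases "i = N") auto
      then show ?case using Var_mult D(6) by blast
    qed
  qed
  then show ?case using hilbert_basis[OF is_subring_polys Suc.IH, of "Var N"] by simp
qed

section \<open>Frobenius algebras over a polynomial ring in two variables\<close>

lemma poly_ring_simps [simp]:
  "carrier (poly_ring N) = polys N" "x \<otimes>\<^bsub>poly_ring N\<^esub> y = x * y" "\<one>\<^bsub>poly_ring N\<^esub> = 1"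
  "\<zero>\<^bsub>poly_ring N\<^esub> = 0" "x \<oplus>\<^bsub>poly_ring N\<^esub> y = x + y"
  by (simp_all add: poly_ring_def)

lemma cring_poly_ring: "cring (poly_ring N :: 'k::field mpoly ring)"
proof (rule cringI)
  show "abelian_group (poly_ring N :: 'k mpoly ring)"
    by (rule abelian_groupI) (auto simp: polys_add add.assoc add.commute intro!: bexI[of _ "- _"] polys_minus)
  show "Group.comm_monoid (poly_ring N :: 'k mpoly ring)"
    by (rule comm_monoidI) (auto simp: polys_mult mult.assoc mult.commute)
qed (simp add: distrib_right)

section \<open>The quotient ring and its modules coinduced from \<open>K\<close>\<close>

locale homogeneous_coordinate_ring =
  fixes N :: nat and I :: "'k::field mpoly set"
  assumes I: "is_ideal (polys N) I"
begin

abbreviation "A \<equiv> poly_ring N Quot I"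

sublocale R: cring "poly_ring N :: 'k mpoly ring" by (rule cring_poly_ring)

lemma ideal_I: "ideal I (poly_ring N)"
  by (rule R.ideal_if_closed) (use is_idealD[OF I] in auto)

sublocale I: ideal I "poly_ring N" by (rule ideal_I)

sublocale A: cring A by (rule I.quotient_is_cring[OF cring_poly_ring])

definition cs :: "'k mpoly \<Rightarrow> 'k mpoly set" where "cs F = I +>\<^bsub>poly_ring N\<^esub> F"

lemma cs_def': "cs F = (\<lambda>h. h + F) ` I"
  by (auto simp: cs_def a_r_coset_def')

lemma I_minus: "h \<in> I \<Longrightarrow> - h \<in> I"
  using is_ideal_diff[OF is_subring_polys I is_idealD(2)[OF I]] by fastforce

lemma cs_eq_iff: "cs F = cs G \<longleftrightarrow> F - G \<in> I"
proof
  assume "cs F = cs G"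
  then have "F \<in> cs G" using is_idealD(2)[OF I] by (force simp: cs_def')
  then show "F - G \<in> I" by (auto simp: cs_def')
next
  assume d: "F - G \<in> I"
  have "h + F \<in> cs G" "h + G \<in> cs F" if "h \<in> I" for h
  proof -
    have "h + F = (h + (F - G)) + G" "h + G = (h + - (F - G)) + F" by simp_all
    then show "h + F \<in> cs G" "h + G \<in> cs F"
      unfolding cs_def' using is_idealD(3)[OF I that d] is_idealD(3)[OF I that I_minus[OF d]] by blast+
  qed
  then show "cs F = cs G" by (auto simp: cs_def')
qed

lemma carrier_A: "carrier A = cs ` polys N"
  by (auto simp: FactRing_def A_RCOSETS_def' cs_def)

lemma A_cases: "X \<in> carrier A \<Longrightarrow> (\<And>F. X = cs F \<Longrightarrow> F \<in> polys N \<Longrightarrow> thesis) \<Longrightarrow> thesis"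
  unfolding carrier_A by blast

lemma cs_carrier [simp]: "F \<in> polys N \<Longrightarrow> cs F \<in> carrier A" by (simp add: carrier_A)

lemma cs_add: "F \<in> polys N \<Longrightarrow> G \<in> polys N \<Longrightarrow> cs F \<oplus>\<^bsub>A\<^esub> cs G = cs (F + G)"
  using I.a_rcos_sum[of F G] by (simp add: FactRing_def cs_def)

lemma cs_mult: "F \<in> polys N \<Longrightarrow> G \<in> polys N \<Longrightarrow> cs F \<otimes>\<^bsub>A\<^esub> cs G = cs (F * G)"
  using I.rcoset_mult_add[of F G] by (simp add: FactRing_def cs_def)

lemma cs_0: "\<zero>\<^bsub>A\<^esub> = cs 0" and cs_1: "\<one>\<^bsub>A\<^esub> = cs 1"
proof -
  show "\<zero>\<^bsub>A\<^esub> = cs 0" by (simp add: FactRing_def cs_def')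
  show "\<one>\<^bsub>A\<^esub> = cs 1" by (simp add: FactRing_def cs_def)
qed

lemma noetherian_A: "noetherian_ring A"
proof (rule A.noetherian_ringI)
  fix J assume J: "ideal J A"
  interpret J: ideal J A by fact
  define J0 where "J0 K = {F \<in> polys N. cs F \<in> K}" for K
  have J0: "is_ideal (polys N) (J0 K)" if "ideal K A" for K
  proof -
    interpret K: ideal K A by fact
    show ?thesis unfolding is_ideal_def J0_def
      using K.zero_closed K.a_closed K.I_l_closed
      by (auto simp: polys_add polys_mult cs_0 simp flip: cs_add cs_mult)
  qed
  obtain G where G: "G \<subseteq> J0 J" "finite G" "J0 J \<subseteq> ideal_gen (polys N) G"
    using is_noetherian_polys J0[OF J] unfolding is_noetherian_def by blast
  have GN: "G \<subseteq> polys N" using G(1) by (auto simp: J0_def)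
  have csG: "cs ` G \<subseteq> carrier A" using GN by auto
  have "J = Idl\<^bsub>A\<^esub> (cs ` G)"
  proof
    show "Idl\<^bsub>A\<^esub> (cs ` G) \<subseteq> J" by (rule A.genideal_minimal[OF J]) (use G(1) in \<open>auto simp: J0_def\<close>)
    have "G \<subseteq> J0 (Idl\<^bsub>A\<^esub> (cs ` G))"
      using A.genideal_self[OF csG] GN by (auto simp: J0_def)
    then have "J0 J \<subseteq> J0 (Idl\<^bsub>A\<^esub> (cs ` G))"
      using G(3) ideal_gen_minimal[OF J0[OF A.genideal_ideal[OF csG]]] by blast
    then show "J \<subseteq> Idl\<^bsub>A\<^esub> (cs ` G)"
      using J.a_subset by (auto simp: J0_def carrier_A)
  qed
  then show "\<exists>B\<subseteq>carrier A. finite B \<and> J = Idl\<^bsub>A\<^esub> B" using G(2) csG by blast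
qed

text \<open>The dual \<open>Hom\<^sub>K(A, K[a, b])\<close>, as maps on representatives that vanish on \<open>I\<close> and (by convention) outside the polynomial ring.\<close>

definition HK :: "('k mpoly \<Rightarrow> 'k mpoly) set" where
  "HK = {f. (\<forall>F. f F \<in> polys 2) \<and> (\<forall>F. F \<notin> polys N \<longrightarrow> f F = 0) \<and> (\<forall>F\<in>I. f F = 0) \<and>
     (\<forall>F\<in>polys N. \<forall>G\<in>polys N. f (F + G) = f F + f G) \<and> (\<forall>c. \<forall>F\<in>polys N. f (Const c * F) = Const c * f F)}"

text \<open>A coset acts through a chosen representative; the choice is immaterial on
  \<open>HK\<close>, whose members vanish on the ideal, see \<open>act_cs\<close>.\<close>

definition act :: "'k mpoly set \<Rightarrow> ('k mpoly \<Rightarrow> 'k mpoly) \<Rightarrow> 'k mpoly \<Rightarrow> 'k mpoly" where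
  "act X f = (\<lambda>z. if z \<in> polys N then f ((SOME F. F \<in> X) * z) else 0)"

lemma HKD:
  assumes "f \<in> HK"
  shows "\<And>F. f F \<in> polys 2" "\<And>F. F \<notin> polys N \<Longrightarrow> f F = 0" "\<And>F. F \<in> I \<Longrightarrow> f F = 0"
    "\<And>F G. F \<in> polys N \<Longrightarrow> G \<in> polys N \<Longrightarrow> f (F + G) = f F + f G"
    "\<And>c F. F \<in> polys N \<Longrightarrow> f (Const c * F) = Const c * f F"
  using assms by (simp_all add: HK_def)

lemma HKI:
  assumes "\<And>F. F \<in> polys N \<Longrightarrow> f F \<in> polys 2" "\<And>F. F \<notin> polys N \<Longrightarrow> f F = 0" "\<And>F. F \<in> I \<Longrightarrow> f F = 0"
    "\<And>F G. F \<in> polys N \<Longrightarrow> G \<in> polys N \<Longrightarrow> f (F + G) = f F + f G"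
    "\<And>c F. F \<in> polys N \<Longrightarrow> f (Const c * F) = Const c * f F"
  shows "f \<in> HK"
proof -
  have "f F \<in> polys 2" for F using assms(1,2)[of F] by (cases "F \<in> polys N") auto
  then show ?thesis using assms(2-) by (auto simp: HK_def)
qed

lemmas ID = is_idealD[OF I]

lemma HK_diff:
  assumes "f \<in> HK" "F \<in> polys N" "G \<in> polys N"
  shows "f (F - G) = f F - f G"
  using HKD(4)[OF assms(1) polys_diff[OF assms(2,3)] assms(3)] by simp

lemma HK_cong: "f \<in> HK \<Longrightarrow> F \<in> polys N \<Longrightarrow> G \<in> polys N \<Longrightarrow> F - G \<in> I \<Longrightarrow> f F = f G"
  using HK_diff[of f F G] HKD(3)[of f "F - G"] by simp

lemma HK_sum:
  assumes "f \<in> HK" "\<And>i. i \<in> S \<Longrightarrow> g i \<in> polys N"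
  shows "f (sum g S) = (\<Sum>i\<in>S. f (g i))"
  using assms(2)
proof (induction S rule: infinite_finite_induct)
  case (insert i S)
  then show ?case by (simp add: HKD(4)[OF assms(1)] polys_sum)
qed (use HKD(3)[OF assms(1) ID(2)] in auto)

lemma zero_HK: "(\<lambda>_. 0) \<in> HK" by (rule HKI) auto

lemma add_HK: "f \<in> HK \<Longrightarrow> g \<in> HK \<Longrightarrow> (\<lambda>z. f z + g z) \<in> HK"
  by (rule HKI) (simp_all add: HKD polys_add distrib_left)

lemma diff_HK: "f \<in> HK \<Longrightarrow> g \<in> HK \<Longrightarrow> (\<lambda>z. f z - g z) \<in> HK"
  by (rule HKI) (simp_all add: HKD right_diff_distrib polys_diff)

lemma mult_HK: "f \<in> HK \<Longrightarrow> G \<in> polys N \<Longrightarrow> (\<lambda>z. if z \<in> polys N then f (G * z) else 0) \<in> HK"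
  by (rule HKI)
    (auto simp: HKD polys_mult polys_add distrib_left mult.left_commute[of G] ID(1,4) intro: HKD(3))

lemma act_cs:
  assumes "f \<in> HK" "F \<in> polys N"
  shows "act (cs F) f = (\<lambda>z. if z \<in> polys N then f (F * z) else 0)"
proof
  fix z
  define G where "G = (SOME G. G \<in> cs F)"
  have "F \<in> cs F" using ID(2) by (force simp: cs_def')
  then have "G \<in> cs F" unfolding G_def by (rule someI)
  then have d: "G - F \<in> I" by (auto simp: cs_def')
  then have GN: "G \<in> polys N" using polys_add[OF ID(1)[OF d] assms(2)] by simp
  have "f (G * z) = f (F * z)" if z: "z \<in> polys N"
  proof (rule HK_cong[OF assms(1)])
    show "G * z - F * z \<in> I" using ID(4)[OF z d] by (simp add: algebra_simps)
  qed (use GN assms z in \<open>auto intro: polys_mult\<close>)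
  then show "act (cs F) f z = (if z \<in> polys N then f (F * z) else 0)"
    by (simp add: act_def G_def)
qed

lemma act_HK: "X \<in> carrier A \<Longrightarrow> f \<in> HK \<Longrightarrow> act X f \<in> HK"
  by (elim A_cases) (simp add: act_cs mult_HK)

lemma act_zero [simp]: "act X (\<lambda>_. 0) = (\<lambda>_. 0)" by (simp add: act_def fun_eq_iff)

text \<open>Pairs, so that all terms of the resolution, from the product \<open>E \<times> E\<close>
  in the middle to the zero modules at the end, have one element type.\<close>

definition hk_module :: "('k mpoly \<Rightarrow> 'k mpoly) set \<Rightarrow> ('k mpoly \<Rightarrow> 'k mpoly) set \<Rightarrow>
    ('k mpoly set, ('k mpoly \<Rightarrow> 'k mpoly) \<times> ('k mpoly \<Rightarrow> 'k mpoly)) module" where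
  "hk_module X Y = \<lparr>carrier = X \<times> Y, monoid.mult = undefined, one = undefined,
     ring.zero = (\<lambda>_. 0, \<lambda>_. 0),
     add = (\<lambda>p q. (\<lambda>z. fst p z + fst q z, \<lambda>z. snd p z + snd q z)),
     module.smult = (\<lambda>c p. (act c (fst p), act c (snd p)))\<rparr>"

definition hk_summand :: "('k mpoly \<Rightarrow> 'k mpoly) set \<Rightarrow> bool" where
  "hk_summand X \<longleftrightarrow> X = HK \<or> X = {\<lambda>_. 0}"

lemma hk_summandD:
  assumes "hk_summand X"
  shows "X \<subseteq> HK" "(\<lambda>_. 0) \<in> X" "\<And>f g. f \<in> X \<Longrightarrow> g \<in> X \<Longrightarrow> (\<lambda>z. f z + g z) \<in> X"
    "\<And>f. f \<in> X \<Longrightarrow> (\<lambda>z. - f z) \<in> X" "\<And>c f. c \<in> carrier A \<Longrightarrow> f \<in> X \<Longrightarrow> act c f \<in> X"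
  using assms diff_HK[OF zero_HK] unfolding hk_summand_def by (auto simp: zero_HK add_HK act_HK)

lemma hk_module:
  assumes "hk_summand X" "hk_summand Y"
  shows "module A (hk_module X Y)"
proof (rule moduleI)
  note X = hk_summandD[OF assms(1)] and Y = hk_summandD[OF assms(2)]
  have XH: "f \<in> HK" if "f \<in> X \<or> f \<in> Y" for f using that X(1) Y(1) by auto
  show "cring A" by unfold_locales
  show "abelian_group (hk_module X Y)"
  proof (rule abelian_groupI)
    fix p assume "p \<in> carrier (hk_module X Y)"
    then show "\<exists>q\<in>carrier (hk_module X Y). q \<oplus>\<^bsub>hk_module X Y\<^esub> p = \<zero>\<^bsub>hk_module X Y\<^esub>"
      using X(4) Y(4)
      by (intro bexI[of _ "(\<lambda>z. - fst p z, \<lambda>z. - snd p z)"]) (auto simp: hk_module_def)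
  qed (auto simp: hk_module_def X Y algebra_simps)
  show "\<one>\<^bsub>A\<^esub> \<odot>\<^bsub>hk_module X Y\<^esub> r = r" if "r \<in> carrier (hk_module X Y)" for r
  proof -
    have "fst r \<in> HK" "snd r \<in> HK" using that XH by (auto simp: hk_module_def)
    then show ?thesis
      by (cases r) (auto simp: hk_module_def cs_1 act_cs fun_eq_iff HKD)
  qed
  fix c d p q assume "c \<in> carrier A" "d \<in> carrier A" and p: "p \<in> carrier (hk_module X Y)" and q: "q \<in> carrier (hk_module X Y)"
  then obtain F G where c: "c = cs F" "F \<in> polys N" and d: "d = cs G" "G \<in> polys N" by (elim A_cases)
  have H: "fst p \<in> HK" "snd p \<in> HK" "fst q \<in> HK" "snd q \<in> HK"
    using p q XH by (auto simp: hk_module_def)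
  show "c \<odot>\<^bsub>hk_module X Y\<^esub> p \<in> carrier (hk_module X Y)"
    using p c X(5) Y(5) by (auto simp: hk_module_def)
  show "(c \<oplus>\<^bsub>A\<^esub> d) \<odot>\<^bsub>hk_module X Y\<^esub> p = c \<odot>\<^bsub>hk_module X Y\<^esub> p \<oplus>\<^bsub>hk_module X Y\<^esub> d \<odot>\<^bsub>hk_module X Y\<^esub> p"
    using c d H by (auto simp: hk_module_def cs_add act_cs polys_add polys_mult fun_eq_iff distrib_right HKD)
  show "c \<odot>\<^bsub>hk_module X Y\<^esub> (p \<oplus>\<^bsub>hk_module X Y\<^esub> q) = c \<odot>\<^bsub>hk_module X Y\<^esub> p \<oplus>\<^bsub>hk_module X Y\<^esub> c \<odot>\<^bsub>hk_module X Y\<^esub> q"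
    using c H by (auto simp: hk_module_def act_cs fun_eq_iff add_HK)
  show "(c \<otimes>\<^bsub>A\<^esub> d) \<odot>\<^bsub>hk_module X Y\<^esub> p = c \<odot>\<^bsub>hk_module X Y\<^esub> (d \<odot>\<^bsub>hk_module X Y\<^esub> p)"
    using c d H mult_HK[OF _ d(2)]
    by (auto simp: hk_module_def cs_mult act_cs polys_mult fun_eq_iff mult.assoc mult.left_commute)
qed

text \<open>The module \<open>Hom\<^sub>K(A, K[a, b])\<close> is coinduced from \<open>K\<close>: a homomorphism from an ideal \<open>J\<close> amounts to a \<open>K\<close>-linear map on \<open>J\<close>, which extends to \<open>A\<close>.\<close>

lemma baer_HK:
  assumes J: "ideal J A" and hC: "\<And>x. x \<in> J \<Longrightarrow> h x \<in> HK"
    and hadd: "\<And>x y. x \<in> J \<Longrightarrow> y \<in> J \<Longrightarrow> h (x \<oplus>\<^bsub>A\<^esub> y) = (\<lambda>z. h x z + h y z)"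
    and hmult: "\<And>a x. a \<in> carrier A \<Longrightarrow> x \<in> J \<Longrightarrow> h (a \<otimes>\<^bsub>A\<^esub> x) = act a (h x)"
  shows "\<exists>\<xi>\<in>HK. \<forall>x\<in>J. h x = act x \<xi>"
proof -
  interpret J: ideal J A by fact
  interpret vp: vector_space_pair "\<lambda>a (p :: 'k mpoly). Const a * p" "\<lambda>a (p :: 'k mpoly). Const a * p"
    by unfold_locales
  define J0 where "J0 = {F \<in> polys N. cs F \<in> J}"
  \<comment> \<open>Evaluation at \<open>1\<close> turns \<open>h\<close> into a
    \<open>K\<close>-linear map with values in \<open>polys 2\<close>, and
    \<open>h (cs F) z = lam (F * z)\<close> recovers \<open>h\<close> from it.\<close>
  define lam where "lam F = h (cs F) 1" for F
  have J0: "cs F \<in> J" "F \<in> polys N" if "F \<in> J0" for F using that by (auto simp: J0_def)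
  have J0_mult: "G * F \<in> J0" if "F \<in> J0" "G \<in> polys N" for F G
    using J.I_l_closed[OF J0(1)[OF that(1)], of "cs G"] that J0[OF that(1)] by (simp add: J0_def polys_mult cs_mult)
  have J0_add: "F + G \<in> J0" if "F \<in> J0" "G \<in> J0" for F G
    using J.a_closed[OF J0(1)[OF that(1)] J0(1)[OF that(2)]] J0[OF that(1)] J0[OF that(2)]
    by (simp add: J0_def polys_add cs_add)
  have IJ0: "F \<in> J0" if "F \<in> I" for F
    using J.zero_closed that cs_eq_iff[of F 0] ID(1) by (simp add: J0_def cs_0)
  have sub: "mpoly.subspace J0"
    by (rule mpoly.subspaceI) (use IJ0[OF ID(2)] J0_add J0_mult in auto)
  have add0: "lam (F + G) = lam F + lam G" if "F \<in> J0" "G \<in> J0" for F G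
    unfolding lam_def using hadd[OF J0(1)[OF that(1)] J0(1)[OF that(2)]] J0[OF that(1)] J0[OF that(2)] by (simp add: cs_add)
  have mult0: "h (cs F) z = lam (F * z)" if "F \<in> J0" "z \<in> polys N" for F z
    using hmult[of "cs z" "cs F"] J0[OF that(1)] that(2) hC[OF J0(1)[OF that(1)]]
    by (simp add: lam_def cs_mult act_cs mult.commute)
  have scale0: "lam (Const c * F) = Const c * lam F" if "F \<in> J0" for c F
    using mult0[OF that, of "Const c"] HKD(5)[OF hC[OF J0(1)[OF that]], of 1 c]
    by (simp add: lam_def mult.commute)
  have zero0: "lam F = 0" if "F \<in> I" for F
    using scale0[OF IJ0[OF ID(2)], of 0] cs_eq_iff[of F 0] that by (simp add: lam_def)
  \<comment> \<open>The extension of \<open>lam\<close> has to be linear over \<open>K\<close> only,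
    so a \<open>K\<close>-basis of \<open>J0\<close> suffices. Its values stay in the span of
    \<open>lam\<close> on \<open>B\<close>, hence in two variables.\<close>
  obtain B where B: "B \<subseteq> J0" "mpoly.independent B" "J0 \<subseteq> mpoly.span B"
    using mpoly.maximal_independent_subset by blast
  define Lam where "Lam = vp.construct B lam"
  have lin: "Vector_Spaces.linear (\<lambda>a (p :: 'k mpoly). Const a * p) (\<lambda>a (p :: 'k mpoly). Const a * p) Lam"
    unfolding Lam_def by (rule vp.linear_construct[OF B(2)])
  note lin_add = vp.linear_add[OF lin] and lin_scale = vp.linear_scale[OF lin]
  have P2: "mpoly.subspace (polys 2 :: 'k mpoly set)"
    by (rule mpoly.subspaceI) (auto intro: polys_add polys_mult)
  have "Lam F \<in> mpoly.span (lam ` B)" for F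
    unfolding Lam_def by (rule vp.construct_in_span[OF B(2)])
  moreover have "mpoly.span (lam ` B) \<subseteq> polys 2"
    by (rule mpoly.span_minimal[OF _ P2]) (use B(1) J0 HKD(1)[OF hC] in \<open>auto simp: lam_def\<close>)
  ultimately have range: "Lam F \<in> polys 2" for F by blast
  have ext: "Lam F = lam F" if "F \<in> J0" for F
  proof -
    have "F \<in> mpoly.span B" using that B(3) by blast
    then have "F \<in> J0 \<and> Lam F = lam F"
    proof (induction rule: mpoly.span_induct_alt)
      case base
      show ?case using vp.linear_0[OF lin] zero0[OF ID(2)] IJ0[OF ID(2)] by simp
    next
      case (step c b F)
      have "b \<in> J0" using step(1) B(1) by blast
      moreover have "Lam b = lam b"
        unfolding Lam_def by (rule vp.construct_basis[OF B(2) step(1)])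
      ultimately show ?case using step(2) J0_mult[of b "Const c"] J0_add
        by (simp add: lin_add lin_scale add0 scale0)
    qed
    then show ?thesis by simp
  qed
  define \<xi> where "\<xi> = (\<lambda>z. if z \<in> polys N then Lam z else 0)"
  have "\<xi> \<in> HK"
    by (rule HKI) (use range ext zero0 IJ0 ID(1) in \<open>auto simp: \<xi>_def polys_add polys_mult lin_add lin_scale\<close>)
  moreover have "h x = act x \<xi>" if x: "x \<in> J" for x
  proof -
    obtain F where F: "x = cs F" "F \<in> polys N" using x J.a_subset by (auto simp: carrier_A)
    have FJ: "F \<in> J0" using x F by (simp add: J0_def)
    have "h x z = act x \<xi> z" for z
      using mult0[OF FJ, of z] ext[OF J0_mult[OF FJ, of z]] F HKD(2)[OF hC[OF x], of z]
        act_cs[OF \<open>\<xi> \<in> HK\<close> F(2)]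
      by (simp add: \<xi>_def polys_mult mult.commute)
    then show ?thesis by blast
  qed
  ultimately show ?thesis by blast
qed

lemma baer_summand:
  assumes "hk_summand X" "ideal J A" "\<And>x. x \<in> J \<Longrightarrow> h x \<in> X"
    "\<And>x y. x \<in> J \<Longrightarrow> y \<in> J \<Longrightarrow> h (x \<oplus>\<^bsub>A\<^esub> y) = (\<lambda>z. h x z + h y z)"
    "\<And>a x. a \<in> carrier A \<Longrightarrow> x \<in> J \<Longrightarrow> h (a \<otimes>\<^bsub>A\<^esub> x) = act a (h x)"
  shows "\<exists>\<xi>\<in>X. \<forall>x\<in>J. h x = act x \<xi>"
proof (cases "X = HK")
  case True
  then show ?thesis using baer_HK[of J h] assms by blast
next
  case False
  then have "X = {\<lambda>_. 0}" using assms(1) by (auto simp: hk_summand_def)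
  then show ?thesis using assms(3) by simp
qed

lemma baer_hk_module:
  assumes "hk_summand X" "hk_summand Y"
  shows "baer_injective A (hk_module X Y)"
proof (rule baer_injectiveI[OF hk_module[OF assms]])
  fix J h assume J: "ideal J A" and "\<And>x. x \<in> J \<Longrightarrow> h x \<in> carrier (hk_module X Y)"
    and hadd: "\<And>x y. x \<in> J \<Longrightarrow> y \<in> J \<Longrightarrow> h (x \<oplus>\<^bsub>A\<^esub> y) = h x \<oplus>\<^bsub>hk_module X Y\<^esub> h y"
    and hmult: "\<And>a x. a \<in> carrier A \<Longrightarrow> x \<in> J \<Longrightarrow> h (a \<otimes>\<^bsub>A\<^esub> x) = a \<odot>\<^bsub>hk_module X Y\<^esub> h x"
  then have hC: "fst (h x) \<in> X" "snd (h x) \<in> Y" if "x \<in> J" for x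
    using that by (simp_all add: hk_module_def mem_Times_iff)
  have "\<exists>\<xi>\<in>X. \<forall>x\<in>J. fst (h x) = act x \<xi>"
    by (rule baer_summand[OF assms(1) J]) (use hC hadd hmult in \<open>auto simp: hk_module_def\<close>)
  moreover have "\<exists>\<eta>\<in>Y. \<forall>x\<in>J. snd (h x) = act x \<eta>"
    by (rule baer_summand[OF assms(2) J]) (use hC hadd hmult in \<open>auto simp: hk_module_def\<close>)
  ultimately obtain \<xi> \<eta> where "\<xi> \<in> X" "\<eta> \<in> Y" "\<forall>x\<in>J. fst (h x) = act x \<xi> \<and> snd (h x) = act x \<eta>" by blast
  then show "\<exists>\<xi>\<in>carrier (hk_module X Y). \<forall>x\<in>J. h x = x \<odot>\<^bsub>hk_module X Y\<^esub> \<xi>"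
    by (intro bexI[of _ "(\<xi>, \<eta>)"]) (auto simp: hk_module_def prod_eq_iff)
qed

end

section \<open>Duality over a polynomial ring in two variables\<close>

definition bisubst :: "'k::field mpoly \<Rightarrow> 'k mpoly \<Rightarrow> 'k mpoly \<Rightarrow> 'k mpoly" where
  "bisubst a b = subst (\<lambda>i. if i = 0 then a else b)"

lemma bisubst_simps [simp]:
  "bisubst a b 0 = 0" "bisubst a b 1 = 1" "bisubst a b (p + q) = bisubst a b p + bisubst a b q"
  "bisubst a b (p - q) = bisubst a b p - bisubst a b q"
  "bisubst a b (p * q) = bisubst a b p * bisubst a b q" "bisubst a b (Const c) = Const c"
  "bisubst a b (Var 0) = a" "bisubst a b (Var (Suc i)) = b" "bisubst a b (p ^ k) = bisubst a b p ^ k"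
  by (simp_all add: bisubst_def subst_add subst_diff subst_mult subst_power)

lemma bisubst_polys:
  assumes "a \<in> polys N" "b \<in> polys N"
  shows "bisubst a b p \<in> polys N"
  unfolding bisubst_def subst_def using assms by (auto intro!: polys_sum polys_mult polys_prod polys_power)

lemma Var01_polys: "Var 0 ^ i * Var 1 ^ j \<in> polys 2"
  by (intro polys_mult polys_power polys_Var) simp_all

lemma Var01_induct [consumes 1, case_names Const add Var0 Var1]:
  assumes "p \<in> polys 2" "\<And>c. P (Const c)" "\<And>p q. P p \<Longrightarrow> P q \<Longrightarrow> P (p + q)"
    "\<And>p. p \<in> polys 2 \<Longrightarrow> P p \<Longrightarrow> P (Var 0 * p)" "\<And>p. p \<in> polys 2 \<Longrightarrow> P p \<Longrightarrow> P (Var 1 * p)"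
  shows "P p"
  using assms(1)
proof (induction p rule: polys_induct)
  case (Var_mult i p)
  then show ?case using assms(4,5) by (cases "i = 0") (auto simp: less_2_cases_iff)
qed (use assms in auto)

text \<open>\<open>A\<close> is a free module with basis \<open>ee\<close> over \<open>K[\<alpha>, \<beta>]\<close>, and \<open>(F, G) \<mapsto> \<phi> (F * G)\<close> is a perfect pairing, for which \<open>es\<close> is the dual basis.\<close>

locale frobenius_ring = homogeneous_coordinate_ring N I for N and I :: "'k::field mpoly set" +
  fixes \<alpha> \<beta> :: "'k mpoly" and n :: nat and ee es :: "nat \<Rightarrow> 'k mpoly" and \<phi> :: "'k mpoly \<Rightarrow> 'k mpoly"
  assumes \<alpha>: "\<alpha> \<in> polys N" and \<beta>: "\<beta> \<in> polys N"
    and ee: "\<And>k. k < n \<Longrightarrow> ee k \<in> polys N" and es: "\<And>k. k < n \<Longrightarrow> es k \<in> polys N"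
    and \<phi>_polys: "\<And>F. F \<in> polys N \<Longrightarrow> \<phi> F \<in> polys 2"
    and \<phi>_add: "\<And>F G. F \<in> polys N \<Longrightarrow> G \<in> polys N \<Longrightarrow> \<phi> (F + G) = \<phi> F + \<phi> G"
    and \<phi>_Const: "\<And>c F. F \<in> polys N \<Longrightarrow> \<phi> (Const c * F) = Const c * \<phi> F"
    and \<phi>_I: "\<And>F. F \<in> I \<Longrightarrow> \<phi> F = 0"
    and \<phi>_\<alpha>: "\<And>F. F \<in> polys N \<Longrightarrow> \<phi> (\<alpha> * F) = Var 0 * \<phi> F"
    and \<phi>_\<beta>: "\<And>F. F \<in> polys N \<Longrightarrow> \<phi> (\<beta> * F) = Var 1 * \<phi> F"
    and dual: "\<And>k l. k < n \<Longrightarrow> l < n \<Longrightarrow> \<phi> (ee k * es l) = (if k = l then 1 else 0)"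
    and span: "\<And>F. F \<in> polys N \<Longrightarrow>
      \<exists>p. (\<forall>k<n. p k \<in> polys 2) \<and> F - (\<Sum>k<n. bisubst \<alpha> \<beta> (p k) * ee k) \<in> I"
begin

abbreviation "emb \<equiv> bisubst \<alpha> \<beta>"

lemma emb_polys [simp]: "emb p \<in> polys N"
  by (rule bisubst_polys[OF \<alpha> \<beta>])

lemma \<phi>_emb:
  assumes "p \<in> polys 2" "F \<in> polys N"
  shows "\<phi> (emb p * F) = p * \<phi> F"
  using assms(1)
proof (induction p rule: Var01_induct)
  case (add p q)
  then show ?case using assms by (simp add: distrib_right \<phi>_add polys_mult)
qed (use assms in \<open>simp_all add: \<phi>_Const \<phi>_\<alpha> \<phi>_\<beta> polys_mult mult.assoc\<close>)

lemma \<phi>_sum: "(\<And>i. i \<in> S \<Longrightarrow> g i \<in> polys N) \<Longrightarrow> \<phi> (sum g S) = (\<Sum>i\<in>S. \<phi> (g i))"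
  by (induction S rule: infinite_finite_induct) (simp_all add: \<phi>_add polys_sum \<phi>_I[OF ID(2)])

text \<open>Modulo the ideal these form a \<open>K\<close>-basis of \<open>A\<close>: a map in
  \<open>HK\<close> is determined by its values on them (\<open>HK_zeroI\<close>), and these can be
  prescribed at will (\<open>HK_prescribed\<close>).\<close>

definition mon :: "nat \<Rightarrow> nat \<Rightarrow> nat \<Rightarrow> 'k mpoly" where
  "mon i j k = \<alpha> ^ i * (\<beta> ^ j * ee k)"

lemma mon_polys: "k < n \<Longrightarrow> mon i j k \<in> polys N"
  unfolding mon_def using \<alpha> \<beta> ee by (intro polys_mult polys_power) auto

lemma mon_Suc: "\<alpha> * mon i j k = mon (Suc i) j k" "\<beta> * mon i j k = mon i (Suc j) k" "mon 0 0 k = ee k"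
  by (simp_all add: mon_def mult_ac)

lemma HK_zeroI:
  assumes f: "f \<in> HK" and z: "\<And>i j k. k < n \<Longrightarrow> f (mon i j k) = 0"
  shows "f = (\<lambda>_. 0)"
proof
  fix F
  note D = HKD[OF f]
  have emb: "\<forall>i j. f (emb p * mon i j k) = 0" if "p \<in> polys 2" "k < n" for p k
    using that(1)
  proof (induction p rule: Var01_induct)
    case (Const c) then show ?case using z[OF that(2)] mon_polys[OF that(2)] by (simp add: D(5))
  next
    case (add p q) then show ?case using mon_polys[OF that(2)] by (simp add: distrib_right D(4) polys_mult)
  next
    case (Var0 p)
    have *: "emb (Var 0 * p) * mon i j k = emb p * mon (Suc i) j k" for i j
      unfolding mon_Suc(1)[symmetric] by (simp add: mult_ac)
    show ?case using Var0(2) by (simp only: * simp_thms)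
  next
    case (Var1 p)
    have *: "emb (Var 1 * p) * mon i j k = emb p * mon i (Suc j) k" for i j
      unfolding mon_Suc(2)[symmetric] by (simp add: mult_ac)
    show ?case using Var1(2) by (simp only: * simp_thms)
  qed
  show "f F = 0"
  proof (cases "F \<in> polys N")
    case True
    then obtain p where p: "\<And>k. k < n \<Longrightarrow> p k \<in> polys 2" "F - (\<Sum>k<n. emb (p k) * ee k) \<in> I"
      using span by blast
    have "f F = f (\<Sum>k<n. emb (p k) * ee k)"
      using True p(2) ee by (intro HK_cong[OF f]) (auto intro!: polys_sum polys_mult)
    also have "\<dots> = (\<Sum>k<n. f (emb (p k) * ee k))"
      using ee by (intro HK_sum[OF f]) (auto intro!: polys_mult)
    also have "\<dots> = 0" using emb[OF p(1), rule_format, of _ _ 0 0] by (simp add: mon_Suc(3))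
    finally show ?thesis .
  qed (rule D(2))
qed

lemma HK_eqI:
  assumes "f \<in> HK" "g \<in> HK" "\<And>i j k. k < n \<Longrightarrow> f (mon i j k) = g (mon i j k)"
  shows "f = g"
  using HK_zeroI[OF diff_HK[OF assms(1,2)]] assms(3) by (simp add: fun_eq_iff)

text \<open>The coordinate of \<open>F\<close> at \<open>ee k\<close> is
  \<open>\<phi> (F * es k)\<close>, a polynomial in two variables; \<open>g k\<close> sends its
  monomial with exponents \<open>i\<close> and \<open>j\<close> to \<open>c i j k\<close>.
  Independence of the \<open>mon i j k\<close> is thus contained in the existence of a dual
  basis.\<close>

lemma HK_prescribed:
  assumes c: "\<And>i j k. k < n \<Longrightarrow> c i j k \<in> polys 2"
  obtains f where "f \<in> HK" "\<And>i j k. k < n \<Longrightarrow> f (mon i j k) = c i j k"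
proof
  define g where "g k m = c (Poly_Mapping.lookup m 0) (Poly_Mapping.lookup m 1) k" for k and m :: "nat \<Rightarrow>\<^sub>0 nat"
  define f where "f F = (if F \<in> polys N then \<Sum>k<n. lin Const (g k) (\<phi> (F * es k)) else 0)" for F
  show "f \<in> HK"
  proof (rule HKI)
    show "f F \<in> polys 2" if "F \<in> polys N" for F
      using c that by (auto simp: f_def lin_def g_def intro!: polys_sum polys_mult)
    show "f F = 0" if "F \<in> I" for F
      using ID(4)[OF es that] by (simp add: f_def mult.commute \<phi>_I)
    show "f (F + G) = f F + f G" if "F \<in> polys N" "G \<in> polys N" for F G
      using that es by (simp add: f_def polys_add polys_mult distrib_right \<phi>_add lin_add[OF coeff_hom_Const] sum.distrib)
    show "f (Const a * F) = Const a * f F" if "F \<in> polys N" for a F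
      using that es by (simp add: f_def polys_mult mult.assoc \<phi>_Const lin_Const_mult[OF coeff_hom_Const] sum_distrib_left)
  qed (simp add: f_def)
  fix i j k assume k: "k < n"
  have "\<phi> (mon i j k * es l) = (if k = l then Poly_Mapping.single (Poly_Mapping.single 0 i + Poly_Mapping.single 1 j) 1 else 0)" if "l < n" for l
  proof -
    have "\<phi> (mon i j k * es l) = \<phi> (emb (Var 0 ^ i * Var 1 ^ j) * (ee k * es l))"
      by (simp add: mon_def mult_ac)
    also have "\<dots> = (Var 0 ^ i * Var 1 ^ j) * (if k = l then 1 else 0)"
      using k that ee es by (subst \<phi>_emb[OF Var01_polys]) (auto intro: polys_mult simp: dual)
    finally show ?thesis by (simp add: Var_power mult_single)
  qed
  then have "lin Const (g l) (\<phi> (mon i j k * es l)) = (if k = l then c i j l else 0)" if "l < n" for l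
    using that by (simp add: lin_single[OF coeff_hom_Const] g_def lookup_add lookup_single)
  then have "f (mon i j k) = (\<Sum>l<n. if k = l then c i j l else 0)"
    using mon_polys[OF k] by (simp add: f_def)
  then show "f (mon i j k) = c i j k" using k by simp
qed

text \<open>Perfectness of the pairing: a map linear over both variables is determined by its values
  on \<open>ee\<close>, and \<open>X\<close> is assembled from these values along the dual
  basis.\<close>

lemma HK_linear_form:
  assumes f: "f \<in> HK" and a: "\<And>F. F \<in> polys N \<Longrightarrow> f (\<alpha> * F) = Var 0 * f F"
    and b: "\<And>F. F \<in> polys N \<Longrightarrow> f (\<beta> * F) = Var 1 * f F"
  obtains X where "X \<in> polys N" "\<And>z. z \<in> polys N \<Longrightarrow> f z = \<phi> (X * z)"
proof
  define X where "X = (\<Sum>l<n. emb (f (ee l)) * es l)"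
  show X: "X \<in> polys N" unfolding X_def using es by (auto intro!: polys_sum polys_mult)
  define g where "g z = (if z \<in> polys N then \<phi> (X * z) else 0)" for z
  have "g \<in> HK"
    by (rule HKI)
      (auto simp: g_def \<phi>_polys polys_mult X polys_add distrib_left \<phi>_add mult.left_commute[of X] \<phi>_Const ID(1,4) intro!: \<phi>_I)
  have "f = g"
  proof (rule HK_eqI[OF f \<open>g \<in> HK\<close>])
    fix i j k assume k: "k < n"
    have f1: "f (mon i j k) = Var 0 ^ i * Var 1 ^ j * f (ee k)"
    proof (induction i)
      case 0
      show ?case
      proof (induction j)
        case (Suc j)
        then show ?case using b[OF mon_polys[OF k, of 0 j]] by (simp add: mon_Suc(2) mult_ac)
      qed (simp add: mon_Suc(3))
    next
      case (Suc i)
      then show ?case using a[OF mon_polys[OF k, of i j]] by (simp add: mon_Suc(1) mult_ac)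
    qed
    have "X * mon i j k = (\<Sum>l<n. emb (Var 0 ^ i * Var 1 ^ j * f (ee l)) * (ee k * es l))"
      unfolding X_def mon_def sum_distrib_right by (simp add: mult_ac)
    also have "\<phi> \<dots> = (\<Sum>l<n. \<phi> (emb (Var 0 ^ i * Var 1 ^ j * f (ee l)) * (ee k * es l)))"
      using ee es k by (intro \<phi>_sum) (auto intro!: polys_mult simp del: bisubst_simps)
    also have "\<dots> = (\<Sum>l<n. Var 0 ^ i * Var 1 ^ j * f (ee l) * (if k = l then 1 else 0))"
    proof (intro sum.cong refl)
      fix l assume "l \<in> {..<n}"
      then show "\<phi> (emb (Var 0 ^ i * Var 1 ^ j * f (ee l)) * (ee k * es l)) = Var 0 ^ i * Var 1 ^ j * f (ee l) * (if k = l then 1 else 0)"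
        using k ee es HKD(1)[OF f]
        by (subst \<phi>_emb[OF polys_mult[OF Var01_polys]]) (auto intro!: polys_mult simp: dual)
    qed
    also have "\<dots> = f (mon i j k)" using k by (simp add: f1 if_distrib cong: if_cong)
    finally show "f (mon i j k) = g (mon i j k)" using mon_polys[OF k] by (simp add: g_def)
  qed
  then show "f z = \<phi> (X * z)" if "z \<in> polys N" for z using that by (simp add: g_def)
qed

text \<open>The commutator with multiplication by a variable; it vanishes iff \<open>f\<close> is linear over that variable.\<close>

definition bracket :: "'k mpoly \<Rightarrow> 'k mpoly \<Rightarrow> ('k mpoly \<Rightarrow> 'k mpoly) \<Rightarrow> 'k mpoly \<Rightarrow> 'k mpoly" where
  "bracket v x f = (\<lambda>z. if z \<in> polys N then f (v * z) - x * f z else 0)"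

abbreviation "br\<^sub>\<alpha> \<equiv> bracket \<alpha> (Var 0)"
abbreviation "br\<^sub>\<beta> \<equiv> bracket \<beta> (Var 1)"

lemma bracket_HK:
  assumes "f \<in> HK" "v \<in> polys N" "x \<in> polys 2"
  shows "bracket v x f \<in> HK"
proof -
  note D = HKD[OF assms(1)]
  show ?thesis
  proof (rule HKI)
    show "bracket v x f F = 0" if "F \<in> I" for F
      using D(3)[OF ID(4)[OF assms(2) that]] D(3)[OF that] by (simp add: bracket_def)
    show "bracket v x f (F + G) = bracket v x f F + bracket v x f G" if "F \<in> polys N" "G \<in> polys N" for F G
      using that assms(2) by (simp add: bracket_def polys_add polys_mult distrib_left D)
    show "bracket v x f (Const c * F) = Const c * bracket v x f F" if "F \<in> polys N" for c F
      using that assms(2) by (simp add: bracket_def polys_mult mult.left_commute[of _ "Const c"] D right_diff_distrib)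
  qed (use assms D in \<open>auto simp: bracket_def polys_mult polys_diff\<close>)
qed

lemma br_HK: "f \<in> HK \<Longrightarrow> br\<^sub>\<alpha> f \<in> HK" "f \<in> HK \<Longrightarrow> br\<^sub>\<beta> f \<in> HK"
  by (auto intro!: bracket_HK \<alpha> \<beta> polys_Var)

lemma bracket_zero [simp]: "bracket v x (\<lambda>_. 0) = (\<lambda>_. 0)" by (simp add: bracket_def fun_eq_iff)

lemma bracket_add: "bracket v x (\<lambda>z. f z + g z) = (\<lambda>z. bracket v x f z + bracket v x g z)"
  by (auto simp: bracket_def fun_eq_iff algebra_simps)

lemma bracket_diff: "bracket v x (\<lambda>z. f z - g z) = (\<lambda>z. bracket v x f z - bracket v x g z)"
  by (auto simp: bracket_def fun_eq_iff algebra_simps)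

lemma bracket_act:
  assumes "f \<in> HK" "v \<in> polys N" "x \<in> polys 2" "X \<in> carrier A"
  shows "bracket v x (act X f) = act X (bracket v x f)"
proof -
  obtain F where F: "X = cs F" "F \<in> polys N" using assms(4) by (rule A_cases)
  show ?thesis
    unfolding F(1) act_cs[OF assms(1) F(2)] act_cs[OF bracket_HK[OF assms(1-3)] F(2)]
    using assms(2) F(2) by (auto simp: bracket_def fun_eq_iff polys_mult mult.left_commute)
qed

lemma br_commute: "br\<^sub>\<alpha> (br\<^sub>\<beta> f) = br\<^sub>\<beta> (br\<^sub>\<alpha> f)"
  using \<alpha> \<beta> by (auto simp: bracket_def fun_eq_iff polys_mult mult.left_commute algebra_simps)

text \<open>On \<open>mon i j k\<close> the equation is the recursion
  \<open>f (mon (Suc i) j k) = Var 0 * f (mon i j k) + g (mon i j k)\<close>, which leaves the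
  values at \<open>i = 0\<close> free.\<close>

lemma br_solve:
  assumes g: "g \<in> HK" and c0: "\<And>j k. k < n \<Longrightarrow> c0 j k \<in> polys 2"
  obtains f where "f \<in> HK" "br\<^sub>\<alpha> f = g" "\<And>j k. k < n \<Longrightarrow> f (mon 0 j k) = c0 j k"
proof -
  define c where "c i j k = rec_nat (c0 j k) (\<lambda>i x. Var 0 * x + g (mon i j k)) i" for i j k
  have c: "c i j k \<in> polys 2" if "k < n" for i j k
    by (induction i) (use that c0 HKD(1)[OF g] in \<open>auto simp: c_def intro!: polys_add polys_mult polys_Var\<close>)
  obtain f where f: "f \<in> HK" "\<And>i j k. k < n \<Longrightarrow> f (mon i j k) = c i j k"
    using HK_prescribed[of c] c by blast
  have "br\<^sub>\<alpha> f = g"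
    by (rule HK_eqI[OF br_HK(1)[OF f(1)] g]) (simp add: bracket_def mon_polys mon_Suc f(2) c_def)
  then show ?thesis using that[of f] f by (simp add: c_def)
qed

text \<open>The values at \<open>i = 0\<close> left free by the first equation are chosen by
  recursion in \<open>j\<close> to satisfy the second one there. The remaining defect
  \<open>h'\<close> is linear over the first variable, by the compatibility of \<open>g\<close> and
  \<open>h\<close>, so its vanishing at \<open>i = 0\<close> spreads to all
  \<open>i\<close>.\<close>

lemma br_exact:
  assumes g: "g \<in> HK" and h: "h \<in> HK" and gh: "br\<^sub>\<beta> g = br\<^sub>\<alpha> h"
  obtains f where "f \<in> HK" "br\<^sub>\<alpha> f = g" "br\<^sub>\<beta> f = h"
proof -
  define c0 where "c0 j k = rec_nat 0 (\<lambda>j x. Var 1 * x + h (mon 0 j k)) j" for j k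
  have "c0 j k \<in> polys 2" for j k
    by (induction j) (use HKD(1)[OF h] in \<open>auto simp: c0_def intro!: polys_add polys_mult polys_Var\<close>)
  then obtain f where f: "f \<in> HK" "br\<^sub>\<alpha> f = g" "\<And>j k. k < n \<Longrightarrow> f (mon 0 j k) = c0 j k"
    using br_solve[OF g, of c0] by blast
  define h' where "h' = (\<lambda>z. h z - br\<^sub>\<beta> f z)"
  have h': "h' \<in> HK" unfolding h'_def by (rule diff_HK[OF h br_HK(2)[OF f(1)]])
  have "br\<^sub>\<alpha> h' = (\<lambda>_. 0)"
    unfolding h'_def bracket_diff br_commute f(2) gh by simp
  then have "br\<^sub>\<alpha> h' (mon i j k) = 0" for i j k by simp
  then have step: "h' (mon (Suc i) j k) = Var 0 * h' (mon i j k)" if "k < n" for i j k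
    using mon_polys[OF that, of i j] by (simp add: bracket_def flip: mon_Suc(1)) (metis eq_iff_diff_eq_0)
  have zero: "h' (mon 0 j k) = 0" if "k < n" for j k
    using that f(3)[OF that, of j] f(3)[OF that, of "Suc j"]
    by (simp add: h'_def bracket_def mon_polys mon_Suc c0_def)
  have "h' (mon i j k) = 0" if "k < n" for i j k
    by (induction i) (simp_all add: zero step that)
  then have "h' = (\<lambda>_. 0)" by (rule HK_zeroI[OF h'])
  then have "br\<^sub>\<beta> f = h" by (auto simp: h'_def fun_eq_iff)
  then show ?thesis using that f by blast
qed

text \<open>
  The Koszul complex of the two commuting commutators is an injective resolution
  \<open>0 \<rightarrow> A \<rightarrow> E \<rightarrow> E \<times> E \<rightarrow> E \<rightarrow> 0\<close> with \<open>E = Hom\<^sub>K(A, K[a, b])\<close>. All its terms are embedded in \<open>E \<times> E\<close>.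
\<close>

abbreviation "zf \<equiv> (\<lambda>_. 0) :: 'k mpoly \<Rightarrow> 'k mpoly"

definition res :: "nat \<Rightarrow> ('k mpoly set, ('k mpoly \<Rightarrow> 'k mpoly) \<times> ('k mpoly \<Rightarrow> 'k mpoly)) module" where
  "res i = hk_module (if i \<le> 2 then HK else {zf}) (if i = 1 then HK else {zf})"

definition diff_map :: "nat \<Rightarrow> ('k mpoly \<Rightarrow> 'k mpoly) \<times> ('k mpoly \<Rightarrow> 'k mpoly) \<Rightarrow> ('k mpoly \<Rightarrow> 'k mpoly) \<times> ('k mpoly \<Rightarrow> 'k mpoly)" where
  "diff_map i p = (if i = 0 then (br\<^sub>\<alpha> (fst p), br\<^sub>\<beta> (fst p))
     else if i = 1 then (\<lambda>z. br\<^sub>\<beta> (fst p) z - br\<^sub>\<alpha> (snd p) z, zf) else (zf, zf))"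

definition \<phi>' :: "'k mpoly \<Rightarrow> 'k mpoly" where "\<phi>' F = (if F \<in> polys N then \<phi> F else 0)"

lemma \<phi>'_HK: "\<phi>' \<in> HK"
  by (rule HKI) (auto simp: \<phi>'_def \<phi>_polys \<phi>_I \<phi>_add \<phi>_Const polys_add polys_mult)

lemma act_\<phi>': "F \<in> polys N \<Longrightarrow> act (cs F) \<phi>' = (\<lambda>z. if z \<in> polys N then \<phi> (F * z) else 0)"
  by (auto simp: act_cs \<phi>'_HK \<phi>'_def polys_mult)

text \<open>Nondegeneracy: pairing \<open>F\<close> with \<open>es l\<close> reads off its
  coordinate at \<open>ee l\<close>, so all coordinates vanish.\<close>

lemma act_\<phi>'_inj:
  assumes "F \<in> polys N" "\<And>z. z \<in> polys N \<Longrightarrow> \<phi> (F * z) = 0"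
  shows "F \<in> I"
proof -
  obtain p where p: "\<And>k. k < n \<Longrightarrow> p k \<in> polys 2" "F - (\<Sum>k<n. emb (p k) * ee k) \<in> I"
    using span[OF assms(1)] by blast
  have "p l = 0" if l: "l < n" for l
  proof -
    have s: "(\<Sum>k<n. emb (p k) * ee k) \<in> polys N" using ee by (auto intro!: polys_sum polys_mult)
    have "\<phi> ((F - (\<Sum>k<n. emb (p k) * ee k)) * es l) = 0"
      using ID(4)[OF es[OF l] p(2)] by (simp add: mult.commute \<phi>_I)
    then have "\<phi> (F * es l) = \<phi> ((\<Sum>k<n. emb (p k) * ee k) * es l)"
      using HK_diff[OF \<phi>'_HK, of "F * es l" "(\<Sum>k<n. emb (p k) * ee k) * es l"] assms(1) es[OF l] s
      by (simp add: \<phi>'_def polys_mult polys_diff left_diff_distrib)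
    also have "\<dots> = (\<Sum>k<n. \<phi> (emb (p k) * (ee k * es l)))"
      unfolding sum_distrib_right mult.assoc using ee es[OF l] by (intro \<phi>_sum) (auto intro!: polys_mult)
    also have "\<dots> = (\<Sum>k<n. if k = l then p k else 0)"
      using p(1) ee es l by (intro sum.cong refl) (simp add: \<phi>_emb polys_mult dual)
    finally show ?thesis using assms(2)[OF es[OF l]] l by simp
  qed
  then show ?thesis using p(2) by simp
qed

lemma finite_injective_dimension_local:
  assumes "primeideal P A"
  shows "finite_injective_dimension (localization A P) (self_module (localization A P))"
proof -
  let ?e = "\<lambda>X. (act X \<phi>', zf)"
  \<comment> \<open>A triple of two maps and a set becomes one function: its value at the empty set
    encodes the graph of the first map, at \<open>UNIV\<close> that of the second, elsewhere the set
    itself. Taking images under it embeds fractions, which are sets of such triples.\<close>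
  define \<iota>0 :: "(('k mpoly \<Rightarrow> 'k mpoly) \<times> ('k mpoly \<Rightarrow> 'k mpoly)) \<times> 'k mpoly set \<Rightarrow> ('k mpoly set \<times> 'k mpoly set) set \<Rightarrow> ('k mpoly set \<times> 'k mpoly set) set"
    where "\<iota>0 x = (\<lambda>Y. if Y = {} then {({p}, {fst (fst x) p}) | p. True}
      else if Y = UNIV then {({p}, {snd (fst x) p}) | p. True} else {(snd x, snd x)})" for x
  \<comment> \<open>Reading off the third component requires an argument different from both the
    empty set and \<open>UNIV\<close>.\<close>
  have sing: "{({}, {})} \<noteq> (UNIV :: ('k mpoly set \<times> 'k mpoly set) set)"
    by (metis UNIV_I empty_not_UNIV prod.inject singletonD)
  have "inj \<iota>0"
  proof (rule injI)
    fix x y assume eq: "\<iota>0 x = \<iota>0 y"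
    have "fst (fst x) p = fst (fst y) p" for p
    proof -
      have "({p}, {fst (fst x) p}) \<in> \<iota>0 x {}" by (auto simp: \<iota>0_def)
      then show ?thesis unfolding eq by (auto simp: \<iota>0_def)
    qed
    moreover have "snd (fst x) p = snd (fst y) p" for p
    proof -
      have "({p}, {snd (fst x) p}) \<in> \<iota>0 x UNIV" by (auto simp: \<iota>0_def)
      then show ?thesis unfolding eq by (auto simp: \<iota>0_def)
    qed
    moreover have "snd x = snd y" using fun_cong[OF eq, of "{({}, {})}"] sing by (simp add: \<iota>0_def)
    ultimately show "x = y" by (auto simp: prod_eq_iff)
  qed
  then have \<iota>: "inj ((`) \<iota>0)" by (simp add: inj_image_eq_iff inj_def)
  have summand: "hk_summand (if b then HK else {zf})" for b by (simp add: hk_summand_def)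
  have V: "(Var 0 :: 'k mpoly) \<in> polys 2" "(Var 1 :: 'k mpoly) \<in> polys 2" by (simp_all add: polys_Var)
  have c: "carrier (res i) = (if i \<le> 2 then HK else {zf}) \<times> (if i = 1 then HK else {zf})"
    and z: "\<zero>\<^bsub>res i\<^esub> = (zf, zf)" for i by (simp_all add: res_def hk_module_def)
  show ?thesis
  proof (rule finite_injective_dimension_localization[where E = res and d = diff_map and e = ?e and n = 2, OF assms noetherian_A \<iota>])
    show "baer_injective A (res i)" for i unfolding res_def by (intro baer_hk_module summand)
    show "carrier (res i) = {\<zero>\<^bsub>res i\<^esub>}" if "2 < i" for i using that by (auto simp: c z)
    show "?e \<in> mod_hom A (self_module A) (res 0)"
    proof -
      have "act X \<phi>' \<in> HK" "act (X \<oplus>\<^bsub>A\<^esub> Y) \<phi>' = (\<lambda>z. act X \<phi>' z + act Y \<phi>' z)"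
        "act (X \<otimes>\<^bsub>A\<^esub> Y) \<phi>' = act X (act Y \<phi>')" if XY: "X \<in> carrier A" "Y \<in> carrier A" for X Y
      proof -
        interpret M: Module.module A "hk_module HK {zf}" by (intro hk_module) (simp_all add: hk_summand_def)
        have p: "(\<phi>', zf) \<in> carrier (hk_module HK {zf})" by (simp add: hk_module_def \<phi>'_HK)
        show "act X \<phi>' \<in> HK" by (rule act_HK[OF XY(1) \<phi>'_HK])
        show "act (X \<oplus>\<^bsub>A\<^esub> Y) \<phi>' = (\<lambda>z. act X \<phi>' z + act Y \<phi>' z)"
          using M.smult_l_distr[OF XY p] by (simp add: hk_module_def)
        show "act (X \<otimes>\<^bsub>A\<^esub> Y) \<phi>' = act X (act Y \<phi>')"
          using M.smult_assoc1[OF XY p] by (simp add: hk_module_def)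
      qed
      then show ?thesis by (auto simp: mod_hom_def res_def hk_module_def)
    qed
    show "inj_on ?e (carrier A)"
    proof (rule inj_onI)
      fix X Y assume XY: "X \<in> carrier A" "Y \<in> carrier A" "?e X = ?e Y"
      obtain F G where F: "X = cs F" "F \<in> polys N" and G: "Y = cs G" "G \<in> polys N" using XY by (elim A_cases)
      have "\<phi> (F * z) = \<phi> (G * z)" if "z \<in> polys N" for z
        using XY(3) F G that act_\<phi>' by (auto dest!: fun_cong[of _ _ z])
      then have "\<phi> ((F - G) * z) = 0" if "z \<in> polys N" for z
        using HK_diff[OF \<phi>'_HK, of "F * z" "G * z"] that F G
        by (simp add: \<phi>'_def polys_mult polys_diff left_diff_distrib)
      then have "F - G \<in> I" using F G by (intro act_\<phi>'_inj polys_diff)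
      then show "X = Y" using F G by (simp add: cs_eq_iff)
    qed
    show "diff_map i \<in> mod_hom A (res i) (res (Suc i))" for i
    proof -
      consider "i = 0" | "i = 1" | "i \<ge> 2" by linarith
      then show ?thesis
      proof cases
        case 1
        then show ?thesis
          by (auto simp: mod_hom_def diff_map_def res_def hk_module_def br_HK bracket_add bracket_act \<alpha> \<beta> V simp del: One_nat_def)
      next
        case 2
        have "(\<lambda>z. act X (br\<^sub>\<beta> f) z - act X (br\<^sub>\<alpha> g) z) = act X (\<lambda>z. br\<^sub>\<beta> f z - br\<^sub>\<alpha> g z)"
          if XF: "X \<in> carrier A" "f \<in> HK" "g \<in> HK" for X f g
        proof -
          obtain F where F: "X = cs F" "F \<in> polys N" using XF(1) by (rule A_cases)
          show ?thesis
            unfolding F(1) act_cs[OF br_HK(2)[OF XF(2)] F(2)] act_cs[OF br_HK(1)[OF XF(3)] F(2)]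
              act_cs[OF diff_HK[OF br_HK(2)[OF XF(2)] br_HK(1)[OF XF(3)]] F(2)] by auto
        qed
        then show ?thesis using 2
          by (auto simp: mod_hom_def diff_map_def res_def hk_module_def br_HK diff_HK bracket_add bracket_act \<alpha> \<beta> V fun_eq_iff simp del: One_nat_def)
      next
        case 3
        then show ?thesis
          by (auto simp: mod_hom_def diff_map_def res_def hk_module_def zero_HK)
      qed
    qed
    show "?e ` carrier A = {x \<in> carrier (res 0). diff_map 0 x = \<zero>\<^bsub>res 1\<^esub>}"
    proof (intro subset_antisym subsetI)
      fix x assume "x \<in> ?e ` carrier A"
      then obtain F where F: "F \<in> polys N" "x = (act (cs F) \<phi>', zf)" by (auto simp: carrier_A)
      have "br\<^sub>\<alpha> (act (cs F) \<phi>') = zf" "br\<^sub>\<beta> (act (cs F) \<phi>') = zf"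
        using F(1) \<alpha> \<beta> by (auto simp: act_\<phi>' bracket_def fun_eq_iff polys_mult mult.left_commute[of F] \<phi>_\<alpha> \<phi>_\<beta>)
      then show "x \<in> {x \<in> carrier (res 0). diff_map 0 x = \<zero>\<^bsub>res 1\<^esub>}"
        using F act_HK[OF cs_carrier[OF F(1)] \<phi>'_HK] by (simp add: c z diff_map_def)
    next
      fix x assume "x \<in> {x \<in> carrier (res 0). diff_map 0 x = \<zero>\<^bsub>res 1\<^esub>}"
      then obtain f where f: "x = (f, zf)" "f \<in> HK" "br\<^sub>\<alpha> f = zf" "br\<^sub>\<beta> f = zf"
        by (auto simp: c z diff_map_def)
      have "br\<^sub>\<alpha> f F = 0" "br\<^sub>\<beta> f F = 0" for F using f by simp_all
      \<comment> \<open>Vanishing of both commutators means linearity over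
        \<open>K[\<alpha>, \<beta>]\<close>, so exactness at the first term is the perfectness of
        the pairing.\<close>
      then have "f (\<alpha> * F) = Var 0 * f F" "f (\<beta> * F) = Var 1 * f F" if "F \<in> polys N" for F
        using that by (simp_all add: bracket_def) (metis eq_iff_diff_eq_0)+
      then obtain X where X: "X \<in> polys N" "\<And>z. z \<in> polys N \<Longrightarrow> f z = \<phi> (X * z)"
        using HK_linear_form[OF f(2)] by blast
      then have "f = act (cs X) \<phi>'" using HKD(2)[OF f(2)] by (auto simp: act_\<phi>' fun_eq_iff)
      then show "x \<in> ?e ` carrier A" using f(1) X(1) by auto
    qed
    show "diff_map i ` carrier (res i) = {x \<in> carrier (res (Suc i)). diff_map (Suc i) x = \<zero>\<^bsub>res (Suc (Suc i))\<^esub>}" for i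
    proof -
      consider "i = 0" | "i = 1" | "i \<ge> 2" by linarith
      then show ?thesis
      proof cases
        case 1
        show ?thesis
        proof (intro subset_antisym subsetI)
          fix x assume "x \<in> diff_map i ` carrier (res i)"
          then obtain f where "f \<in> HK" "x = (br\<^sub>\<alpha> f, br\<^sub>\<beta> f)" using 1 by (auto simp: c diff_map_def)
          then show "x \<in> {x \<in> carrier (res (Suc i)). diff_map (Suc i) x = \<zero>\<^bsub>res (Suc (Suc i))\<^esub>}"
            using 1 by (simp add: c z diff_map_def br_HK br_commute flip: One_nat_def)
        next
          fix x assume "x \<in> {x \<in> carrier (res (Suc i)). diff_map (Suc i) x = \<zero>\<^bsub>res (Suc (Suc i))\<^esub>}"
          then obtain g h where gh: "x = (g, h)" "g \<in> HK" "h \<in> HK" "(\<lambda>z. br\<^sub>\<beta> g z - br\<^sub>\<alpha> h z) = zf"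
            using 1 by (auto simp: c z diff_map_def)
          have "br\<^sub>\<beta> g = br\<^sub>\<alpha> h" using gh(4) by (simp add: fun_eq_iff)
          then obtain f where "f \<in> HK" "br\<^sub>\<alpha> f = g" "br\<^sub>\<beta> f = h" using br_exact gh by blast
          then show "x \<in> diff_map i ` carrier (res i)"
            using 1 gh(1) by (intro image_eqI[of _ _ "(f, zf)"]) (simp_all add: c diff_map_def)
        qed
      next
        case 2
        \<comment> \<open>One commutator alone is onto, so the second slot suffices; the minus sign
          offsets the sign with which that slot enters \<open>diff_map 1\<close>.\<close>
        have "\<exists>p\<in>HK \<times> HK. (f, zf) = diff_map 1 p" if f: "f \<in> HK" for f
        proof -
          obtain h where "h \<in> HK" "br\<^sub>\<alpha> h = f" using br_solve[OF f, of "\<lambda>_ _. 0"] by auto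
          then show ?thesis
            using diff_HK[OF zero_HK, of h] bracket_diff[of \<alpha> "Var 0" zf h]
            by (intro bexI[of _ "(zf, \<lambda>z. 0 - h z)"]) (simp_all add: diff_map_def zero_HK)
        qed
        then show ?thesis using 2 by (auto simp: c z diff_map_def image_iff br_HK diff_HK simp flip: One_nat_def)
      next
        case 3
        then show ?thesis by (auto simp: c z diff_map_def image_iff intro!: zero_HK)
      qed
    qed
  qed
qed

theorem gorenstein_A: "gorenstein_ring A"
  unfolding gorenstein_ring_def
  using A.is_cring noetherian_A finite_injective_dimension_local by blast

end

section \<open>Polynomials in two variables\<close>

declare One_nat_def [simp del]

lemma bisubst_Var1 [simp]: "bisubst a b (Var 1) = b"
  using bisubst_simps(8)[of a b 0] by (simp add: One_nat_def)

text \<open>An independent family in the span of \<open>Z\<close> with at least as many members as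
  \<open>Z\<close> spans everything: one further independent vector would exceed the dimension
  bound. This serves to invert the coordinates \<open>y\<close> and to express monomials of degree
  \<open>r - 2\<close> through the forms \<open>l i\<close>.\<close>

lemma family_span:
  fixes y :: "'i \<Rightarrow> 'k::field mpoly"
  assumes X: "finite X" and indep: "\<And>c. (\<Sum>k\<in>X. Const (c k) * y k) = 0 \<Longrightarrow> \<forall>k\<in>X. c k = 0"
    and Z: "finite Z" "card Z \<le> card X" "\<And>k. k \<in> X \<Longrightarrow> y k \<in> mpoly.span Z"
  shows "mpoly.independent (y ` X)" "inj_on y X" "Z \<subseteq> mpoly.span (y ` X)"
proof -
  show inj: "inj_on y X"
  proof (rule inj_onI, rule ccontr)
    fix i j assume ij: "i \<in> X" "j \<in> X" "y i = y j" "i \<noteq> j"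
    define c where "c k = (if k = i then 1 else if k = j then - 1 else 0 :: 'k)" for k
    have "(\<Sum>k\<in>X. Const (c k) * y k) = (\<Sum>k\<in>{i, j}. Const (c k) * y k)"
      using X ij by (intro sum.mono_neutral_right) (auto simp: c_def)
    also have "\<dots> = 0" using ij by (simp add: c_def Const_minus)
    finally show False using indep ij(1) by (fastforce simp: c_def)
  qed
  show ind: "mpoly.independent (y ` X)"
  proof (rule mpoly.independent_if_scalars_zero)
    fix f x assume "(\<Sum>x\<in>y ` X. Const (f x) * x) = 0" "x \<in> y ` X"
    then show "f x = 0" using indep[of "\<lambda>k. f (y k)"] by (auto simp: sum.reindex[OF inj])
  qed (simp add: X)
  show "Z \<subseteq> mpoly.span (y ` X)"
  proof (rule ccontr)
    assume "\<not> Z \<subseteq> mpoly.span (y ` X)"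
    then obtain z where z: "z \<in> Z" "z \<notin> mpoly.span (y ` X)" by blast
    have "mpoly.independent (insert z (y ` X))" by (rule mpoly.independent_insertI[OF z(2) ind])
    moreover have "insert z (y ` X) \<subseteq> mpoly.span Z" using z(1) Z(3) mpoly.span_base by blast
    ultimately have "card (insert z (y ` X)) \<le> card Z" using mpoly.independent_span_bound[OF Z(1)] by blast
    moreover have "z \<notin> y ` X" using z(2) mpoly.span_base by blast
    ultimately show False using Z(2) X card_image[OF inj] by simp
  qed
qed

lemma span_family_obtain:
  fixes y :: "'i \<Rightarrow> 'k::field mpoly"
  assumes "finite X" "x \<in> mpoly.span (y ` X)" "inj_on y X"
  obtains c where "x = (\<Sum>k\<in>X. Const (c k) * y k)"
proof -
  obtain f where "x = (\<Sum>v\<in>y ` X. Const (f v) * v)"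
    using assms(2) mpoly.span_finite[of "y ` X"] assms(1) by auto
  then show ?thesis using that[of "\<lambda>k. f (y k)"] by (simp add: sum.reindex[OF assms(3)])
qed

lemma forms_1_eq_sum:
  fixes F :: "'k::field mpoly"
  assumes "F \<in> forms n 1"
  obtains c where "F = (\<Sum>i<n. Const (c i) * Var i)"
proof
  have sub: "Poly_Mapping.keys F \<subseteq> (\<lambda>i. Poly_Mapping.single i 1) ` {..<n}"
  proof
    fix m assume "m \<in> Poly_Mapping.keys F"
    then have m: "Poly_Mapping.keys m \<subseteq> {..<n}" "mdeg m = 1" using assms by (auto simp: forms_def polys_def)
    have "mdeg m = 1 \<longleftrightarrow> (\<exists>i\<in>Poly_Mapping.keys m. Poly_Mapping.lookup m i = 1 \<and> (\<forall>j\<in>Poly_Mapping.keys m. i \<noteq> j \<longrightarrow> Poly_Mapping.lookup m j = 0))"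
      using sum_eq_1_iff[of "Poly_Mapping.keys m" "Poly_Mapping.lookup m"] by simp
    then obtain i where i: "i \<in> Poly_Mapping.keys m" "Poly_Mapping.lookup m i = 1" "\<And>j. j \<in> Poly_Mapping.keys m \<Longrightarrow> i \<noteq> j \<Longrightarrow> Poly_Mapping.lookup m j = 0"
      using m(2) by blast
    have "m = Poly_Mapping.single i 1"
      using i by (intro poly_mapping_eqI) (auto simp: lookup_single when_def in_keys_iff)
    then show "m \<in> (\<lambda>i. Poly_Mapping.single i 1) ` {..<n}" using m(1) i(1) by auto
  qed
  have inj: "inj_on (\<lambda>i. Poly_Mapping.single i (1::nat)) {..<n}"
  proof (rule inj_onI)
    fix i j assume "Poly_Mapping.single i (1::nat) = Poly_Mapping.single j 1"
    then have "Poly_Mapping.lookup (Poly_Mapping.single i (1::nat)) i = Poly_Mapping.lookup (Poly_Mapping.single j 1) i" by simp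
    then show "i = j" by (simp add: lookup_single when_def split: if_splits)
  qed
  have "F = (\<Sum>m\<in>(\<lambda>i. Poly_Mapping.single i 1) ` {..<n}. Poly_Mapping.single m (Poly_Mapping.lookup F m))"
    by (rule trans[OF sum_single_lookup], rule sum.mono_neutral_left) (use sub in \<open>auto simp: in_keys_iff\<close>)
  then show "F = (\<Sum>i<n. Const (Poly_Mapping.lookup F (Poly_Mapping.single i 1)) * Var i)"
    by (simp add: sum.reindex[OF inj] Var_def Const_mult_single)
qed

abbreviation m0 :: "(nat \<Rightarrow>\<^sub>0 nat) \<Rightarrow> nat" where "m0 m \<equiv> Poly_Mapping.lookup m 0"
abbreviation m1 :: "(nat \<Rightarrow>\<^sub>0 nat) \<Rightarrow> nat" where "m1 m \<equiv> Poly_Mapping.lookup m 1"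

definition tu :: "nat \<Rightarrow> nat \<Rightarrow> 'k::field mpoly" where "tu i j = Var 0 ^ i * Var 1 ^ j"

lemma tu_single: "tu i j = Poly_Mapping.single (Poly_Mapping.single 0 i + Poly_Mapping.single 1 j) 1"
  by (simp add: tu_def Var_power mult_single)

lemma tu_polys [simp]: "tu i j \<in> polys 2" unfolding tu_def by (rule Var01_polys)

lemma tu_forms: "i + j = d \<Longrightarrow> tu i j \<in> forms 2 d"
  unfolding tu_def using forms_mult[OF forms_power[OF forms_Var, of 0 2 i] forms_power[OF forms_Var, of 1 2 j]] by auto

lemma tu_mult: "tu i j * tu k l = tu (i + k) (j + l)" by (simp add: tu_def power_add mult_ac)

lemma tu_0_0 [simp]: "tu 0 0 = 1" by (simp add: tu_def)

lemma tu_nonzero [simp]: "tu i j \<noteq> 0"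
  unfolding tu_single by (metis lookup_single_eq lookup_zero zero_neq_one)

lemma lookup_tu: "Poly_Mapping.lookup (tu i j) (Poly_Mapping.single 0 k + Poly_Mapping.single 1 l) = (if i = k \<and> j = l then 1 else 0)"
proof -
  have "Poly_Mapping.single (0::nat) i + Poly_Mapping.single 1 j = Poly_Mapping.single 0 k + Poly_Mapping.single 1 l \<longleftrightarrow> i = k \<and> j = l"
  proof
    assume eq: "Poly_Mapping.single 0 i + Poly_Mapping.single 1 j = Poly_Mapping.single (0::nat) k + Poly_Mapping.single 1 l"
    show "i = k \<and> j = l"
      using arg_cong[OF eq, of m0] arg_cong[OF eq, of m1] by (simp add: lookup_add lookup_single)
  qed simp
  then show ?thesis by (auto simp: tu_single lookup_single when_def)
qed

lemma polys2_monomial: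
  assumes "Poly_Mapping.keys m \<subseteq> {..<2}"
  shows "m = Poly_Mapping.single 0 (m0 m) + Poly_Mapping.single 1 (m1 m)" "mdeg m = m0 m + m1 m"
proof -
  show 1: "m = Poly_Mapping.single 0 (m0 m) + Poly_Mapping.single 1 (m1 m)"
  proof (rule poly_mapping_eqI)
    fix i
    have "Poly_Mapping.lookup m i = 0" if "i \<noteq> 0" "i \<noteq> 1"
      using assms that by (auto simp: in_keys_iff)
    then show "Poly_Mapping.lookup m i = Poly_Mapping.lookup (Poly_Mapping.single 0 (m0 m) + Poly_Mapping.single 1 (m1 m)) i"
      by (auto simp: lookup_add lookup_single when_def)
  qed
  show "mdeg m = m0 m + m1 m" by (subst (1 2) 1) (simp only: mdeg_add mdeg_single)
qed

lemma single_eq_tu: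
  assumes "Poly_Mapping.keys m \<subseteq> {..<2}"
  shows "Poly_Mapping.single m c = Const c * tu (m0 m) (m1 m)"
  unfolding tu_single Const_mult_single using polys2_monomial(1)[OF assms] by simp

lemma polys2_eq_sum: "p \<in> polys 2 \<Longrightarrow> p = (\<Sum>m\<in>Poly_Mapping.keys p. Const (Poly_Mapping.lookup p m) * tu (m0 m) (m1 m))"
  by (rule trans[OF sum_single_lookup]) (intro sum.cong refl single_eq_tu, auto simp: polys_def)

lemma forms2_eq_sum:
  assumes "p \<in> forms 2 d"
  shows "p = (\<Sum>i\<le>d. Const (Poly_Mapping.lookup p (Poly_Mapping.single 0 i + Poly_Mapping.single 1 (d - i))) * tu i (d - i))"
proof -
  define g where "g i = Poly_Mapping.single (0::nat) i + Poly_Mapping.single 1 (d - i)" for i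
  have g0: "m0 (g i) = i" for i by (simp add: g_def lookup_add lookup_single)
  have inj: "inj_on g {..d}" by (rule inj_on_inverseI[of _ m0]) (rule g0)
  have sub: "Poly_Mapping.keys p \<subseteq> g ` {..d}"
  proof
    fix m assume m: "m \<in> Poly_Mapping.keys p"
    then have k: "Poly_Mapping.keys m \<subseteq> {..<2}" "m0 m + m1 m = d"
      using assms polys2_monomial(2)[of m] by (auto simp: forms_def polys_def)
    then have "m = g (m0 m)" using polys2_monomial(1)[OF k(1)] by (auto simp: g_def)
    then show "m \<in> g ` {..d}" using k(2) by auto
  qed
  have "p = (\<Sum>m\<in>Poly_Mapping.keys p. Poly_Mapping.single m (Poly_Mapping.lookup p m))" by (rule sum_single_lookup)
  also have "\<dots> = (\<Sum>m\<in>g ` {..d}. Poly_Mapping.single m (Poly_Mapping.lookup p m))"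
    using sub by (intro sum.mono_neutral_left) (auto simp: in_keys_iff)
  also have "\<dots> = (\<Sum>i\<le>d. Poly_Mapping.single (g i) (Poly_Mapping.lookup p (g i)))"
    by (simp add: sum.reindex[OF inj])
  finally show ?thesis by (simp add: tu_single Const_mult_single g_def)
qed

text \<open>Restricting to one residue class of exponents modulo \<open>r\<close> and contracting \<open>t\<^sup>r\<close>, \<open>u\<^sup>r\<close> to new variables.\<close>

definition ext :: "nat \<Rightarrow> nat \<Rightarrow> nat \<Rightarrow> 'k::field mpoly \<Rightarrow> 'k mpoly" where
  "ext r \<rho> \<sigma> = lin Const (\<lambda>m. if m0 m mod r = \<rho> \<and> m1 m mod r = \<sigma> then tu (m0 m div r) (m1 m div r) else 0)"

lemma ext_simps [simp]:
  "ext r \<rho> \<sigma> 0 = 0" "ext r \<rho> \<sigma> (f + g) = ext r \<rho> \<sigma> f + ext r \<rho> \<sigma> g"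
  "ext r \<rho> \<sigma> (f - g) = ext r \<rho> \<sigma> f - ext r \<rho> \<sigma> g" "ext r \<rho> \<sigma> (Const c * f) = Const c * ext r \<rho> \<sigma> f"
  "ext r \<rho> \<sigma> (sum h S) = (\<Sum>i\<in>S. ext r \<rho> \<sigma> (h i))"
  by (simp_all add: ext_def lin_add lin_diff lin_Const_mult lin_sum coeff_hom_Const)

lemma ext_single: "ext r \<rho> \<sigma> (Poly_Mapping.single m c) =
    (if m0 m mod r = \<rho> \<and> m1 m mod r = \<sigma> then Const c * tu (m0 m div r) (m1 m div r) else 0)"
  by (simp add: ext_def lin_single coeff_hom_Const)

lemma ext_tu: "ext r \<rho> \<sigma> (tu i j) = (if i mod r = \<rho> \<and> j mod r = \<sigma> then tu (i div r) (j div r) else 0)"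
  unfolding tu_single[of i j] ext_single by (simp add: lookup_add lookup_single)

lemma ext_polys [simp]: "ext r \<rho> \<sigma> f \<in> polys 2"
  unfolding ext_def lin_def by (auto intro!: polys_sum polys_mult)

lemma ext_Var:
  assumes "r > 0"
  shows "ext r \<rho> \<sigma> (Var 0 ^ r * f) = Var 0 * ext r \<rho> \<sigma> f" "ext r \<rho> \<sigma> (Var 1 ^ r * f) = Var 1 * ext r \<rho> \<sigma> f"
proof -
  have tuS: "tu (Suc i) j = Var 0 * tu i j" "tu i (Suc j) = Var 1 * tu i j" for i j
    by (simp_all add: tu_def mult_ac)
  have "(r + a) div r = Suc (a div r)" for a using assms by simp
  then show "ext r \<rho> \<sigma> (Var 0 ^ r * f) = Var 0 * ext r \<rho> \<sigma> f" "ext r \<rho> \<sigma> (Var 1 ^ r * f) = Var 1 * ext r \<rho> \<sigma> f"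
    by (induction f rule: mpoly_induct)
      (auto simp: Var_power mult_single ext_single lookup_add lookup_single tuS distrib_left mult.left_commute simp del: div_add_self1)
qed

abbreviation pow_subst :: "nat \<Rightarrow> 'k::field mpoly \<Rightarrow> 'k mpoly" where
  "pow_subst r \<equiv> bisubst (Var 0 ^ r) (Var 1 ^ r)"

lemma ext_pow_subst:
  assumes "r > 0" "p \<in> polys 2"
  shows "ext r \<rho> \<sigma> (pow_subst r p * f) = p * ext r \<rho> \<sigma> f"
  using assms(2)
proof (induction p rule: Var01_induct)
  case (Var1 p)
  have *: "pow_subst r (Var 1 * p) * f = Var 1 ^ r * (pow_subst r p * f)" by (simp add: mult_ac)
  show ?case unfolding * ext_Var[OF assms(1)] Var1.IH by (simp only: mult_ac)
next
  case (Var0 p)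
  have *: "pow_subst r (Var 0 * p) * f = Var 0 ^ r * (pow_subst r p * f)" by (simp add: mult_ac)
  show ?case unfolding * ext_Var[OF assms(1)] Var0.IH by (simp only: mult_ac)
qed (simp_all add: distrib_right)

lemma pow_subst_tu: "pow_subst r (tu i j) = tu (r * i) (r * j)"
  by (simp add: tu_def power_mult)

text \<open>\<open>K[t, u]\<close> is free over \<open>K[t^r, u^r]\<close> on the monomials with
  both exponents below \<open>r\<close>; the \<open>ext r \<rho> \<sigma>\<close> are the
  coordinates.\<close>

lemma ext_decomposition:
  assumes "r > 0" "f \<in> polys 2"
  shows "f = (\<Sum>\<rho><r. \<Sum>\<sigma><r. pow_subst r (ext r \<rho> \<sigma> f) * tu \<rho> \<sigma>)"
proof -
  have mono: "(\<Sum>\<rho><r. \<Sum>\<sigma><r. pow_subst r (ext r \<rho> \<sigma> (tu i j)) * tu \<rho> \<sigma>) = (tu i j :: 'a mpoly)" for i j :: nat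
  proof -
    have "(\<Sum>\<rho><r. \<Sum>\<sigma><r. pow_subst r (ext r \<rho> \<sigma> (tu i j)) * tu \<rho> \<sigma>) =
      (\<Sum>\<rho><r. \<Sum>\<sigma><r. if i mod r = \<rho> then if j mod r = \<sigma> then tu i j else 0 else 0)"
      by (intro sum.cong refl) (auto simp: ext_tu pow_subst_tu tu_mult)
    also have "\<dots> = (\<Sum>\<rho><r. if i mod r = \<rho> then tu i j else 0)"
      using assms(1) by (intro sum.cong refl) auto
    also have "\<dots> = tu i j" using assms(1) by simp
    finally show ?thesis .
  qed
  define D where "D g = (\<Sum>\<rho><r. \<Sum>\<sigma><r. pow_subst r (ext r \<rho> \<sigma> g) * tu \<rho> \<sigma>)" for g :: "'a mpoly"
  have D: "D (sum h S) = (\<Sum>i\<in>S. D (h i))" "D (Const c * g) = Const c * D g" for h :: "(nat \<Rightarrow>\<^sub>0 nat) \<Rightarrow> 'a mpoly" and S c g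
  proof -
    show "D (Const c * g) = Const c * D g" by (simp add: D_def sum_distrib_left mult.assoc)
    have D0: "D 0 = 0" "D (g1 + g2) = D g1 + D g2" for g1 g2 by (simp_all add: D_def distrib_right sum.distrib)
    show "D (sum h S) = (\<Sum>i\<in>S. D (h i))"
      by (induction S rule: infinite_finite_induct) (simp_all add: D0)
  qed
  have "D f = D (\<Sum>m\<in>Poly_Mapping.keys f. Const (Poly_Mapping.lookup f m) * tu (m0 m) (m1 m))"
    using polys2_eq_sum[OF assms(2)] by simp
  also have "\<dots> = f" unfolding D using polys2_eq_sum[OF assms(2), symmetric] mono by (simp add: D_def)
  finally show ?thesis by (simp add: D_def)
qed

lemma ext_forms:
  assumes "f \<in> forms 2 D" "D = r * e + \<rho> + \<sigma>" "r > 0"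
  shows "ext r \<rho> \<sigma> f \<in> forms 2 e"
  unfolding ext_def lin_def
proof (intro forms_sum forms_Const_mult)
  fix m assume m: "m \<in> Poly_Mapping.keys f"
  then have "m0 m + m1 m = D" using assms(1) polys2_monomial(2)[of m] by (auto simp: forms_def polys_def)
  moreover have "m0 m = r * (m0 m div r) + m0 m mod r" "m1 m = r * (m1 m div r) + m1 m mod r" by simp_all
  ultimately have "m0 m mod r = \<rho> \<Longrightarrow> m1 m mod r = \<sigma> \<Longrightarrow> r * (m0 m div r + m1 m div r) = r * e"
    using assms(2) by (simp add: distrib_left)
  then show "(if m0 m mod r = \<rho> \<and> m1 m mod r = \<sigma> then tu (m0 m div r) (m1 m div r) else 0) \<in> forms 2 e"
    using assms(3) by (auto intro: tu_forms)
qed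

text \<open>Degrees congruent to \<open>-c\<close> modulo \<open>r\<close>, written with a sum to
  stay in the naturals: \<open>c = 0\<close> is the Veronese subring of \<open>K[t, u]\<close>, and
  \<open>c = 2\<close> its canonical module.\<close>

definition wt :: "nat \<Rightarrow> nat \<Rightarrow> 'k::field mpoly set" where
  "wt r c = {f \<in> polys 2. \<forall>m\<in>Poly_Mapping.keys f. r dvd m0 m + m1 m + c}"

lemma wt_add: "f \<in> wt r c \<Longrightarrow> g \<in> wt r c \<Longrightarrow> f + g \<in> wt r c"
  using keys_add[of f g] by (auto simp: wt_def polys_add)

lemma wt_0 [simp]: "0 \<in> wt r c" by (simp add: wt_def)

lemma wt_sum: "(\<And>i. i \<in> S \<Longrightarrow> h i \<in> wt r c) \<Longrightarrow> sum h S \<in> wt r c"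
  by (induction S rule: infinite_finite_induct) (auto intro: wt_add)

lemma wt_mult:
  assumes "f \<in> wt r 0" "g \<in> wt r c"
  shows "f * g \<in> wt r c"
proof -
  have "r dvd m0 m + m1 m + c" if m: "m \<in> Poly_Mapping.keys (f * g)" for m
  proof -
    obtain a b where "m = a + b" "a \<in> Poly_Mapping.keys f" "b \<in> Poly_Mapping.keys g"
      using keys_mult[of f g] m by blast
    then have "r dvd (m0 a + m1 a) + (m0 b + m1 b + c)" "m = a + b"
      using assms by (auto simp: wt_def intro!: dvd_add)
    then show ?thesis by (simp add: lookup_add add_ac)
  qed
  then show ?thesis using assms by (auto simp: wt_def polys_mult)
qed

lemma forms_wt: "f \<in> forms 2 d \<Longrightarrow> r dvd d + c \<Longrightarrow> f \<in> wt r c"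
  using polys2_monomial(2) by (fastforce simp: wt_def forms_def polys_def)

lemma ext_wt_zero:
  assumes "f \<in> wt r c" "\<not> r dvd \<rho> + \<sigma> + c"
  shows "ext r \<rho> \<sigma> f = 0"
  unfolding ext_def lin_def
proof (rule sum.neutral, rule ballI)
  fix m assume "m \<in> Poly_Mapping.keys f"
  then have d: "r dvd m0 m + m1 m + c" using assms(1) by (auto simp: wt_def)
  have "m0 m + m1 m + c = r * (m0 m div r + m1 m div r) + (m0 m mod r + m1 m mod r + c)"
    by (simp add: distrib_left)
  then have "r dvd m0 m mod r + m1 m mod r + c" using d dvd_add_right_iff[of r "r * (m0 m div r + m1 m div r)"] by (metis dvd_triv_left)
  then show "Const (Poly_Mapping.lookup f m) * (if m0 m mod r = \<rho> \<and> m1 m mod r = \<sigma> then tu (m0 m div r) (m1 m div r) else 0) = 0"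
    using assms(2) by auto
qed

text \<open>For \<open>\<rho>, \<tau> < r\<close> the sum \<open>\<rho> + \<tau> + 2\<close> lies
  between \<open>2\<close> and \<open>2 r\<close>, so divisibility by \<open>r\<close> leaves the
  values \<open>r\<close> and \<open>2 r\<close>. The latter forces both exponents to be
  \<open>r - 1\<close>; the former means \<open>\<tau> = r - 2 - \<rho>\<close>. Hence there is one
  \<open>\<tau>\<close> for each \<open>\<rho>\<close>.\<close>

lemma wt2_decomposition:
  assumes "r \<ge> 2" "g \<in> wt r 2"
  defines "\<sigma> \<equiv> \<lambda>\<rho>. if \<rho> = r - 1 then r - 1 else r - 2 - \<rho>"
  shows "g = (\<Sum>\<rho><r. pow_subst r (ext r \<rho> (\<sigma> \<rho>) g) * tu \<rho> (\<sigma> \<rho>))"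
proof -
  have r: "r > 0" using assms(1) by simp
  have "g = (\<Sum>\<rho><r. \<Sum>\<tau><r. pow_subst r (ext r \<rho> \<tau> g) * tu \<rho> \<tau>)"
    by (rule ext_decomposition[OF r]) (use assms(2) in \<open>simp add: wt_def\<close>)
  also have "\<dots> = (\<Sum>\<rho><r. \<Sum>\<tau><r. if \<tau> = \<sigma> \<rho> then pow_subst r (ext r \<rho> \<tau> g) * tu \<rho> \<tau> else 0)"
  proof (intro sum.cong refl)
    fix \<rho> \<tau> assume *: "\<rho> \<in> {..<r}" "\<tau> \<in> {..<r}"
    have "ext r \<rho> \<tau> g = 0" if ne: "\<tau> \<noteq> \<sigma> \<rho>"
    proof (rule ext_wt_zero[OF assms(2)])
      show "\<not> r dvd \<rho> + \<tau> + 2"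
      proof
        assume "r dvd \<rho> + \<tau> + 2"
        then obtain k where k: "\<rho> + \<tau> + 2 = r * k" by blast
        have "r * k < r * 3" "0 < r * k" using k * assms(1) by (simp_all flip: k)
        then have "k = 1 \<or> k = 2" using r by auto
        then show False using k ne * assms(1) by (auto simp: \<sigma>_def split: if_splits)
      qed
    qed
    then show "pow_subst r (ext r \<rho> \<tau> g) * tu \<rho> \<tau> = (if \<tau> = \<sigma> \<rho> then pow_subst r (ext r \<rho> \<tau> g) * tu \<rho> \<tau> else 0)"
      by auto
  qed
  also have "\<dots> = (\<Sum>\<rho><r. pow_subst r (ext r \<rho> (\<sigma> \<rho>) g) * tu \<rho> (\<sigma> \<rho>))"
    using assms(1) by (intro sum.cong refl) (auto simp: \<sigma>_def)
  finally show ?thesis .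
qed

text \<open>The quotient by \<open>t^r\<close> on multiples of \<open>t^r\<close>, by
  \<open>divt_mult\<close>. Being defined linearly on all polynomials, it needs no divisibility side
  conditions in sums.\<close>

definition divt :: "nat \<Rightarrow> 'k::field mpoly \<Rightarrow> 'k mpoly" where
  "divt r = lin Const (\<lambda>m. tu (m0 m - r) (m1 m))"

lemma divt_simps [simp]:
  "divt r 0 = 0" "divt r (f + g) = divt r f + divt r g" "divt r (f - g) = divt r f - divt r g"
  "divt r (Const c * f) = Const c * divt r f"
  by (simp_all add: divt_def lin_add lin_diff lin_Const_mult coeff_hom_Const)

lemma divt_mult:
  assumes "g \<in> polys 2"
  shows "divt r (tu r 0 * g) = g"
proof -
  have "divt r (tu r 0 * (Const c * tu i j)) = Const c * tu i j" for c :: 'a and i j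
  proof -
    have eq: "tu r 0 * (Const c * tu i j) = Const c * tu (r + i) j"
      by (simp add: tu_mult mult.left_commute)
    show ?thesis
      unfolding eq divt_def lin_Const_mult[OF coeff_hom_Const] tu_single[of "r + i" j] lin_single[OF coeff_hom_Const]
      by (simp add: lookup_add lookup_single)
  qed
  then have "divt r (\<Sum>m\<in>S. tu r 0 * (Const (f m) * tu (m0 m) (m1 m))) = (\<Sum>m\<in>S. Const (f m) * tu (m0 m) (m1 m))" for f :: "(nat \<Rightarrow>\<^sub>0 nat) \<Rightarrow> 'a" and S :: "(nat \<Rightarrow>\<^sub>0 nat) set"
    by (induction S rule: infinite_finite_induct) simp_all
  note * = this
  have g: "(\<Sum>m\<in>Poly_Mapping.keys g. Const (Poly_Mapping.lookup g m) * tu (m0 m) (m1 m)) = g"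
    by (rule polys2_eq_sum[OF assms, symmetric])
  have "divt r (tu r 0 * g) = divt r (\<Sum>m\<in>Poly_Mapping.keys g. tu r 0 * (Const (Poly_Mapping.lookup g m) * tu (m0 m) (m1 m)))"
    unfolding sum_distrib_left[symmetric] g ..
  also have "\<dots> = g" unfolding * by (rule g)
  finally show ?thesis .
qed

section \<open>The double structure\<close>

declare of_nat_diff [simp del]

locale rnc_double =
  fixes r :: nat and e :: "nat \<Rightarrow> nat \<Rightarrow> 'k::field" and y m l :: "nat \<Rightarrow> 'k mpoly"
  assumes r2: "r \<ge> 2"
    and adapted: "adapted_coordinates r e y"
    and m_forms: "\<And>i. i \<in> {1..<r} \<Longrightarrow> m i \<in> forms 2 r"
    and l_forms: "\<And>i. i \<in> {1..<r} \<Longrightarrow> l i \<in> forms 2 (r - 2)"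
    and l_indep: "\<And>c. (\<Sum>i\<in>{1..<r}. Const (c i) * l i) = 0 \<Longrightarrow> \<forall>i\<in>{1..<r}. c i = 0"
begin

abbreviation "N \<equiv> 2 * r"
abbreviation "\<pi> \<equiv> rnc_pullback r e"

lemma y_forms: "k < N \<Longrightarrow> y k \<in> forms N 1"
  and y_indep: "(\<Sum>k<N. Const (c k) * y k) = 0 \<Longrightarrow> \<forall>k<N. c k = 0"
  and \<pi>_y: "k < N \<Longrightarrow> \<pi> (y k) = (if k \<le> r then tu (r - k) k else 0)"
  using adapted unfolding adapted_coordinates_def tu_def by blast+

lemma y_polys: "k < N \<Longrightarrow> y k \<in> polys N"
  using y_forms formsD by blast

lemma y_in_span: "k < N \<Longrightarrow> y k \<in> mpoly.span (Var ` {..<N})"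
proof -
  assume "k < N"
  then obtain c where "y k = (\<Sum>i<N. Const (c i) * Var i)" using forms_1_eq_sum[OF y_forms] by blast
  then show ?thesis by (simp only:) (intro mpoly.span_sum mpoly.span_scale mpoly.span_base; simp)
qed

lemma y_basis:
  shows "mpoly.independent (y ` {..<N})" "inj_on y {..<N}" "Var ` {..<N} \<subseteq> mpoly.span (y ` {..<N})"
proof -
  have *: "finite {..<N}" "(\<Sum>k\<in>{..<N}. Const (c k) * y k) = 0 \<Longrightarrow> \<forall>k\<in>{..<N}. c k = 0"
    "finite (Var ` {..<N} :: 'k mpoly set)" "card (Var ` {..<N} :: 'k mpoly set) \<le> card {..<N}"
    "k \<in> {..<N} \<Longrightarrow> y k \<in> mpoly.span (Var ` {..<N})" for c k
    using y_indep[of c] y_in_span card_image_le[of "{..<N}" "Var :: nat \<Rightarrow> 'k mpoly"] by simp_all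
  note sp = family_span[of "{..<N}" y, OF *]
  show "mpoly.independent (y ` {..<N})" "inj_on y {..<N}" "Var ` {..<N} \<subseteq> mpoly.span (y ` {..<N})"
    by (rule sp; simp)+
qed

lemma Var_eq_sum_y:
  assumes "i < N"
  obtains c where "Var i = (\<Sum>k<N. Const (c k) * y k)"
  using span_family_obtain[of "{..<N}" "Var i" y] y_basis(2,3) assms by blast

text \<open>The pullback and the vector field have explicit values on the adapted coordinates, not
  on the variables, so the induction multiplies by \<open>y k\<close>. The case \<open>scale\<close>
  arises when a variable is expanded in the \<open>y k\<close>.\<close>

lemma y_induct [consumes 1, case_names Const add scale y_mult]:
  assumes "F \<in> polys N" "\<And>c. P (Const c)" "\<And>F G. F \<in> polys N \<Longrightarrow> G \<in> polys N \<Longrightarrow> P F \<Longrightarrow> P G \<Longrightarrow> P (F + G)"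
    "\<And>c F. F \<in> polys N \<Longrightarrow> P F \<Longrightarrow> P (Const c * F)"
    "\<And>k F. k < N \<Longrightarrow> F \<in> polys N \<Longrightarrow> P F \<Longrightarrow> P (y k * F)"
  shows "P F"
proof -
  have "F \<in> polys N \<and> P F" using assms(1)
  proof (induction F rule: polys_induct)
    case (Var_mult i F)
    obtain c where c: "Var i = (\<Sum>k<N. Const (c k) * y k)" using Var_eq_sum_y[OF Var_mult(1)] .
    have "(\<Sum>k\<in>S. Const (c k) * y k) * F \<in> polys N \<and> P ((\<Sum>k\<in>S. Const (c k) * y k) * F)" if "S \<subseteq> {..<N}" for S
      using finite_subset[OF that finite_lessThan] that
    proof (induction S rule: finite_induct)
      case empty then show ?case using assms(2)[of 0] by simp
    next
      case (insert k S)
      have "Const (c k) * (y k * F) \<in> polys N \<and> P (Const (c k) * (y k * F))"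
      proof -
        have k: "k < N" "F \<in> polys N" "P F" using insert Var_mult by auto
        then have "y k * F \<in> polys N" "P (y k * F)" using y_polys polys_mult assms(5) by blast+
        then show ?thesis using assms(4) by (simp add: polys_mult)
      qed
      then show ?case using insert by (simp add: distrib_right mult.assoc polys_add assms(3))
    qed
    from this[of "{..<N}"] show ?case unfolding c by simp
  qed (use assms in \<open>auto intro: polys_add\<close>)
  then show ?thesis by simp
qed

lemma \<pi>_simps [simp]:
  "\<pi> 0 = 0" "\<pi> 1 = 1" "\<pi> (F + G) = \<pi> F + \<pi> G" "\<pi> (F - G) = \<pi> F - \<pi> G" "\<pi> (- F) = - \<pi> F"
  "\<pi> (F * G) = \<pi> F * \<pi> G" "\<pi> (Const c) = Const c" "\<pi> (F ^ n) = \<pi> F ^ n" "\<pi> (sum h S) = (\<Sum>i\<in>S. \<pi> (h i))"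
  by (simp_all add: subst_add subst_diff subst_minus subst_mult subst_power subst_sum)

text \<open>
  A vector field along the curve, scaled by \<open>t\<^sup>r\<close> to be polynomial, along which the derivative of
  each equation of the curve is the prescribed value of \<open>\<mu>\<close>. For \<open>k \<le> r\<close> it solves the recursion
  \<open>t\<^sup>2 v (k + 1) - 2 t u v k + u\<^sup>2 v (k - 1) = t\<^sup>r m k\<close> with \<open>v 0 = v 1 = 0\<close>.
\<close>

definition vfield :: "nat \<Rightarrow> 'k mpoly" where
  "vfield k = (if k \<le> r then \<Sum>s\<in>{1..<k}. of_nat (k - s) * (tu (r + s - 1 - k) (k - 1 - s) * m s)
     else tu r 0 * l (k - r))"

lemma vfield_forms: "k < N \<Longrightarrow> vfield k \<in> forms 2 (2 * r - 2)"
proof (cases "k \<le> r")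
  case True
  have "of_nat (k - s) * (tu (r + s - 1 - k) (k - 1 - s) * m s) \<in> forms 2 (2 * r - 2)" if "s \<in> {1..<k}" for s
  proof -
    have "tu (r + s - 1 - k) (k - 1 - s) * m s \<in> forms 2 ((r - 2) + r)"
      using that True r2 by (intro forms_mult tu_forms m_forms) auto
    moreover have "(of_nat (k - s) :: 'k mpoly) = Const (of_nat (k - s))"
      by (simp add: Const_def)
    moreover have "r - 2 + r = 2 * r - 2" using r2 by simp
    ultimately show ?thesis by (simp only: forms_Const_mult)
  qed
  then have "(\<Sum>s\<in>{1..<k}. of_nat (k - s) * (tu (r + s - 1 - k) (k - 1 - s) * m s)) \<in> forms 2 (2 * r - 2)"
    by (rule forms_sum)
  then show ?thesis by (simp only: vfield_def True if_True)
next
  case False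
  assume "k < N"
  then have "tu r 0 * l (k - r) \<in> forms 2 (r + (r - 2))"
    using False by (intro forms_mult tu_forms l_forms) auto
  moreover have "r + (r - 2) = 2 * r - 2" using r2 by simp
  ultimately show ?thesis using False by (simp add: vfield_def)
qed

text \<open>The vector field is prescribed on the coordinates \<open>y k\<close>, while a jet is
  specified on the variables \<open>Var i\<close>; a linear map determined on the independent set of
  the \<open>y k\<close> translates between them.\<close>

definition vlin :: "'k mpoly \<Rightarrow> 'k mpoly" where
  "vlin = (SOME g. Vector_Spaces.linear (\<lambda>a p. Const a * p) (\<lambda>a p. Const a * p) g \<and> (\<forall>k<N. g (y k) = vfield k))"

lemma vlin:
  shows "vlin (F + G) = vlin F + vlin G" "vlin (Const c * F) = Const c * vlin F" "k < N \<Longrightarrow> vlin (y k) = vfield k"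
    "vlin (sum h S) = (\<Sum>i\<in>S. vlin (h i))"
proof -
  interpret vp: vector_space_pair "\<lambda>a (p :: 'k mpoly). Const a * p" "\<lambda>a (p :: 'k mpoly). Const a * p"
    by unfold_locales
  obtain g where g: "Vector_Spaces.linear (\<lambda>a p. Const a * p) (\<lambda>a p. Const a * p) g"
    "\<forall>x\<in>y ` {..<N}. g x = vfield (inv_into {..<N} y x)"
    using vp.linear_independent_extend[OF y_basis(1), of "\<lambda>x. vfield (inv_into {..<N} y x)"] by (elim exE conjE)
  have "g (y k) = vfield k" if "k < N" for k
    using g(2) that y_basis(2) inv_into_f_f[of y "{..<N}" k] by simp
  with g(1) have "Vector_Spaces.linear (\<lambda>a p. Const a * p) (\<lambda>a p. Const a * p) vlin \<and> (\<forall>k<N. vlin (y k) = vfield k)"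
    unfolding vlin_def by (intro someI[of "\<lambda>g. Vector_Spaces.linear (\<lambda>a p. Const a * p) (\<lambda>a p. Const a * p) g \<and> (\<forall>k<N. g (y k) = vfield k)" g]) simp
  then have *: "Vector_Spaces.linear (\<lambda>a p. Const a * p) (\<lambda>a p. Const a * p) vlin" "\<forall>k<N. vlin (y k) = vfield k"
    by simp_all
  show "vlin (F + G) = vlin F + vlin G" by (rule vp.linear_add[OF *(1)])
  show "vlin (Const c * F) = Const c * vlin F" by (rule vp.linear_scale[OF *(1)])
  show "k < N \<Longrightarrow> vlin (y k) = vfield k" using *(2) by simp
  show "vlin (sum h S) = (\<Sum>i\<in>S. vlin (h i))" by (rule vp.linear_sum[OF *(1)])
qed

definition dual_coeff :: "'k \<Rightarrow> 'k mpoly poly" where "dual_coeff c = [:Const c:]"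

text \<open>Evaluation at a point of the curve moved to first order. Values are polynomials in a
  parameter \<open>\<epsilon>\<close>, and no quotient by \<open>\<epsilon>^2\<close> is formed: the
  coefficients at \<open>0\<close> and \<open>1\<close> of a product depend only on those of the
  factors, which makes the second one a derivation over the first.\<close>

definition jet :: "'k mpoly \<Rightarrow> 'k mpoly poly" where
  "jet = lin dual_coeff (meval (\<lambda>i. [:rnc_param r e i, vlin (Var i):]))"

definition \<delta> :: "'k mpoly \<Rightarrow> 'k mpoly" where "\<delta> F = coeff (jet F) 1"

lemma coeff_hom_dual: "coeff_hom dual_coeff"
  by (simp add: coeff_hom_def dual_coeff_def Const_add Const_mult one_pCons)

lemma jet_simps:
  "jet (F + G) = jet F + jet G" "jet (F * G) = jet F * jet G" "jet (Const c) = [:Const c:]"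
  "jet (Var i) = [:rnc_param r e i, vlin (Var i):]" "jet (F - G) = jet F - jet G" "jet 0 = 0"
proof -
  show "jet (Const c) = [:Const c:]"
    by (simp add: jet_def Const_def lin_single[OF coeff_hom_dual]) (simp add: dual_coeff_def Const_def)
  show "jet (Var i) = [:rnc_param r e i, vlin (Var i):]"
    by (simp add: jet_def Var_def lin_single coeff_hom_dual) (simp add: dual_coeff_def flip: Var_def one_pCons)
qed (simp_all add: jet_def lin_add lin_diff lin_mult meval_add coeff_hom_dual)

lemma coeff_0_jet: "coeff (jet F) 0 = \<pi> F"
proof (induction F rule: mpoly_induct)
  case (single m c)
  have "coeff (meval (\<lambda>i. [:rnc_param r e i, vlin (Var i):]) m) 0 = meval (rnc_param r e) m"
    by (simp add: meval_def poly_prod flip: poly_0_coeff_0)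
  then show ?case
    by (simp add: jet_def lin_single coeff_hom_dual coeff_hom_Const subst_eq_lin dual_coeff_def)
qed (simp_all add: jet_simps)

lemma \<delta>_simps [simp]:
  "\<delta> 0 = 0" "\<delta> (F + G) = \<delta> F + \<delta> G" "\<delta> (F - G) = \<delta> F - \<delta> G" "\<delta> (F * G) = \<pi> F * \<delta> G + \<delta> F * \<pi> G"
  "\<delta> (Const c) = 0" "\<delta> (sum h S) = (\<Sum>i\<in>S. \<delta> (h i))"
proof -
  show "\<delta> (F * G) = \<pi> F * \<delta> G + \<delta> F * \<pi> G"
    by (simp add: \<delta>_def jet_simps coeff_mult coeff_0_jet[symmetric] One_nat_def)
  show "\<delta> (Const c) = 0" by (simp add: \<delta>_def jet_simps One_nat_def)
  show "\<delta> (sum h S) = (\<Sum>i\<in>S. \<delta> (h i))"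
    by (induction S rule: infinite_finite_induct) (simp_all add: \<delta>_def jet_simps)
qed (simp_all add: \<delta>_def jet_simps)

lemma \<delta>_y: "k < N \<Longrightarrow> \<delta> (y k) = vfield k"
proof -
  assume k: "k < N"
  obtain c where c: "y k = (\<Sum>i<N. Const (c i) * Var i)" using forms_1_eq_sum[OF y_forms[OF k]] .
  have "\<delta> (Var i) = vlin (Var i)" for i by (simp add: \<delta>_def jet_simps One_nat_def)
  then have "\<delta> (y k) = vlin (y k)" unfolding c by (simp add: vlin)
  then show ?thesis by (simp add: vlin k)
qed

text \<open>The exponents depend on \<open>a\<close> and \<open>b\<close> only through
  \<open>a + b\<close>, so all four products in a minor become combinations of the same monomials.
  The factor \<open>of_nat (b - s)\<close> is zero for \<open>s \<ge> b\<close>, which lets the sum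
  run over a range independent of \<open>b\<close>.\<close>

lemma \<delta>_product_part:
  assumes "a \<le> r" "b \<le> r" "a + b < 2 * r"
  shows "tu (r - a) a * vfield b = (\<Sum>s\<in>{1..<r}. of_nat (b - s) * (tu (2 * r - 1 - (a + b) + s) (a + b - 1 - s) * m s))"
proof -
  have "tu (r - a) a * vfield b = (\<Sum>s\<in>{1..<b}. of_nat (b - s) * (tu (r - a) a * tu (r + s - 1 - b) (b - 1 - s) * m s))"
    using assms(2) by (simp add: vfield_def sum_distrib_left mult_ac)
  also have "\<dots> = (\<Sum>s\<in>{1..<b}. of_nat (b - s) * (tu (2 * r - 1 - (a + b) + s) (a + b - 1 - s) * m s))"
  proof (intro sum.cong refl)
    fix s assume s: "s \<in> {1..<b}"
    have "r - a + (r + s - 1 - b) = 2 * r - 1 - (a + b) + s" "a + (b - 1 - s) = a + b - 1 - s"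
      using s assms by auto
    then show "of_nat (b - s) * (tu (r - a) a * tu (r + s - 1 - b) (b - 1 - s) * m s) =
      of_nat (b - s) * (tu (2 * r - 1 - (a + b) + s) (a + b - 1 - s) * m s)" by (simp add: tu_mult)
  qed
  also have "\<dots> = (\<Sum>s\<in>{1..<r}. of_nat (b - s) * (tu (2 * r - 1 - (a + b) + s) (a + b - 1 - s) * m s))"
    using assms(2) by (intro sum.mono_neutral_left) auto
  finally show ?thesis .
qed

text \<open>Over a common range of summation the coefficient of \<open>H s\<close> is
  \<open>[s < q] - [s < p]\<close>, the indicator of \<open>p \<le> s < q\<close>, because
  consecutive truncated differences \<open>k - s\<close> differ by \<open>[s < k]\<close>. This is
  why the solution of the recursion carries the weights \<open>k - s\<close>.\<close>

lemma \<delta>_minor: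
  assumes "1 \<le> p" "p < q" "q \<le> r"
  shows "\<delta> (rnc_minor y p q) = tu r 0 * mu_minor r m p q"
proof -
  define H where "H s = tu (2 * r - p - q + s) (p + q - 2 - s) * m s" for s
  have pq: "p - 1 < N" "p < N" "q - 1 < N" "q < N" and le: "p - 1 \<le> r" "q - 1 \<le> r" "p \<le> r" using assms r2 by auto
  have *: "tu (r - a) a * vfield b = (\<Sum>s\<in>{1..<r}. of_nat (b - s) * H s)"
    if ab: "a \<le> r" "b \<le> r" "a + b = p + q - 1" for a b
  proof -
    have "2 * r - 1 - (a + b) = 2 * r - p - q" "a + b - 1 = p + q - 2" using ab assms by auto
    then show ?thesis using \<delta>_product_part[of a b] ab assms by (simp add: H_def)
  qed
  have "\<delta> (rnc_minor y p q) = tu (r - (p - 1)) (p - 1) * vfield q + tu (r - q) q * vfield (p - 1)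
      - (tu (r - p) p * vfield (q - 1) + tu (r - (q - 1)) (q - 1) * vfield p)"
    using \<pi>_y[OF pq(1)] \<pi>_y[OF pq(2)] \<pi>_y[OF pq(3)] \<pi>_y[OF pq(4)] le assms(3)
      \<delta>_y[OF pq(1)] \<delta>_y[OF pq(2)] \<delta>_y[OF pq(3)] \<delta>_y[OF pq(4)]
    by (simp only: rnc_minor_def \<delta>_simps if_True ac_simps)
  also have "\<dots> = (\<Sum>s\<in>{1..<r}. (of_nat (q - s) + of_nat (p - 1 - s) - (of_nat (q - 1 - s) + of_nat (p - s))) * H s)"
  proof -
    have "tu (r - (p - 1)) (p - 1) * vfield q = (\<Sum>s\<in>{1..<r}. of_nat (q - s) * H s)"
      "tu (r - q) q * vfield (p - 1) = (\<Sum>s\<in>{1..<r}. of_nat (p - 1 - s) * H s)"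
      "tu (r - p) p * vfield (q - 1) = (\<Sum>s\<in>{1..<r}. of_nat (q - 1 - s) * H s)"
      "tu (r - (q - 1)) (q - 1) * vfield p = (\<Sum>s\<in>{1..<r}. of_nat (p - s) * H s)"
      by (rule *; use assms in simp)+
    then show ?thesis by (simp only: sum.distrib[symmetric] sum_subtractf[symmetric] distrib_right left_diff_distrib)
  qed
  also have "\<dots> = (\<Sum>s\<in>{1..<r}. if s \<in> {p..<q} then H s else 0)"
  proof (intro sum.cong refl)
    fix s assume "s \<in> {1..<r}"
    \<comment> \<open>Negative terms are moved to the other side, so that the identity holds for
      truncated differences of naturals.\<close>
    have "(q - s) + (p - 1 - s) = (q - 1 - s) + (p - s) + (if s \<in> {p..<q} then 1 else 0)" using assms by auto
    from arg_cong[OF this, of "of_nat :: nat \<Rightarrow> 'k mpoly"]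
    have "(of_nat (q - s) + of_nat (p - 1 - s) :: 'k mpoly) = of_nat (q - 1 - s) + of_nat (p - s) + (if s \<in> {p..<q} then 1 else 0)"
      unfolding of_nat_add by (simp only: of_nat_0 of_nat_1 if_distrib[of of_nat])
    then show "(of_nat (q - s) + of_nat (p - 1 - s) - (of_nat (q - 1 - s) + of_nat (p - s))) * H s = (if s \<in> {p..<q} then H s else 0)"
      by (simp only: add_diff_cancel_left') simp
  qed
  also have "\<dots> = (\<Sum>s\<in>{p..<q}. H s)"
    using assms by (subst sum.inter_restrict[symmetric]) (auto intro!: sum.cong)
  \<comment> \<open>The reflection \<open>h = p + q - 1 - s\<close> of the interval matches the
    indexing of \<open>mu_minor\<close>.\<close>
  also have "\<dots> = (\<Sum>h\<in>{p..<q}. tu r 0 * (Var 0 ^ (r - h - 1) * Var 1 ^ (h - 1) * m (p + q - 1 - h)))"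
  proof (rule sum.reindex_bij_witness[of _ "\<lambda>h. p + q - 1 - h" "\<lambda>h. p + q - 1 - h"])
    fix s assume s: "s \<in> {p..<q}"
    have 1: "p + q - 1 - (p + q - 1 - s) = s" "r + (r - (p + q - 1 - s) - 1) = 2 * r - p - q + s" "p + q - 1 - s - 1 = p + q - 2 - s"
      using s assms by auto
    show "tu r 0 * (Var 0 ^ (r - (p + q - 1 - s) - 1) * Var 1 ^ (p + q - 1 - s - 1) * m (p + q - 1 - (p + q - 1 - s))) = H s"
      unfolding tu_def[symmetric] H_def mult.assoc[symmetric] tu_mult 1 add_0 ..
  qed (use assms in auto)
  finally show ?thesis by (simp add: mu_minor_def sum_distrib_left)
qed

end

section \<open>The ideal of the curve and a module basis of its coordinate ring\<close>

context rnc_double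
begin

abbreviation "emb \<equiv> bisubst (y 0) (y r)"

lemma yN: "0 < N" "r < N" using r2 by auto

lemma emb_polys: "emb p \<in> polys N" by (rule bisubst_polys) (use yN y_polys in auto)

definition comb :: "(nat \<Rightarrow> nat \<Rightarrow> 'k mpoly) \<Rightarrow> (nat \<Rightarrow> 'k mpoly) \<Rightarrow> 'k mpoly" where
  "comb a b = (\<Sum>q\<in>{1..r}. \<Sum>p\<in>{1..<q}. a p q * rnc_minor y p q) + (\<Sum>i\<in>{1..<r}. b i * y (r + i))"

definition mu_comb :: "(nat \<Rightarrow> nat \<Rightarrow> 'k mpoly) \<Rightarrow> (nat \<Rightarrow> 'k mpoly) \<Rightarrow> 'k mpoly" where
  "mu_comb a b = (\<Sum>q\<in>{1..r}. \<Sum>p\<in>{1..<q}. \<pi> (a p q) * mu_minor r m p q) + (\<Sum>i\<in>{1..<r}. \<pi> (b i) * l i)"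

definition J :: "'k mpoly set" where
  "J = {comb a b | a b. (\<forall>p q. a p q \<in> polys N) \<and> (\<forall>i. b i \<in> polys N)}"

lemma minor_polys: "1 \<le> p \<Longrightarrow> p < q \<Longrightarrow> q \<le> r \<Longrightarrow> rnc_minor y p q \<in> polys N"
  unfolding rnc_minor_def using r2 by (intro polys_diff polys_mult y_polys) auto

lemma \<pi>_minor: "1 \<le> p \<Longrightarrow> p < q \<Longrightarrow> q \<le> r \<Longrightarrow> \<pi> (rnc_minor y p q) = 0"
proof -
  assume pq: "1 \<le> p" "p < q" "q \<le> r"
  then have "r - (p - 1) + (r - q) = r - p + (r - (q - 1))" "p - 1 + q = p + (q - 1)" by auto
  moreover have "p - 1 \<le> r" "q - 1 \<le> r" "p \<le> r" "p - 1 < N" "p < N" "q - 1 < N" "q < N" using pq r2 by auto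
  ultimately show ?thesis using pq by (simp add: rnc_minor_def \<pi>_y tu_mult)
qed

lemma \<pi>_comb: "\<pi> (comb a b) = 0"
proof -
  have "\<pi> (a p q * rnc_minor y p q) = 0" if "q \<in> {1..r}" "p \<in> {1..<q}" for p q
    using that by (simp add: \<pi>_minor)
  then have "(\<Sum>q\<in>{1..r}. \<Sum>p\<in>{1..<q}. \<pi> (a p q * rnc_minor y p q)) = 0"
    by (intro sum.neutral ballI)
  moreover have "\<pi> (b i * y (r + i)) = 0" if "i \<in> {1..<r}" for i
    using that by (simp add: \<pi>_y)
  then have "(\<Sum>i\<in>{1..<r}. \<pi> (b i * y (r + i))) = 0"
    by (intro sum.neutral ballI)
  ultimately show ?thesis unfolding comb_def \<pi>_simps(3,9) by simp
qed

text \<open>The left side depends on the element alone, and \<open>t^r\<close> can be cancelled, so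
  the value of \<open>\<mu>\<close> does not depend on the coefficients chosen in a
  combination.\<close>

lemma \<delta>_comb: "\<delta> (comb a b) = tu r 0 * mu_comb a b"
proof -
  have "\<delta> (a p q * rnc_minor y p q) = tu r 0 * (\<pi> (a p q) * mu_minor r m p q)" if "q \<in> {1..r}" "p \<in> {1..<q}" for p q
    using that by (simp add: \<delta>_minor \<pi>_minor mult_ac)
  moreover have "\<delta> (b i * y (r + i)) = tu r 0 * (\<pi> (b i) * l i)" if "i \<in> {1..<r}" for i
    using that by (simp add: \<pi>_y \<delta>_y vfield_def mult_ac)
  ultimately show ?thesis
    unfolding comb_def mu_comb_def \<delta>_simps(2,6) distrib_left sum_distrib_left by simp
qed

lemma J_polys: "F \<in> J \<Longrightarrow> F \<in> polys N"
  unfolding J_def comb_def using minor_polys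
  by (auto intro!: polys_add polys_sum polys_mult y_polys)

lemma \<pi>_J: "F \<in> J \<Longrightarrow> \<pi> F = 0"
  unfolding J_def using \<pi>_comb by auto

lemma J_ideal: "is_ideal (polys N) J"
  unfolding is_ideal_def
proof (intro conjI ballI)
  show "J \<subseteq> polys N" using J_polys by blast
  have "comb (\<lambda>_ _. 0) (\<lambda>_. 0) = 0" by (simp add: comb_def)
  then show "0 \<in> J" unfolding J_def by (intro CollectI exI[of _ "\<lambda>_ _. 0"] exI[of _ "\<lambda>_. 0"]) simp
  fix F G assume "F \<in> J" "G \<in> J"
  then obtain a b a' b' where *: "F = comb a b" "\<forall>p q. a p q \<in> polys N" "\<forall>i. b i \<in> polys N"
    "G = comb a' b'" "\<forall>p q. a' p q \<in> polys N" "\<forall>i. b' i \<in> polys N" unfolding J_def by blast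
  have "F + G = comb (\<lambda>p q. a p q + a' p q) (\<lambda>i. b i + b' i)"
    unfolding * comb_def by (simp add: distrib_right sum.distrib)
  then show "F + G \<in> J" unfolding J_def using * by (auto intro!: exI polys_add)
next
  fix c F :: "'k mpoly" assume "c \<in> polys N" "F \<in> J"
  then obtain a b where *: "F = comb a b" "\<forall>p q. a p q \<in> polys N" "\<forall>i. b i \<in> polys N" "c \<in> polys N" unfolding J_def by blast
  have "c * F = comb (\<lambda>p q. c * a p q) (\<lambda>i. c * b i)"
    unfolding * comb_def by (simp add: distrib_left sum_distrib_left mult.assoc)
  then show "c * F \<in> J" unfolding J_def using * by (auto intro!: exI polys_mult)
qed

lemmas JD = is_idealD[OF J_ideal]

lemma J_diff: "F \<in> J \<Longrightarrow> G \<in> J \<Longrightarrow> F - G \<in> J"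
  by (rule is_ideal_diff[OF is_subring_polys J_ideal])

lemma minor_J: "1 \<le> p \<Longrightarrow> p < q \<Longrightarrow> q \<le> r \<Longrightarrow> rnc_minor y p q \<in> J"
proof -
  assume pq: "1 \<le> p" "p < q" "q \<le> r"
  have "comb (\<lambda>p' q'. if p' = p \<and> q' = q then 1 else 0) (\<lambda>_. 0) =
    (\<Sum>q'\<in>{1..r}. \<Sum>p'\<in>{1..<q'}. if q' = q then if p' = p then rnc_minor y p q else 0 else 0)"
  proof -
    have "(if p' = p \<and> q' = q then 1 else 0) * rnc_minor y p' q' = (if q' = q then if p' = p then rnc_minor y p q else 0 else 0)" for p' q'
      by auto
    then show ?thesis by (simp only: comb_def mult_zero_left sum.neutral_const add_0_right)
  qed
  also have "\<dots> = (\<Sum>q'\<in>{1..r}. if q' = q then rnc_minor y p q else 0)"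
    using pq by (intro sum.cong refl) auto
  also have "\<dots> = rnc_minor y p q" using pq by simp
  finally show ?thesis unfolding J_def
    by (intro CollectI exI[of _ "\<lambda>p' q'. if p' = p \<and> q' = q then 1 else 0"] exI[of _ "\<lambda>_. 0"]) simp
qed

lemma y_J: "r < j \<Longrightarrow> j < N \<Longrightarrow> y j \<in> J"
proof -
  assume j: "r < j" "j < N"
  have "comb (\<lambda>_ _. 0) (\<lambda>i. if i = j - r then 1 else 0) = (\<Sum>i\<in>{1..<r}. if i = j - r then y j else 0)"
  proof -
    have "(if i = j - r then 1 else 0) * y (r + i) = (if i = j - r then y j else 0)" for i using j by auto
    then show ?thesis by (simp only: comb_def mult_zero_left sum.neutral_const add_0)
  qed
  also have "\<dots> = y j"
  proof -
    have "j - r \<in> {1..<r}" using j by auto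
    then show ?thesis by simp
  qed
  finally show ?thesis unfolding J_def
    by (intro CollectI exI[of _ "\<lambda>_ _. 0"] exI[of _ "\<lambda>i. if i = j - r then 1 else 0"]) simp
qed

lemma conormal_kernel_eq: "conormal_kernel r e y m l = {F \<in> J. \<delta> F = 0}"
proof -
  have "mu_comb a b = 0 \<longleftrightarrow> \<delta> (comb a b) = 0" for a b by (simp add: \<delta>_comb)
  then show ?thesis
    unfolding conormal_kernel_def J_def comb_def[symmetric] mu_comb_def[symmetric] by auto
qed

text \<open>Lifts of a basis of the Veronese ring over \<open>K[t^r, u^r]\<close>. Slot
  \<open>0\<close> holds \<open>1\<close>, because \<open>y 0\<close> maps to the coefficient
  \<open>t^r\<close>; for \<open>0 < k < r\<close> the coordinate \<open>y k\<close> maps to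
  \<open>t^(r-k) u^k\<close>.\<close>

definition e1 :: "nat \<Rightarrow> 'k mpoly" where "e1 k = (if k = 0 then 1 else y k)"

lemma e1_polys: "k < r \<Longrightarrow> e1 k \<in> polys N" using y_polys r2 by (auto simp: e1_def)

lemma \<pi>_e1: "k < r \<Longrightarrow> \<pi> (e1 k) = (if k = 0 then 1 else tu (r - k) k)"
  by (simp add: e1_def \<pi>_y)

definition decomposable :: "'k mpoly set" where
  "decomposable = {F. \<exists>p. (\<forall>k<r. p k \<in> polys 2) \<and> F - (\<Sum>k<r. emb (p k) * e1 k) \<in> J}"

lemma decomposable_add: "F \<in> decomposable \<Longrightarrow> G \<in> decomposable \<Longrightarrow> F + G \<in> decomposable"
proof -
  assume "F \<in> decomposable" "G \<in> decomposable"
  then obtain p q where "\<forall>k<r. p k \<in> polys 2" "F - (\<Sum>k<r. emb (p k) * e1 k) \<in> J"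
    "\<forall>k<r. q k \<in> polys 2" "G - (\<Sum>k<r. emb (q k) * e1 k) \<in> J" unfolding decomposable_def by blast
  then show ?thesis unfolding decomposable_def
    by (intro CollectI exI[of _ "\<lambda>k. p k + q k"]) (auto simp: polys_add distrib_right sum.distrib algebra_simps dest: JD(3))
qed

lemma decomposable_emb: "F \<in> decomposable \<Longrightarrow> c \<in> polys 2 \<Longrightarrow> emb c * F \<in> decomposable"
proof -
  assume "F \<in> decomposable" and c: "c \<in> polys 2"
  then obtain p where p: "\<forall>k<r. p k \<in> polys 2" "F - (\<Sum>k<r. emb (p k) * e1 k) \<in> J" unfolding decomposable_def by blast
  have "emb c * (F - (\<Sum>k<r. emb (p k) * e1 k)) = emb c * F - (\<Sum>k<r. emb (c * p k) * e1 k)"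
    by (simp add: right_diff_distrib sum_distrib_left mult.assoc)
  then have "emb c * F - (\<Sum>k<r. emb (c * p k) * e1 k) \<in> J" using JD(4)[OF emb_polys p(2), of c] by simp
  then show ?thesis unfolding decomposable_def using p(1) c
    by (intro CollectI exI[of _ "\<lambda>k. c * p k"]) (auto simp: polys_mult)
qed

lemma J_decomposable: "F \<in> J \<Longrightarrow> F \<in> decomposable"
  unfolding decomposable_def by (intro CollectI exI[of _ "\<lambda>_. 0"]) simp

lemma e1_decomposable: "k < r \<Longrightarrow> e1 k \<in> decomposable"
proof -
  assume k: "k < r"
  have "(\<Sum>k'<r. emb (if k' = k then 1 else 0) * e1 k') = (\<Sum>k'<r. if k' = k then e1 k' else 0)"
    by (intro sum.cong refl) simp
  also have "\<dots> = e1 k" using k by simp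
  finally show ?thesis unfolding decomposable_def using JD(2)
    by (intro CollectI exI[of _ "\<lambda>k'. if k' = k then 1 else 0"]) simp
qed

lemma decomposable_sum: "(\<And>i. i \<in> S \<Longrightarrow> h i \<in> decomposable) \<Longrightarrow> sum h S \<in> decomposable"
  by (induction S rule: infinite_finite_induct) (auto intro: decomposable_add J_decomposable JD(2))

lemma y0_decomposable: "F \<in> decomposable \<Longrightarrow> y 0 * F \<in> decomposable" and yr_decomposable: "F \<in> decomposable \<Longrightarrow> y r * F \<in> decomposable"
  using decomposable_emb[of F "Var 0"] decomposable_emb[of F "Var 1"] by (auto simp: polys_Var)

lemma one_decomposable: "1 \<in> decomposable" using e1_decomposable[of 0] r2 by (simp add: e1_def)

lemma y_decomposable: "j < N \<Longrightarrow> y j \<in> decomposable"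
proof -
  assume j: "j < N"
  consider "j = 0" | "j = r" | "0 < j" "j < r" | "r < j" by linarith
  then show ?thesis
    using y0_decomposable[OF one_decomposable] yr_decomposable[OF one_decomposable] e1_decomposable[of j] J_decomposable[OF y_J] j
    by cases (auto simp: e1_def)
qed

text \<open>Straightening: modulo \<open>J\<close> a minor replaces \<open>y (Suc j) * y k\<close>
  by \<open>y j * y (Suc k)\<close>, moving the indices apart until the product contains
  \<open>y 0\<close> or \<open>y r\<close>.\<close>

lemma yy_decomposable:
  "j \<le> k \<Longrightarrow> k \<le> r \<Longrightarrow> y j * y k \<in> decomposable"
proof (induction j arbitrary: k)
  case 0
  show ?case by (rule y0_decomposable, rule y_decomposable) (use 0 r2 in auto)
next
  case (Suc j)
  show ?case
  proof (cases "k = r")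
    case True
    have "y (Suc j) \<in> decomposable" by (rule y_decomposable) (use Suc r2 in auto)
    then show ?thesis using yr_decomposable[of "y (Suc j)"] True by (simp add: mult.commute)
  next
    case False
    have "y j * y (Suc k) \<in> decomposable" by (rule Suc.IH) (use Suc False in auto)
    moreover have "rnc_minor y (Suc j) (Suc k) \<in> J" by (rule minor_J) (use Suc False in auto)
    then have "- rnc_minor y (Suc j) (Suc k) \<in> decomposable" using J_decomposable J_diff[OF JD(2)] by fastforce
    ultimately have "y j * y (Suc k) + - rnc_minor y (Suc j) (Suc k) \<in> decomposable" by (rule decomposable_add)
    then show ?thesis by (simp add: rnc_minor_def)
  qed
qed

lemma y_e1_decomposable: "j < N \<Longrightarrow> k < r \<Longrightarrow> y j * e1 k \<in> decomposable"
proof -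
  assume j: "j < N" "k < r"
  show ?thesis
  proof (cases "k = 0")
    case True then show ?thesis using y_decomposable[OF j(1)] by (simp add: e1_def)
  next
    case False
    show ?thesis
    proof (cases "r < j")
      case True
      then show ?thesis using J_decomposable[OF JD(4)[OF e1_polys[OF j(2)] y_J[OF True j(1)]]] by (simp add: mult.commute)
    next
      case False
      then show ?thesis
        using yy_decomposable[of j k] yy_decomposable[of k j] j \<open>k \<noteq> 0\<close> by (cases "j \<le> k") (auto simp: e1_def mult.commute)
    qed
  qed
qed

lemma polys_decomposable: "F \<in> polys N \<Longrightarrow> F \<in> decomposable"
proof (induction F rule: y_induct)
  case (Const c)
  show ?case using decomposable_emb[OF one_decomposable, of "Const c"] by simp
next
  case (add F G) then show ?case by (blast intro: decomposable_add)
next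
  case (scale c F) then show ?case using decomposable_emb[of F "Const c"] by simp
next
  case (y_mult j F)
  then obtain p where p: "\<forall>k<r. p k \<in> polys 2" "F - (\<Sum>k<r. emb (p k) * e1 k) \<in> J" unfolding decomposable_def by blast
  have "y j * (F - (\<Sum>k<r. emb (p k) * e1 k)) \<in> decomposable"
    by (rule J_decomposable[OF JD(4)[OF y_polys[OF y_mult(1)] p(2)]])
  moreover have "(\<Sum>k<r. emb (p k) * (y j * e1 k)) \<in> decomposable"
    using p(1) y_e1_decomposable[OF y_mult(1)] by (intro decomposable_sum decomposable_emb) auto
  ultimately have "y j * (F - (\<Sum>k<r. emb (p k) * e1 k)) + (\<Sum>k<r. emb (p k) * (y j * e1 k)) \<in> decomposable" by (rule decomposable_add)
  moreover have "y j * (F - (\<Sum>k<r. emb (p k) * e1 k)) + (\<Sum>k<r. emb (p k) * (y j * e1 k)) = y j * F"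
    by (simp add: right_diff_distrib sum_distrib_left mult.left_commute)
  ultimately show ?case by simp
qed

lemma \<pi>_emb: "p \<in> polys 2 \<Longrightarrow> \<pi> (emb p) = pow_subst r p"
proof (induction p rule: Var01_induct)
  case (Var0 p) then show ?case using \<pi>_y[OF yN(1)] by (simp add: tu_def)
next
  case (Var1 p) then show ?case using \<pi>_y[OF yN(2)] by (simp add: tu_def)
qed simp_all

text \<open>Coordinate at the \<open>k\<close>-th basis element of the Veronese ring, whose
  exponents modulo \<open>r\<close> are \<open>(r - k, k)\<close>, or \<open>(0, 0)\<close> for
  \<open>k = 0\<close>.\<close>

definition \<kappa> :: "nat \<Rightarrow> 'k mpoly \<Rightarrow> 'k mpoly" where
  "\<kappa> k = (if k = 0 then ext r 0 0 else ext r (r - k) k)"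

lemma \<kappa>_simps [simp]:
  "\<kappa> k 0 = 0" "\<kappa> k (f + g) = \<kappa> k f + \<kappa> k g" "\<kappa> k (f - g) = \<kappa> k f - \<kappa> k g" "\<kappa> k (Const c * f) = Const c * \<kappa> k f"
  "\<kappa> k (sum h S) = (\<Sum>i\<in>S. \<kappa> k (h i))" "\<kappa> k f \<in> polys 2"
  by (simp_all add: \<kappa>_def)

lemma \<kappa>_e1:
  assumes "k < r" "k' < r" "p \<in> polys 2"
  shows "\<kappa> k (pow_subst r p * \<pi> (e1 k')) = (if k = k' then p else 0)"
proof -
  have r0: "r > 0" using r2 by simp
  have *: "\<pi> (e1 k') = (if k' = 0 then tu 0 0 else tu (r - k') k')" using \<pi>_e1[OF assms(2)] by simp
  show ?thesis
    unfolding * \<kappa>_def using assms by (auto simp: ext_pow_subst[OF r0] ext_tu simp del: tu_0_0) simp_all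
qed

text \<open>Projection onto the ideal of the curve along the span of the \<open>e1 k\<close> over
  \<open>K[y 0, y r]\<close>. As a module over that subring, the coordinate ring of the double
  structure is thereby split into a copy of the Veronese ring and the canonical module.\<close>

definition nf :: "'k mpoly \<Rightarrow> 'k mpoly" where
  "nf F = F - (\<Sum>k<r. emb (\<kappa> k (\<pi> F)) * e1 k)"

text \<open>Applying the pullback to a decomposition identifies its coefficients as the
  \<open>\<kappa> k (\<pi> F)\<close>, so \<open>nf\<close> subtracts precisely the part outside
  \<open>J\<close>.\<close>

lemma nf_J: "F \<in> polys N \<Longrightarrow> nf F \<in> J"
proof -
  assume "F \<in> polys N"
  then obtain p where p: "\<forall>k<r. p k \<in> polys 2" "F - (\<Sum>k<r. emb (p k) * e1 k) \<in> J"
    using polys_decomposable unfolding decomposable_def by blast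
  have "\<kappa> k (\<pi> F) = p k" if k: "k < r" for k
  proof -
    have "\<pi> F = \<pi> (\<Sum>k<r. emb (p k) * e1 k)" using \<pi>_J[OF p(2)] by simp
    also have "\<dots> = (\<Sum>k<r. pow_subst r (p k) * \<pi> (e1 k))" using p(1) by (simp add: \<pi>_emb)
    finally have "\<kappa> k (\<pi> F) = (\<Sum>k'<r. \<kappa> k (pow_subst r (p k') * \<pi> (e1 k')))" by simp
    also have "\<dots> = (\<Sum>k'<r. if k = k' then p k' else 0)"
      using p(1) by (intro sum.cong refl \<kappa>_e1 k) auto
    finally show ?thesis using k by simp
  qed
  then have "nf F = F - (\<Sum>k<r. emb (p k) * e1 k)" by (simp add: nf_def)
  then show ?thesis using p(2) by simp
qed

lemma nf_simps [simp]: "nf (F + G) = nf F + nf G" "nf (F - G) = nf F - nf G" "nf (Const c * F) = Const c * nf F"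
  by (simp_all add: nf_def distrib_right left_diff_distrib sum.distrib sum_subtractf right_diff_distrib sum_distrib_left mult.assoc)

lemma nf_id: "\<pi> F = 0 \<Longrightarrow> nf F = F" by (simp add: nf_def)

lemma nf_y: "nf (y 0 * F) = y 0 * nf F" "nf (y r * F) = y r * nf F"
proof -
  have r0: "r > 0" using r2 by simp
  have *: "\<pi> (y 0) = Var 0 ^ r" "\<pi> (y r) = Var 1 ^ r" using \<pi>_y[OF yN(1)] \<pi>_y[OF yN(2)] by (simp_all add: tu_def)
  have "\<kappa> k (Var 0 ^ r * f) = Var 0 * \<kappa> k f" "\<kappa> k (Var 1 ^ r * f) = Var 1 * \<kappa> k f" for k f
    by (simp_all add: \<kappa>_def ext_Var[OF r0])
  then show "nf (y 0 * F) = y 0 * nf F" "nf (y r * F) = y r * nf F"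
    by (simp_all add: nf_def * right_diff_distrib sum_distrib_left mult.assoc)
qed

lemma nf_e1: "k < r \<Longrightarrow> nf (e1 k) = 0"
proof -
  assume k: "k < r"
  have "\<kappa> k' (\<pi> (e1 k)) = (if k' = k then 1 else 0)" if "k' < r" for k'
    using \<kappa>_e1[OF that k, of 1] by simp
  then have "(\<Sum>k'<r. emb (\<kappa> k' (\<pi> (e1 k))) * e1 k') = (\<Sum>k'<r. if k' = k then e1 k' else 0)"
    by (intro sum.cong refl) simp
  then show ?thesis using k by (simp add: nf_def)
qed

text \<open>Hence the minors and the linear forms generate the full ideal of the curve:
  \<open>nf\<close> maps into \<open>J\<close> and fixes whatever the pullback kills.\<close>

lemma ker_\<pi>: "F \<in> polys N \<Longrightarrow> \<pi> F = 0 \<Longrightarrow> F \<in> J"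
  using nf_J[of F] nf_id[of F] by simp

definition I where "I = {F \<in> polys N. \<pi> F = 0 \<and> \<delta> F = 0}"

lemma conormal_kernel_I: "conormal_kernel r e y m l = I"
  unfolding conormal_kernel_eq I_def using ker_\<pi> \<pi>_J J_polys by blast

lemma I_ideal: "is_ideal (polys N) I"
  unfolding is_ideal_def I_def by (auto intro: polys_add polys_mult)

text \<open>The ideal is already saturated: multiplying by \<open>y 0 ^ d\<close> multiplies the
  pullback, and once this vanishes also the derivation, by a power of \<open>t^r\<close>, a
  nonzerodivisor in \<open>K[t, u]\<close>.\<close>

lemma double_structure_eq: "double_structure r e y m l = I"
proof -
  have "F \<in> I" if F: "F \<in> polys N" and d: "\<forall>g\<in>forms N d. g * F \<in> I" for F d
  proof -
    have "y 0 ^ d \<in> forms N d" using forms_power[OF y_forms[OF yN(1)], of d] by simp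
    with d have "\<pi> (y 0 ^ d * F) = 0" "\<delta> (y 0 ^ d * F) = 0" by (auto simp: I_def)
    moreover have "\<pi> (y 0) \<noteq> 0" using \<pi>_y[OF yN(1)] by simp
    ultimately have "\<pi> F = 0" "\<pi> (y 0) ^ d * \<delta> F = 0" by simp_all
    then show ?thesis using F \<open>\<pi> (y 0) \<noteq> 0\<close> by (simp add: I_def)
  qed
  moreover have "\<forall>g\<in>forms N 0. g * F \<in> I" if "F \<in> I" for F
    using is_idealD(4)[OF I_ideal formsD that] by blast
  ultimately show ?thesis
    unfolding double_structure_def conormal_kernel_I saturation_def
    using is_idealD(1)[OF I_ideal] by blast
qed

end

lemma sum_lessThan_add: "(\<Sum>k<a + b. f k) = (\<Sum>k<a. f k) + (\<Sum>k<b. f (a + k))" for f :: "nat \<Rightarrow> 'a::comm_monoid_add"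
  by (induction b) (simp_all add: add.assoc)

section \<open>The canonical module, the residue pairing and dual bases\<close>

context rnc_double
begin

lemma r0: "r > 0" using r2 by simp

lemma rnc_param_forms: "rnc_param r e k \<in> forms 2 r"
  unfolding rnc_param_def tu_def[symmetric] by (intro forms_sum forms_Const_mult tu_forms) auto

lemma \<pi>_polys: "\<pi> F \<in> polys 2"
  unfolding subst_def using formsD[OF rnc_param_forms] by (auto intro!: polys_sum polys_mult polys_prod polys_power)

lemma \<pi>_wt: "F \<in> polys N \<Longrightarrow> \<pi> F \<in> wt r 0"
proof (induction F rule: y_induct)
  case (Const c) show ?case by (simp, rule forms_wt[OF forms_Const]) simp
next
  case (add F G) then show ?case by (simp add: wt_add)
next
  case (scale c F)
  have "Const c \<in> wt r 0" by (rule forms_wt[OF forms_Const]) simp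
  then show ?case using scale wt_mult by simp
next
  case (y_mult k F)
  have "\<pi> (y k) \<in> wt r 0"
    unfolding \<pi>_y[OF y_mult(1)] by (auto intro!: forms_wt[OF tu_forms[OF refl]])
  then show ?case using y_mult wt_mult by simp
qed

lemma mu_minor_wt: "1 \<le> p \<Longrightarrow> p < q \<Longrightarrow> q \<le> r \<Longrightarrow> mu_minor r m p q \<in> wt r 2"
proof -
  assume pq: "1 \<le> p" "p < q" "q \<le> r"
  have "tu (r - h - 1) (h - 1) * m (p + q - 1 - h) \<in> forms 2 ((r - 2) + r)" if "h \<in> {p..<q}" for h
    using that pq by (intro forms_mult tu_forms m_forms) auto
  moreover have "r dvd (r - 2) + r + 2"
  proof -
    have "(r - 2) + r + 2 = r * 2" using r2 by simp
    then show ?thesis by (simp only: dvd_triv_left)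
  qed
  ultimately show ?thesis
    unfolding mu_minor_def tu_def[symmetric] by (intro wt_sum) (blast intro: forms_wt)
qed

lemma l_wt: "i \<in> {1..<r} \<Longrightarrow> l i \<in> wt r 2"
proof -
  assume i: "i \<in> {1..<r}"
  have "r - 2 + 2 = r" using r2 by simp
  then show ?thesis using forms_wt[OF l_forms[OF i], of r 2] by (simp only: dvd_refl)
qed

text \<open>On \<open>J\<close> this is the conormal map, freed of the factor \<open>t^r\<close>
  that made the vector field polynomial; \<open>mu_J\<close> supplies the divisibility.\<close>

definition mu :: "'k mpoly \<Rightarrow> 'k mpoly" where "mu F = divt r (\<delta> F)"

lemma mu_J:
  assumes "F \<in> J"
  shows "mu F \<in> wt r 2" "\<delta> F = tu r 0 * mu F"
proof -
  obtain a b where *: "F = comb a b" "\<forall>p q. a p q \<in> polys N" "\<forall>i. b i \<in> polys N"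
    using assms unfolding J_def by blast
  have w: "mu_comb a b \<in> wt r 2"
    unfolding mu_comb_def using *(2,3) \<pi>_wt mu_minor_wt l_wt
    by (intro wt_add wt_sum wt_mult) auto
  then have "mu F = mu_comb a b"
    unfolding mu_def *(1) \<delta>_comb by (intro divt_mult) (simp add: wt_def)
  then show "mu F \<in> wt r 2" "\<delta> F = tu r 0 * mu F" using w \<delta>_comb * by simp_all
qed

lemma mu_mult: "F \<in> J \<Longrightarrow> mu (G * F) = \<pi> G * mu F"
proof -
  assume F: "F \<in> J"
  have "\<delta> (G * F) = tu r 0 * (\<pi> G * mu F)" using \<pi>_J[OF F] mu_J(2)[OF F] by (simp add: mult.left_commute)
  moreover have "\<pi> G * mu F \<in> polys 2" using mu_J(1)[OF F] \<pi>_polys by (simp add: wt_def polys_mult)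
  ultimately show ?thesis by (simp add: mu_def divt_mult)
qed

lemma mu_simps [simp]: "mu 0 = 0" "mu (F + G) = mu F + mu G" "mu (F - G) = mu F - mu G"
  by (simp_all add: mu_def)

lemma J_mu_I: "F \<in> J \<Longrightarrow> mu F = 0 \<Longrightarrow> F \<in> I"
  unfolding I_def using \<pi>_J J_polys mu_J(2)[of F] by simp

lemma mu_Const: "F \<in> J \<Longrightarrow> mu (Const c * F) = Const c * mu F"
  using mu_mult[of F "Const c"] by simp

text \<open>
  The values \<open>tu \<rho> (\<sigma> \<rho>)\<close> for \<open>\<rho> < r\<close> form a basis over \<open>K[t\<^sup>r, u\<^sup>r]\<close> of the canonical module
  of the curve, the forms of degree congruent to \<open>-2\<close> modulo \<open>r\<close>; \<open>z \<rho>\<close> is a preimage.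
\<close>

definition \<sigma> :: "nat \<Rightarrow> nat" where "\<sigma> \<rho> = (if \<rho> = r - 1 then r - 1 else r - 2 - \<rho>)"

text \<open>Degree of the form \<open>z \<rho>\<close>, fixed by the relation
  \<open>\<rho> + \<sigma> \<rho> + 2 = r * dz \<rho>\<close>.\<close>

definition dz :: "nat \<Rightarrow> nat" where "dz \<rho> = (if \<rho> = r - 1 then 2 else 1)"

text \<open>The forms of degree \<open>r - 2\<close> in two variables have dimension
  \<open>r - 1\<close>, the number of the \<open>l i\<close>; in the absence of a syzygy of degree
  \<open>0\<close> the \<open>l i\<close> are therefore a basis.\<close>

lemma l_span: "tu \<rho> (r - 2 - \<rho>) \<in> mpoly.span (l ` {1..<r})" "inj_on l {1..<r}" if "\<rho> \<le> r - 2"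
proof -
  let ?Z = "(\<lambda>i. tu i (r - 2 - i)) ` {..r - 2} :: 'k mpoly set"
  have 2: "(\<Sum>k\<in>{1..<r}. Const (c k) * l k) = 0 \<Longrightarrow> \<forall>k\<in>{1..<r}. c k = 0" for c by (rule l_indep)
  have "card ?Z \<le> card {..r - 2}" by (rule card_image_le) simp
  then have 3: "finite ?Z" "card ?Z \<le> card {1..<r}" using r2 by simp_all
  have 4: "l k \<in> mpoly.span ?Z" if "k \<in> {1..<r}" for k
    by (subst forms2_eq_sum[OF l_forms[OF that]]) (intro mpoly.span_sum mpoly.span_scale mpoly.span_base; simp)
  show "inj_on l {1..<r}" using family_span(2)[of "{1..<r}" l ?Z] 2 3 4 by simp
  have "?Z \<subseteq> mpoly.span (l ` {1..<r})" using family_span(3)[of "{1..<r}" l ?Z] 2 3 4 by simp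
  then show "tu \<rho> (r - 2 - \<rho>) \<in> mpoly.span (l ` {1..<r})" using that by auto
qed

lemma z_exists_linear:
  assumes "\<rho> \<le> r - 2"
  shows "\<exists>z. z \<in> J \<and> z \<in> forms N 1 \<and> \<delta> z = tu r 0 * tu \<rho> (r - 2 - \<rho>)"
proof -
  obtain c where c: "tu \<rho> (r - 2 - \<rho>) = (\<Sum>i\<in>{1..<r}. Const (c i) * l i)"
    using span_family_obtain[OF _ l_span[OF assms]] by blast
  define z where "z = (\<Sum>i\<in>{1..<r}. Const (c i) * y (r + i))"
  have J_sum: "sum h S \<in> J" if "\<And>i. i \<in> S \<Longrightarrow> h i \<in> J" for h and S :: "nat set"
    using that by (induction S rule: infinite_finite_induct) (auto intro: JD)
  have "z \<in> J" unfolding z_def by (intro J_sum JD(4) y_J) auto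
  moreover have "z \<in> forms N 1" unfolding z_def by (intro forms_sum forms_Const_mult y_forms) auto
  moreover have "\<delta> z = tu r 0 * tu \<rho> (r - 2 - \<rho>)"
    unfolding z_def c sum_distrib_left by (simp, intro sum.cong refl) (auto simp: \<delta>_y vfield_def mult.left_commute)
  ultimately show ?thesis by blast
qed

lemma z_exists: "\<rho> < r \<Longrightarrow> \<exists>z. z \<in> J \<and> z \<in> forms N (dz \<rho>) \<and> \<delta> z = tu r 0 * tu \<rho> (\<sigma> \<rho>)"
proof (cases "\<rho> = r - 1")
  case False
  moreover assume "\<rho> < r"
  ultimately show ?thesis using z_exists_linear[of \<rho>] by (simp add: dz_def \<sigma>_def)
next
  case True
  \<comment> \<open>The top generator \<open>t^(r-1) u^(r-1)\<close> is \<open>t^(r-1) u\<close>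
    times \<open>u^(r-2)\<close>, so it is reached by \<open>y 1\<close> times a linear lift of
    \<open>u^(r-2)\<close>.\<close>
  obtain z where z: "z \<in> J" "z \<in> forms N 1" "\<delta> z = tu r 0 * tu 0 (r - 2)" using z_exists_linear[of 0] by auto
  have y1: "1 < N" "1 \<le> r" using r2 by auto
  have "y 1 * z \<in> J" by (rule JD(4)[OF y_polys[OF y1(1)] z(1)])
  moreover have "y 1 * z \<in> forms N 2" using forms_mult[OF y_forms[OF y1(1)] z(2)] by simp
  moreover have "\<delta> (y 1 * z) = tu r 0 * tu (r - 1) (r - 1)"
  proof -
    have "\<delta> (y 1 * z) = tu (r - 1) 1 * (tu r 0 * tu 0 (r - 2))"
      using y1 by (simp add: \<pi>_J[OF z(1)] z(3) \<pi>_y)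
    also have "\<dots> = tu r 0 * tu (r - 1 + 0) (1 + (r - 2))"
      by (simp only: tu_mult add_0_right add_0_left ac_simps)
    also have "1 + (r - 2) = r - 1" using r2 by simp
    finally show ?thesis by simp
  qed
  ultimately show ?thesis using True by (auto simp: dz_def \<sigma>_def)
qed

definition z :: "nat \<Rightarrow> 'k mpoly" where
  "z \<rho> = (SOME z. z \<in> J \<and> z \<in> forms N (dz \<rho>) \<and> \<delta> z = tu r 0 * tu \<rho> (\<sigma> \<rho>))"

lemma z_properties:
  assumes "\<rho> < r"
  shows "z \<rho> \<in> J" "z \<rho> \<in> forms N (dz \<rho>)" "mu (z \<rho>) = tu \<rho> (\<sigma> \<rho>)" "z \<rho> \<in> polys N"
proof -
  have *: "z \<rho> \<in> J \<and> z \<rho> \<in> forms N (dz \<rho>) \<and> \<delta> (z \<rho>) = tu r 0 * tu \<rho> (\<sigma> \<rho>)"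
    unfolding z_def by (rule someI_ex[OF z_exists[OF assms]])
  then show "z \<rho> \<in> J" "z \<rho> \<in> forms N (dz \<rho>)" "z \<rho> \<in> polys N" using formsD by blast+
  show "mu (z \<rho>) = tu \<rho> (\<sigma> \<rho>)" using * by (simp only: mu_def divt_mult tu_polys)
qed

text \<open>A residue: the coordinate of the conormal value at \<open>t^(r-1) u^(r-1)\<close>, taken
  after \<open>nf\<close> has removed the part over the Veronese basis.\<close>

definition \<phi> :: "'k mpoly \<Rightarrow> 'k mpoly" where "\<phi> F = ext r (r - 1) (r - 1) (mu (nf F))"

definition ee :: "nat \<Rightarrow> 'k mpoly" where "ee k = (if k < r then e1 k else z (k - r))"

text \<open>The sum makes the pairing vanish between two elements \<open>y i\<close>, \<open>y j\<close>.\<close>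

definition es :: "nat \<Rightarrow> 'k mpoly" where
  "es k = (if k = 0 then z (r - 1) else if k < r then z (k - 1) else if k = 2 * r - 1 then 1
     else y (k - r + 1) - (\<Sum>j\<in>{1..<r}. emb (\<phi> (y (k - r + 1) * y j)) * z (j - 1)))"

lemma \<phi>_add: "\<phi> (F + G) = \<phi> F + \<phi> G" and \<phi>_diff: "\<phi> (F - G) = \<phi> F - \<phi> G"
  by (simp_all add: \<phi>_def)

lemma \<phi>_0 [simp]: "\<phi> 0 = 0" using \<phi>_diff[of 0 0] by simp

lemma \<phi>_Const: "F \<in> polys N \<Longrightarrow> \<phi> (Const c * F) = Const c * \<phi> F"
  by (simp add: \<phi>_def mu_Const nf_J)

lemma \<phi>_sum: "\<phi> (sum h S) = (\<Sum>i\<in>S. \<phi> (h i))"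
  by (induction S rule: infinite_finite_induct) (simp_all add: \<phi>_add)

lemma \<phi>_y:
  assumes "F \<in> polys N"
  shows "\<phi> (y 0 * F) = Var 0 * \<phi> F" "\<phi> (y r * F) = Var 1 * \<phi> F"
proof -
  have *: "\<pi> (y 0) = Var 0 ^ r" "\<pi> (y r) = Var 1 ^ r" using \<pi>_y[OF yN(1)] \<pi>_y[OF yN(2)] by (simp_all add: tu_def)
  show "\<phi> (y 0 * F) = Var 0 * \<phi> F" "\<phi> (y r * F) = Var 1 * \<phi> F"
    by (simp_all add: \<phi>_def nf_y mu_mult nf_J[OF assms] * ext_Var[OF r0])
qed

lemma \<phi>_emb:
  assumes "p \<in> polys 2" "F \<in> polys N"
  shows "\<phi> (emb p * F) = p * \<phi> F"
  using assms(1)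
  by (induction p rule: Var01_induct)
    (simp_all add: assms(2) \<phi>_Const \<phi>_y \<phi>_add distrib_right mult.assoc polys_mult emb_polys)

lemma \<phi>_J: "F \<in> J \<Longrightarrow> \<phi> F = ext r (r - 1) (r - 1) (mu F)"
  by (simp add: \<phi>_def nf_id \<pi>_J)

lemma \<phi>_e1: "k < r \<Longrightarrow> \<phi> (e1 k) = 0"
  by (simp add: \<phi>_def nf_e1)

lemma \<phi>_z: "\<rho> < r \<Longrightarrow> F \<in> polys N \<Longrightarrow> \<phi> (F * z \<rho>) = ext r (r - 1) (r - 1) (\<pi> F * tu \<rho> (\<sigma> \<rho>))"
  using \<phi>_J[OF JD(4)[OF _ z_properties(1)]] mu_mult[OF z_properties(1)] z_properties(3) by simp

lemma \<phi>_z_J: "\<rho> < r \<Longrightarrow> F \<in> J \<Longrightarrow> \<phi> (F * z \<rho>) = 0"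
  using \<phi>_z J_polys \<pi>_J by simp

text \<open>Exponents modulo \<open>r\<close> have to reach \<open>(r - 1, r - 1)\<close>. Starting
  from \<open>t^(r-k) u^k\<close> with \<open>k > 0\<close> this happens only for
  \<open>\<rho> = k - 1\<close>, and starting from \<open>1\<close> only for
  \<open>\<rho> = r - 1\<close>. The residue thus makes the bases of Veronese ring and canonical
  module dual, up to a cyclic shift of the index.\<close>

lemma \<phi>_e1_z:
  assumes "k < r" "\<rho> < r"
  shows "\<phi> (e1 k * z \<rho>) = (if \<rho> = (if k = 0 then r - 1 else k - 1) then 1 else 0)"
proof (cases "k = 0")
  case True
  have "\<phi> (e1 k * z \<rho>) = ext r (r - 1) (r - 1) (tu \<rho> (\<sigma> \<rho>))"
    using \<phi>_z[OF assms(2) e1_polys[OF assms(1)]] \<pi>_e1[OF assms(1)] True by simp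
  moreover have "\<sigma> \<rho> = r - 1" if "\<rho> = r - 1" using that by (simp add: \<sigma>_def)
  ultimately show ?thesis using True assms(2) r0 by (cases "\<rho> = r - 1") (simp_all add: ext_tu)
next
  case False
  have *: "\<phi> (e1 k * z \<rho>) = ext r (r - 1) (r - 1) (tu (r - k + \<rho>) (k + \<sigma> \<rho>))"
    using \<phi>_z[OF assms(2) e1_polys[OF assms(1)]] \<pi>_e1[OF assms(1)] False by (simp add: tu_mult)
  show ?thesis
  proof (cases "\<rho> = k - 1")
    case True
    have "r - k + \<rho> = r - 1" "k + \<sigma> \<rho> = r - 1" using True False assms by (auto simp: \<sigma>_def)
    then show ?thesis using * True False r2 by (simp add: ext_tu)
  next
    case ne: False
    \<comment> \<open>The first exponent decides: it reduces to \<open>\<rho> - k\<close> with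
      \<open>k > 0\<close>, or is itself below \<open>r - 1\<close>.\<close>
    have "(r - k + \<rho>) mod r \<noteq> r - 1"
    proof (cases "k \<le> \<rho>")
      case True
      then have eq: "r - k + \<rho> = r + (\<rho> - k)" using assms by simp
      have "(r - k + \<rho>) mod r = \<rho> - k" unfolding eq using assms by simp
      then show ?thesis using True False assms by simp
    next
      case False
      then have "r - k + \<rho> < r - 1" using ne assms by simp
      then show ?thesis by simp
    qed
    then show ?thesis using * ne False by (simp add: ext_tu)
  qed
qed

lemma ee_polys: "k < 2 * r \<Longrightarrow> ee k \<in> polys N"
  by (auto simp: ee_def e1_polys z_properties)

lemma es_polys: "k < 2 * r \<Longrightarrow> es k \<in> polys N"
  using r2 by (auto simp: es_def intro!: z_properties polys_diff y_polys polys_sum polys_mult emb_polys)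

lemma \<phi>_polys [simp]: "\<phi> F \<in> polys 2" by (simp add: \<phi>_def)

text \<open>In block form, the pairing of the \<open>e1 k\<close> with the \<open>z \<rho>\<close>
  is the residue pairing, that of two \<open>z\<close> is zero because the pullback kills
  \<open>J\<close>, and that of two coordinates \<open>y j\<close> is uncontrolled; the correction
  in \<open>es\<close> clears the last block.\<close>

lemma dual:
  assumes "k < 2 * r" "i < 2 * r"
  shows "\<phi> (ee k * es i) = (if k = i then 1 else 0)"
proof -
  have ez: "\<phi> (ee k * z \<rho>) = (if k < r \<and> \<rho> = (if k = 0 then r - 1 else k - 1) then 1 else 0)" if "\<rho> < r" for \<rho>
    using \<phi>_e1_z[of k \<rho>] \<phi>_z_J[OF that, of "z (k - r)"] z_properties(1)[of "k - r"] that assms(1) by (auto simp: ee_def)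
  consider "i = 0" | "0 < i" "i < r" | "i = 2 * r - 1" | "r \<le> i" "i < 2 * r - 1" using assms(2) by linarith
  then show ?thesis
  proof cases
    case 1
    then show ?thesis using ez[of "r - 1"] r2 by (auto simp: es_def)
  next
    case 2
    then show ?thesis using ez[of "i - 1"] by (auto simp: es_def)
  next
    case 3
    have e: "es i = 1" using 3 r2 by (simp add: es_def)
    show ?thesis
    proof (cases "k < r")
      case True
      then show ?thesis using e \<phi>_e1[of k] 3 r2 by (auto simp: ee_def)
    next
      case False
      then show ?thesis using e \<phi>_e1_z[of 0 "k - r"] 3 r2 assms(1) by (auto simp: ee_def e1_def)
    qed
  next
    case 4
    \<comment> \<open>The partner of \<open>z \<rho>\<close> for \<open>\<rho> < r - 1\<close> is
      \<open>y (\<rho> + 1)\<close>; as \<open>i = r + \<rho>\<close>, this has index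
      \<open>i - r + 1\<close>.\<close>
    define j0 where "j0 = i - r + 1"
    have j0: "1 \<le> j0" "j0 < r" "j0 < N" using 4 by (auto simp: j0_def)
    have "es i = y j0 - (\<Sum>j\<in>{1..<r}. emb (\<phi> (y j0 * y j)) * z (j - 1))"
      using 4 r2 by (simp add: es_def j0_def)
    then have "ee k * es i = ee k * y j0 - (\<Sum>j\<in>{1..<r}. emb (\<phi> (y j0 * y j)) * (ee k * z (j - 1)))"
      by (simp only: right_diff_distrib sum_distrib_left mult.left_commute)
    then have "\<phi> (ee k * es i) = \<phi> (ee k * y j0) - (\<Sum>j\<in>{1..<r}. \<phi> (emb (\<phi> (y j0 * y j)) * (ee k * z (j - 1))))"
      by (simp only: \<phi>_diff \<phi>_sum)
    also have "(\<Sum>j\<in>{1..<r}. \<phi> (emb (\<phi> (y j0 * y j)) * (ee k * z (j - 1)))) = (\<Sum>j\<in>{1..<r}. \<phi> (y j0 * y j) * \<phi> (ee k * z (j - 1)))"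
      using ee_polys[OF assms(1)] z_properties(4) by (intro sum.cong refl \<phi>_emb polys_mult) auto
    also have "\<dots> = (\<Sum>j\<in>{1..<r}. if j = k then \<phi> (y j0 * y k) else 0)"
    proof (intro sum.cong refl)
      fix j assume j: "j \<in> {1..<r}"
      have "k < r \<and> j - 1 = (if k = 0 then r - 1 else k - 1) \<longleftrightarrow> j = k"
        using j by (cases "k = 0") auto
      then show "\<phi> (y j0 * y j) * \<phi> (ee k * z (j - 1)) = (if j = k then \<phi> (y j0 * y k) else 0)"
        using ez[of "j - 1"] less_imp_diff_less[of j r 1] j by simp
    qed
    also have "\<dots> = (if k \<in> {1..<r} then \<phi> (y j0 * y k) else 0)" by simp
    finally have *: "\<phi> (ee k * es i) = \<phi> (ee k * y j0) - (if k \<in> {1..<r} then \<phi> (y j0 * y k) else 0)" .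
    consider "k = 0" | "k \<in> {1..<r}" | "r \<le> k" by (cases "k = 0"; cases "k < r") (auto simp: One_nat_def Suc_le_eq)
    then show ?thesis
    proof cases
      case 1
      then show ?thesis using * \<phi>_e1[of j0] j0 4 r2 by (simp add: ee_def e1_def)
    next
      case 2
      then show ?thesis using * 4 by (simp add: ee_def e1_def mult.commute)
    next
      case 3
      have "\<phi> (ee k * y j0) = \<phi> (e1 j0 * z (k - r))" using 3 j0 by (simp add: ee_def e1_def mult.commute)
      also have "\<dots> = (if k = i then 1 else 0)"
        using \<phi>_e1_z[of j0 "k - r"] j0 3 assms(1) 4 by (auto simp: j0_def)
      finally show ?thesis using * 3 by simp
    qed
  qed
qed

definition cd :: "'k mpoly \<Rightarrow> nat \<Rightarrow> 'k mpoly" where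
  "cd F k = (if k < r then \<kappa> k (\<pi> F) else ext r (k - r) (\<sigma> (k - r)) (mu (nf F)))"

lemma cd_polys [simp]: "cd F k \<in> polys 2" by (simp add: cd_def)

text \<open>Removing the coordinates over \<open>e1\<close> leaves \<open>nf F\<close>, whose
  conormal value lies in the canonical module and is used up by the \<open>z \<rho>\<close>. The
  remainder lies in \<open>J\<close> and has value zero, hence it lies in \<open>I\<close>.\<close>

lemma cd_span:
  assumes "F \<in> polys N"
  shows "F - (\<Sum>k<2 * r. emb (cd F k) * ee k) \<in> I"
proof -
  define q where "q \<rho> = ext r \<rho> (\<sigma> \<rho>) (mu (nf F))" for \<rho>
  have G: "nf F \<in> J" by (rule nf_J[OF assms])
  have *: "(\<Sum>k<2 * r. emb (cd F k) * ee k) = (\<Sum>k<r. emb (\<kappa> k (\<pi> F)) * e1 k) + (\<Sum>\<rho><r. emb (q \<rho>) * z \<rho>)"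
    unfolding mult_2 sum_lessThan_add by (simp add: cd_def ee_def q_def)
  then have eq: "F - (\<Sum>k<2 * r. emb (cd F k) * ee k) = nf F - (\<Sum>\<rho><r. emb (q \<rho>) * z \<rho>)"
    by (simp add: nf_def)
  have J_sum: "sum h S \<in> J" if "\<And>i. i \<in> S \<Longrightarrow> h i \<in> J" for h and S :: "nat set"
    using that by (induction S rule: infinite_finite_induct) (auto intro: JD)
  have s: "(\<Sum>\<rho><r. emb (q \<rho>) * z \<rho>) \<in> J"
    by (intro J_sum JD(4)[OF emb_polys] z_properties(1)) simp
  have mu_sum: "mu (sum h S) = (\<Sum>i\<in>S. mu (h i))" for h and S :: "nat set"
    by (induction S rule: infinite_finite_induct) simp_all
  have "mu (\<Sum>\<rho><r. emb (q \<rho>) * z \<rho>) = (\<Sum>\<rho><r. pow_subst r (q \<rho>) * tu \<rho> (\<sigma> \<rho>))"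
    unfolding mu_sum by (intro sum.cong refl) (simp add: mu_mult z_properties \<pi>_emb q_def)
  also have "\<dots> = mu (nf F)"
    unfolding q_def \<sigma>_def by (rule wt2_decomposition[OF r2 mu_J(1)[OF G], symmetric])
  finally have "mu (nf F - (\<Sum>\<rho><r. emb (q \<rho>) * z \<rho>)) = 0" unfolding mu_simps by simp
  with J_diff[OF G s] show ?thesis unfolding eq by (rule J_mu_I)
qed

lemma frobenius: "frobenius_ring N I (y 0) (y r) (2 * r) ee es \<phi>"
proof (intro frobenius_ring.intro homogeneous_coordinate_ring.intro I_ideal frobenius_ring_axioms.intro)
  show "y 0 \<in> polys N" "y r \<in> polys N" using y_polys yN by auto
  show "\<phi> F = 0" if "F \<in> I" for F
    using that by (simp add: I_def \<phi>_def nf_id mu_def)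
  show "\<exists>p. (\<forall>k<2 * r. p k \<in> polys 2) \<and> F - (\<Sum>k<2 * r. emb (p k) * ee k) \<in> I" if "F \<in> polys N" for F
    using cd_span[OF that] by (intro exI[of _ "cd F"]) simp
qed (simp_all add: ee_polys es_polys \<phi>_add \<phi>_Const \<phi>_y dual)

end

section \<open>The Hilbert function\<close>

lemma finite_monomials: "finite {m :: nat \<Rightarrow>\<^sub>0 nat. Poly_Mapping.keys m \<subseteq> {..<n} \<and> mdeg m = d}"
proof -
  let ?h = "\<lambda>f. \<Sum>i<n. Poly_Mapping.single i (f i)"
  have "{m. Poly_Mapping.keys m \<subseteq> {..<n} \<and> mdeg m = d} \<subseteq> ?h ` ({..<n} \<rightarrow>\<^sub>E {..d})"
  proof
    fix m :: "nat \<Rightarrow>\<^sub>0 nat" assume "m \<in> {m. Poly_Mapping.keys m \<subseteq> {..<n} \<and> mdeg m = d}"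
    then have m: "Poly_Mapping.keys m \<subseteq> {..<n}" "mdeg m = d" by auto
    have le: "Poly_Mapping.lookup m i \<le> d" for i
    proof (cases "i \<in> Poly_Mapping.keys m")
      case True
      then show ?thesis using member_le_sum[of i "Poly_Mapping.keys m" "Poly_Mapping.lookup m"] m(2) by simp
    qed (simp add: in_keys_iff)
    have "m = (\<Sum>i\<in>Poly_Mapping.keys m. Poly_Mapping.single i (Poly_Mapping.lookup m i))" by (rule sum_single_lookup)
    also have "\<dots> = (\<Sum>i<n. Poly_Mapping.single i (Poly_Mapping.lookup m i))"
      using m(1) by (intro sum.mono_neutral_left) (auto simp: in_keys_iff)
    also have "\<dots> = ?h (restrict (Poly_Mapping.lookup m) {..<n})" by (intro sum.cong refl) simp
    finally have "m = ?h (restrict (Poly_Mapping.lookup m) {..<n})" .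
    then show "m \<in> ?h ` ({..<n} \<rightarrow>\<^sub>E {..d})" by (rule image_eqI[of m ?h]) (use le in \<open>auto split: if_splits\<close>)
  qed
  then show ?thesis by (rule finite_subset) (intro finite_imageI finite_PiE; simp)
qed

lemma forms_in_span: "forms n d \<subseteq> mpoly.span ((\<lambda>m. Poly_Mapping.single m 1) ` {m. Poly_Mapping.keys m \<subseteq> {..<n} \<and> mdeg m = d})"
proof
  fix F :: "'k::field mpoly" assume F: "F \<in> forms n d"
  have "F = (\<Sum>m\<in>Poly_Mapping.keys F. Const (Poly_Mapping.lookup F m) * Poly_Mapping.single m 1)"
    using sum_single_lookup[of F] by (simp add: Const_mult_single)
  also have "\<dots> \<in> mpoly.span ((\<lambda>m. Poly_Mapping.single m 1) ` {m. Poly_Mapping.keys m \<subseteq> {..<n} \<and> mdeg m = d})"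
    using F by (intro mpoly.span_sum mpoly.span_scale mpoly.span_base) (auto simp: forms_def polys_def)
  finally show "F \<in> mpoly.span ((\<lambda>m. Poly_Mapping.single m 1) ` {m. Poly_Mapping.keys m \<subseteq> {..<n} \<and> mdeg m = d})" .
qed

lemma subspace_forms: "mpoly.subspace (forms n d :: 'k::field mpoly set)"
  by (rule mpoly.subspaceI) (auto intro: forms_add forms_Const_mult)

text \<open>The \<open>b x\<close> complete a basis of \<open>U\<close> to one of \<open>V\<close>.
  Spanning and independence are asked modulo \<open>U\<close> and for an indexed family, which is
  the form in which a free basis of the quotient ring provides them.\<close>

lemma dim_modulo_subspace:
  fixes V U :: "'k::field mpoly set"
  assumes V: "mpoly.subspace V" "V \<subseteq> mpoly.span W" "finite W" and U: "mpoly.subspace U" "U \<subseteq> V"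
    and X: "finite X" "\<And>x. x \<in> X \<Longrightarrow> b x \<in> V"
    and span: "\<And>v. v \<in> V \<Longrightarrow> \<exists>c. v - (\<Sum>x\<in>X. Const (c x) * b x) \<in> U"
    and indep: "\<And>c. (\<Sum>x\<in>X. Const (c x) * b x) \<in> U \<Longrightarrow> \<forall>x\<in>X. c x = 0"
  shows "mpoly.dim V = mpoly.dim U + card X"
proof -
  obtain B where B: "B \<subseteq> U" "mpoly.independent B" "U \<subseteq> mpoly.span B" "card B = mpoly.dim U"
    using mpoly.basis_exists[of U] by blast
  have finB: "finite B" using mpoly.independent_span_bound[OF V(3) B(2)] B(1) U(2) V(2) by blast
  have spanB: "mpoly.span B \<subseteq> U" by (rule mpoly.span_minimal[OF B(1) U(1)])
  have inj: "inj_on b X"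
    by (rule family_span(2)[OF X(1) _ finite_imageI[OF X(1), of b] card_image_le[OF X(1)]])
      (use indep mpoly.subspace_0[OF U(1)] in \<open>auto intro: mpoly.span_base\<close>)
  have notU: "b x \<notin> U" if x: "x \<in> X" for x
  proof
    assume bU: "b x \<in> U"
    have "(\<Sum>x'\<in>X. Const (if x' = x then 1 else 0) * b x') = (\<Sum>x'\<in>X. if x' = x then b x' else 0)"
      by (intro sum.cong refl) simp
    also have "\<dots> = b x" using X(1) x by simp
    finally show False using indep[of "\<lambda>x'. if x' = x then 1 else 0"] bU x by auto
  qed
  have disj: "B \<inter> b ` X = {}" using notU B(1) by blast
  have sumU: "(\<Sum>v\<in>B. Const (f v) * v) \<in> U" for f
    by (rule subsetD[OF spanB]) (intro mpoly.span_sum mpoly.span_scale mpoly.span_base)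
  have ind: "mpoly.independent (B \<union> b ` X)"
  proof (rule mpoly.independent_if_scalars_zero)
    fix f v assume s: "(\<Sum>v\<in>B \<union> b ` X. Const (f v) * v) = 0" and v: "v \<in> B \<union> b ` X"
    have "(\<Sum>v\<in>B. Const (f v) * v) + (\<Sum>x\<in>X. Const (f (b x)) * b x) = 0"
      using s finB X(1) disj by (simp add: sum.union_disjoint sum.reindex[OF inj])
    then have eq: "(\<Sum>x\<in>X. Const (f (b x)) * b x) = - (\<Sum>v\<in>B. Const (f v) * v)" by (simp add: eq_neg_iff_add_eq_0 add.commute)
    have "(\<Sum>x\<in>X. Const (f (b x)) * b x) \<in> U" unfolding eq by (rule mpoly.subspace_neg[OF U(1) sumU])
    then have z: "\<forall>x\<in>X. f (b x) = 0" by (rule indep)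
    then have "(\<Sum>v\<in>B. Const (f v) * v) = 0" using eq by simp
    then have "f v = 0" if "v \<in> B" for v
      using mpoly.independentD[OF B(2) finB subset_refl] that by blast
    then show "f v = 0" using v z by auto
  qed (use finB X(1) in simp)
  have "V \<subseteq> mpoly.span (B \<union> b ` X)"
  proof
    fix v assume "v \<in> V"
    then obtain c where c: "v - (\<Sum>x\<in>X. Const (c x) * b x) \<in> U" using span by blast
    have "v - (\<Sum>x\<in>X. Const (c x) * b x) \<in> mpoly.span (B \<union> b ` X)"
      using c B(3) mpoly.span_mono[of B "B \<union> b ` X"] by blast
    moreover have "(\<Sum>x\<in>X. Const (c x) * b x) \<in> mpoly.span (B \<union> b ` X)"
      by (intro mpoly.span_sum mpoly.span_scale mpoly.span_base) simp
    ultimately show "v \<in> mpoly.span (B \<union> b ` X)" using mpoly.span_add by fastforce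
  qed
  moreover have "B \<union> b ` X \<subseteq> V" using B(1) U(2) X(2) by blast
  ultimately have "mpoly.dim V = card (B \<union> b ` X)" using mpoly.basis_card_eq_dim[OF _ _ ind] by metis
  also have "\<dots> = mpoly.dim U + card X"
    using card_Un_disjoint[OF finB _ disj] X(1) card_image[OF inj] B(4) by simp
  finally show ?thesis .
qed

lemma divt_forms: "f \<in> forms 2 (r + d) \<Longrightarrow> f = tu r 0 * g \<Longrightarrow> g \<in> polys 2 \<Longrightarrow> divt r f \<in> forms 2 d"
proof -
  assume f: "f \<in> forms 2 (r + d)" "f = tu r 0 * g" "g \<in> polys 2"
  have "mdeg m = d" if m: "m \<in> Poly_Mapping.keys g" for m
  proof -
    have "Poly_Mapping.lookup (tu r 0 * g) (Poly_Mapping.single 0 r + m) = Poly_Mapping.lookup g m" for g :: "'a mpoly"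
    proof (induction g rule: mpoly_induct)
      case (single n c)
      show ?case by (simp add: tu_single mult_single lookup_single when_def)
    qed (simp_all add: distrib_left lookup_add)
    then have "Poly_Mapping.single 0 r + m \<in> Poly_Mapping.keys f" using m by (simp add: f(2) in_keys_iff)
    then have "mdeg (Poly_Mapping.single 0 r + m) = r + d" using f(1) by (auto simp: forms_def)
    then show ?thesis unfolding mdeg_add mdeg_single by simp
  qed
  then have "g \<in> forms 2 d" using f(3) by (simp add: forms_def)
  then show ?thesis using divt_mult[OF f(3), of r] f(2) by simp
qed

section \<open>Degrees of jets and coordinates, Hilbert function and nondegeneracy\<close>

context rnc_double
begin

text \<open>The excess \<open>r - 2\<close> of the derivative is the difference between the degree
  \<open>2 r - 2\<close> of the vector field and the degree \<open>r\<close> of a coordinate of the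
  curve.\<close>

definition jet_forms :: "nat \<Rightarrow> 'k mpoly poly set" where
  "jet_forms d = {p. coeff p 0 \<in> forms 2 (r * d) \<and> coeff p 1 \<in> forms 2 (r * d + (r - 2))}"

lemma jet_forms_mult: "p \<in> jet_forms a \<Longrightarrow> q \<in> jet_forms b \<Longrightarrow> p * q \<in> jet_forms (a + b)"
proof -
  assume "p \<in> jet_forms a" "q \<in> jet_forms b"
  then have *: "coeff p 0 \<in> forms 2 (r * a)" "coeff p 1 \<in> forms 2 (r * a + (r - 2))"
    "coeff q 0 \<in> forms 2 (r * b)" "coeff q 1 \<in> forms 2 (r * b + (r - 2))" by (auto simp: jet_forms_def)
  have "coeff (p * q) 0 = coeff p 0 * coeff q 0" "coeff (p * q) 1 = coeff p 0 * coeff q 1 + coeff p 1 * coeff q 0"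
    by (simp_all add: coeff_mult One_nat_def)
  moreover have "coeff p 0 * coeff q 0 \<in> forms 2 (r * (a + b))"
    using forms_mult[OF *(1,3)] by (simp add: distrib_left)
  moreover have "coeff p 0 * coeff q 1 \<in> forms 2 (r * (a + b) + (r - 2))"
    using forms_mult[OF *(1,4)] by (simp add: distrib_left add_ac)
  moreover have "coeff p 1 * coeff q 0 \<in> forms 2 (r * (a + b) + (r - 2))"
    using forms_mult[OF *(2,3)] by (simp add: distrib_left add_ac)
  ultimately show ?thesis by (simp add: jet_forms_def forms_add)
qed

lemma one_jet_forms: "1 \<in> jet_forms 0"
  by (simp add: jet_forms_def One_nat_def)

lemma vlin_Var_forms: "i < N \<Longrightarrow> vlin (Var i) \<in> forms 2 (2 * r - 2)"
proof -
  assume "i < N"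
  then obtain c where "Var i = (\<Sum>k<N. Const (c k) * y k)" by (rule Var_eq_sum_y)
  then show ?thesis by (simp add: vlin) (intro forms_sum forms_Const_mult vfield_forms; simp)
qed

lemma jet_forms: "F \<in> forms N d \<Longrightarrow> jet F \<in> jet_forms d"
proof -
  assume F: "F \<in> forms N d"
  have V: "[:rnc_param r e i, vlin (Var i):] \<in> jet_forms 1" if "i < N" for i
  proof -
    have "r + (r - 2) = 2 * r - 2" using r2 by simp
    then show ?thesis using rnc_param_forms vlin_Var_forms[OF that] by (simp add: jet_forms_def One_nat_def)
  qed
  have Vp: "[:rnc_param r e i, vlin (Var i):] ^ k \<in> jet_forms k" if "i < N" for i k
  proof (induction k)
    case (Suc k)
    then show ?case using jet_forms_mult[OF V[OF that] Suc] by (simp only: power_Suc plus_1_eq_Suc)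
  qed (simp add: one_jet_forms)
  have prod: "(\<Prod>i\<in>A. [:rnc_param r e i, vlin (Var i):] ^ f i) \<in> jet_forms (sum f A)" if "finite A" "A \<subseteq> {..<N}" for A f
    using that by (induction A rule: finite_induct) (auto intro!: one_jet_forms jet_forms_mult Vp)
  have scale: "dual_coeff c * p \<in> jet_forms d" if "p \<in> jet_forms d" for c p
    using that by (simp add: jet_forms_def dual_coeff_def forms_Const_mult)
  have monomial: "meval (\<lambda>i. [:rnc_param r e i, vlin (Var i):]) m \<in> jet_forms d" if "m \<in> Poly_Mapping.keys F" for m
    using prod[of "Poly_Mapping.keys m" "Poly_Mapping.lookup m"] F that by (auto simp: meval_def forms_def polys_def)
  have sum: "sum h S \<in> jet_forms d" if "\<And>i. i \<in> S \<Longrightarrow> h i \<in> jet_forms d" for h and S :: "(nat \<Rightarrow>\<^sub>0 nat) set"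
    using that by (auto simp: jet_forms_def coeff_sum intro!: forms_sum)
  show ?thesis unfolding jet_def lin_def by (intro sum scale monomial)
qed

lemma \<pi>_forms: "F \<in> forms N d \<Longrightarrow> \<pi> F \<in> forms 2 (r * d)"
  and \<delta>_forms: "F \<in> forms N d \<Longrightarrow> \<delta> F \<in> forms 2 (r * d + (r - 2))"
  using jet_forms[of F d] by (auto simp: jet_forms_def \<delta>_def coeff_0_jet)

lemma emb_forms: "p \<in> forms 2 d \<Longrightarrow> emb p \<in> forms N d"
proof -
  assume p: "p \<in> forms 2 d"
  have "emb (tu i j) \<in> forms N (i + j)" for i j
    using forms_mult[OF forms_power[OF y_forms[OF yN(1)], of i] forms_power[OF y_forms[OF yN(2)], of j]]
    by (simp add: tu_def)
  then have "emb (tu i (d - i)) \<in> forms N d" if "i \<le> d" for i using that by (metis le_add_diff_inverse)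
  moreover have "emb (sum h S) = (\<Sum>i\<in>S. emb (h i))" for h and S :: "nat set"
    unfolding bisubst_def by (rule subst_sum)
  ultimately show ?thesis
    by (subst forms2_eq_sum[OF p]) (auto intro!: forms_sum forms_Const_mult)
qed

definition dg :: "nat \<Rightarrow> nat" where "dg k = (if k = 0 then 0 else if k < r then 1 else dz (k - r))"

lemma ee_forms: "k < 2 * r \<Longrightarrow> ee k \<in> forms N (dg k)"
  using y_forms z_properties(2)[of "k - r"] r2 by (auto simp: ee_def dg_def e1_def)

lemma dg_le: "dg k \<le> 2" by (simp add: dg_def dz_def)

text \<open>Coordinates of a form are forms of complementary degree. Since
  \<open>dg k \<le> 2\<close>, the bound \<open>2 \<le> d\<close> keeps \<open>d - dg k\<close> from
  being truncated.\<close>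

lemma cd_forms:
  assumes F: "F \<in> forms N d" and d: "2 \<le> d" and k: "k < 2 * r"
  shows "cd F k \<in> forms 2 (d - dg k)"
proof -
  have \<kappa>: "\<kappa> k (\<pi> F) \<in> forms 2 (d - (if k = 0 then 0 else 1))" if "k < r" for k
  proof (cases "k = 0")
    case True
    then show ?thesis using ext_forms[OF \<pi>_forms[OF F] _ r0, of d 0 0] by (simp add: \<kappa>_def)
  next
    case False
    obtain d' where "d = d' + 1" using d by (metis add_leD2 le_add_diff_inverse2 one_add_one)
    then have "r * d = r * (d - 1) + (r - k) + k" using that by (simp add: distrib_left)
    then show ?thesis using ext_forms[OF \<pi>_forms[OF F] _ r0, of "d - 1" "r - k" k] False by (simp add: \<kappa>_def)
  qed
  show ?thesis
  proof (cases "k < r")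
    case True
    then show ?thesis using \<kappa>[OF True] by (cases "k = 0") (simp_all add: cd_def dg_def)
  next
    case False
    have "emb (\<kappa> k (\<pi> F)) * e1 k \<in> forms N d" if "k < r" for k
      using forms_mult[OF emb_forms[OF \<kappa>[OF that]], of "e1 k" "if k = 0 then 0 else 1"] y_forms[of k] that d r2
      by (auto simp: e1_def split: if_splits)
    then have nf: "nf F \<in> forms N d" unfolding nf_def by (intro forms_diff F forms_sum) auto
    have rd: "r * d + (r - 2) = r + (r * d - 2)" using d r2 mult_le_mono[OF r2 d] by simp
    have nJ: "nf F \<in> J" by (rule nf_J[OF formsD[OF F]])
    have muf: "mu (nf F) \<in> forms 2 (r * d - 2)"
      unfolding mu_def by (rule divt_forms[OF \<delta>_forms[OF nf, unfolded rd] mu_J(2)[OF nJ]])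
        (use mu_J(1)[OF nJ] in \<open>simp add: wt_def\<close>)
    \<comment> \<open>The degree \<open>r * d - 2\<close> of the conormal value differs from that of
      \<open>t^\<rho> u^\<sigma>\<close> by a multiple of \<open>r\<close>, by the relation that
      fixes \<open>dz\<close>.\<close>
    have rd2: "r * d - 2 = r * (d - dg k) + (k - r) + \<sigma> (k - r)"
    proof (cases "k - r = r - 1")
      case True
      obtain d' where d': "d = d' + 2" using d by (metis le_add_diff_inverse2)
      show ?thesis using True False r2 k by (simp add: dg_def dz_def \<sigma>_def d' distrib_left)
    next
      case ne: False
      obtain d' where d': "d = d' + 1" using d by (metis add_leD2 le_add_diff_inverse2 one_add_one)
      show ?thesis using ne False r2 k by (simp add: dg_def dz_def \<sigma>_def d' distrib_left)
    qed
    show ?thesis using ext_forms[OF muf rd2 r0] by (simp only: cd_def False if_False)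
  qed
qed

text \<open>A generator of degree \<open>dg k\<close> contributes the \<open>d - dg k + 1\<close>
  monomials in \<open>y 0\<close> and \<open>y r\<close> of complementary degree. The sum is
  \<open>(d + 1) + (2 r - 2) d + (d - 1) = 2 r d\<close>.\<close>

lemma hilbert_function_I:
  assumes d: "2 \<le> d"
  shows "hilbert_function N I d = 2 * r * d"
proof -
  interpret F: frobenius_ring N I "y 0" "y r" "2 * r" ee es \<phi> by (rule frobenius)
  define X where "X = (SIGMA k:{..<2 * r}. {..d - dg k})"
  define b where "b x = emb (tu (snd x) (d - dg (fst x) - snd x)) * ee (fst x)" for x
  have dgd: "dg k \<le> d" for k using dg_le[of k] d by simp
  have sum_X: "(\<Sum>x\<in>X. Const (c x) * b x) = (\<Sum>k<2 * r. emb (\<Sum>i\<le>d - dg k. Const (c (k, i)) * tu i (d - dg k - i)) * ee k)" for c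
  proof -
    have emb_sum: "emb (sum h S) = (\<Sum>i\<in>S. emb (h i))" for h and S :: "nat set"
      unfolding bisubst_def by (rule subst_sum)
    have "(\<Sum>x\<in>X. Const (c x) * b x) = (\<Sum>(k, i)\<in>X. Const (c (k, i)) * b (k, i))"
      by (intro sum.cong refl) auto
    also have "\<dots> = (\<Sum>k<2 * r. \<Sum>i\<le>d - dg k. Const (c (k, i)) * b (k, i))"
      unfolding X_def by (rule sum.Sigma[symmetric]) auto
    finally show ?thesis by (simp add: emb_sum sum_distrib_right b_def mult.assoc)
  qed
  have "mpoly.dim (forms N d :: 'k mpoly set) = mpoly.dim (I \<inter> forms N d) + card X"
  proof (rule dim_modulo_subspace)
    show "mpoly.subspace (forms N d :: 'k mpoly set)" by (rule subspace_forms)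
    show "forms N d \<subseteq> mpoly.span ((\<lambda>m. Poly_Mapping.single m 1) ` {m. Poly_Mapping.keys m \<subseteq> {..<N} \<and> mdeg m = d} :: 'k mpoly set)"
      by (rule forms_in_span)
    show "finite ((\<lambda>m. Poly_Mapping.single m 1) ` {m. Poly_Mapping.keys m \<subseteq> {..<N} \<and> mdeg m = d} :: 'k mpoly set)"
      by (intro finite_imageI finite_monomials)
    have "mpoly.subspace I" by (rule mpoly.subspaceI) (use is_idealD[OF I_ideal] in auto)
    then show "mpoly.subspace (I \<inter> forms N d)" by (rule mpoly.subspace_inter) (rule subspace_forms)
    show "finite X" by (simp add: X_def)
    show bV: "b x \<in> forms N d" if "x \<in> X" for x
    proof -
      obtain k i where x: "x = (k, i)" by (cases x)
      then have "k < 2 * r" "i + (d - dg k - i) = d - dg k" "d - dg k + dg k = d"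
        using that dgd[of k] by (auto simp: X_def)
      then show ?thesis
        using forms_mult[OF emb_forms[OF tu_forms] ee_forms, of i "d - dg k - i" "d - dg k" k] by (simp add: x b_def)
    qed
    show "\<exists>c. v - (\<Sum>x\<in>X. Const (c x) * b x) \<in> I \<inter> forms N d" if v: "v \<in> forms N d" for v
    proof -
      define c where "c x = Poly_Mapping.lookup (cd v (fst x)) (Poly_Mapping.single 0 (snd x) + Poly_Mapping.single 1 (d - dg (fst x) - snd x))" for x
      have "(\<Sum>x\<in>X. Const (c x) * b x) = (\<Sum>k<2 * r. emb (cd v k) * ee k)"
        unfolding sum_X
      proof (intro sum.cong refl)
        fix k assume "k \<in> {..<2 * r}"
        then have "cd v k \<in> forms 2 (d - dg k)" using cd_forms[OF v d] by simp
        from forms2_eq_sum[OF this]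
        show "emb (\<Sum>i\<le>d - dg k. Const (c (k, i)) * tu i (d - dg k - i)) * ee k = emb (cd v k) * ee k"
          by (simp add: c_def)
      qed
      then have "v - (\<Sum>x\<in>X. Const (c x) * b x) \<in> I" using cd_span[OF formsD[OF v]] by simp
      moreover have "v - (\<Sum>x\<in>X. Const (c x) * b x) \<in> forms N d"
        by (intro forms_diff v forms_sum forms_Const_mult bV)
      ultimately show ?thesis by blast
    qed
    show "\<forall>x\<in>X. c x = 0" if c: "(\<Sum>x\<in>X. Const (c x) * b x) \<in> I \<inter> forms N d" for c
    proof clarify
      fix k i assume ki: "(k, i) \<in> X"
      define P where "P k = (\<Sum>i\<le>d - dg k. Const (c (k, i)) * tu i (d - dg k - i))" for k
      have P: "P k \<in> polys 2" for k unfolding P_def by (intro polys_sum polys_mult) simp_all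
      have k: "k < 2 * r" "i \<le> d - dg k" using ki by (auto simp: X_def)
      have "(\<Sum>k'<2 * r. emb (P k') * ee k') \<in> I" using c unfolding sum_X P_def by simp
      \<comment> \<open>Multiplying by the dual element \<open>es k\<close> and applying
        \<open>\<phi>\<close> isolates the coefficient form \<open>P k\<close>.\<close>
      then have "\<phi> (es k * (\<Sum>k'<2 * r. emb (P k') * ee k')) = 0"
        using F.\<phi>_I is_idealD(4)[OF I_ideal es_polys[OF k(1)]] by blast
      moreover have "es k * (\<Sum>k'<2 * r. emb (P k') * ee k') = (\<Sum>k'<2 * r. emb (P k') * (ee k' * es k))"
        by (simp add: sum_distrib_left mult_ac)
      moreover have "\<phi> (\<Sum>k'<2 * r. emb (P k') * (ee k' * es k)) = (\<Sum>k'<2 * r. if k' = k then P k' else 0)"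
        unfolding \<phi>_sum using k(1) by (intro sum.cong refl) (simp add: \<phi>_emb P polys_mult ee_polys es_polys dual)
      ultimately have "P k = 0" using k(1) by simp
      then have "Poly_Mapping.lookup (P k) (Poly_Mapping.single 0 i + Poly_Mapping.single 1 (d - dg k - i)) = 0" by simp
      moreover have "Poly_Mapping.lookup (P k) (Poly_Mapping.single 0 i + Poly_Mapping.single 1 (d - dg k - i)) =
        (\<Sum>i'\<le>d - dg k. if i' = i then c (k, i') else 0)"
        unfolding P_def lookup_sum lookup_Const_mult lookup_tu by (intro sum.cong refl) auto
      ultimately show "c (k, i) = 0" using k(2) by simp
    qed
  qed simp_all
  moreover have "card X = 2 * r * d"
  proof -
    have "card X = (\<Sum>k<r + r. d - dg k + 1)" by (simp add: X_def mult_2 Suc_eq_plus1)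
    also have "\<dots> = (\<Sum>k<r. if k = 0 then d + 1 else d) + (\<Sum>k<r. if k = r - 1 then d - 1 else d)"
      unfolding sum_lessThan_add using d by (intro arg_cong2[of _ _ _ _ "(+)"] sum.cong refl) (auto simp: dg_def dz_def)
    also have "\<dots> = (\<Sum>k<r. d) + (\<Sum>k<r. d)"
    proof -
      have "(\<Sum>k<r. if k = 0 then d + 1 else d) = (\<Sum>k<r. d + (if k = 0 then 1 else 0))" by (intro sum.cong refl) simp
      also have "\<dots> = (\<Sum>k<r. d) + 1" using r2 by (simp add: sum.distrib)
      finally have 1: "(\<Sum>k<r. if k = 0 then d + 1 else d) = (\<Sum>k<r. d) + 1" .
      have "(\<Sum>k<r. if k = r - 1 then d - 1 else d) + 1 = (\<Sum>k<r. if k = r - 1 then d - 1 else d) + (\<Sum>k<r. if k = r - 1 then 1 else 0)"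
        using r2 by simp
      also have "\<dots> = (\<Sum>k<r. d)" unfolding sum.distrib[symmetric] using d by (intro sum.cong refl) auto
      finally show ?thesis using 1 by linarith
    qed
    finally show ?thesis by simp
  qed
  ultimately show ?thesis by (simp add: hilbert_function_def)
qed

text \<open>A linear form vanishing on the curve involves only the coordinates
  \<open>y (r + i)\<close>, because the \<open>t^(r-k) u^k\<close> are independent. On these the
  derivation is \<open>t^r\<close> times the same combination of the \<open>l i\<close>, whose
  independence makes the form zero: the thickening leaves the span of the curve in all remaining
  directions.\<close>

lemma nondegenerate_I: "nondegenerate N I"
  unfolding nondegenerate_def
proof (intro ballI impI notI)
  fix h assume h: "h \<in> forms N 1" "h \<noteq> 0" "h \<in> I"
  obtain a where a: "h = (\<Sum>i<N. Const (a i) * Var i)" using forms_1_eq_sum[OF h(1)] .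
  have "h \<in> mpoly.span (y ` {..<N})"
    unfolding a using y_basis(3) by (intro mpoly.span_sum mpoly.span_scale) auto
  then obtain c where c: "h = (\<Sum>k<N. Const (c k) * y k)"
    using span_family_obtain[OF finite_lessThan _ y_basis(2)] by blast
  have N: "N = Suc r + (r - 1)" using r2 by simp
  have "\<pi> h = (\<Sum>k<N. Const (c k) * \<pi> (y k))" by (simp add: c)
  also have "\<dots> = (\<Sum>k<Suc r. Const (c k) * tu (r - k) k)"
    using r2 by (intro sum.mono_neutral_cong_right) (auto simp: \<pi>_y)
  finally have s: "(\<Sum>k<Suc r. Const (c k) * tu (r - k) k) = 0" using h(3) by (simp add: I_def)
  have c1: "c k = 0" if "k \<le> r" for k
  proof -
    have "0 = Poly_Mapping.lookup (\<Sum>k<Suc r. Const (c k) * tu (r - k) k) (Poly_Mapping.single 0 (r - k) + Poly_Mapping.single 1 k)"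
      using s by simp
    also have "\<dots> = (\<Sum>k'<Suc r. if k' = k then c k' else 0)"
      unfolding lookup_sum lookup_Const_mult lookup_tu by (intro sum.cong refl) auto
    also have "\<dots> = c k" using that by (subst sum.delta) auto
    finally show ?thesis ..
  qed
  have "\<delta> h = (\<Sum>k<N. Const (c k) * vfield k)" by (simp add: c \<delta>_y)
  also have "\<dots> = (\<Sum>k\<in>{Suc r..<N}. Const (c k) * vfield k)"
    using c1 by (intro sum.mono_neutral_right) auto
  also have "\<dots> = (\<Sum>i\<in>{1..<r}. Const (c (r + i)) * vfield (r + i))"
    by (rule sum.reindex_bij_witness[of _ "\<lambda>i. r + i" "\<lambda>k. k - r"]) auto
  also have "\<dots> = tu r 0 * (\<Sum>i\<in>{1..<r}. Const (c (r + i)) * l i)"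
    unfolding sum_distrib_left by (intro sum.cong refl) (simp add: vfield_def mult.left_commute)
  finally have "(\<Sum>i\<in>{1..<r}. Const (c (r + i)) * l i) = 0" using h(3) by (simp add: I_def)
  then have c2: "\<forall>i\<in>{1..<r}. c (r + i) = 0" by (rule l_indep)
  have "c k = 0" if "k < N" for k
  proof (cases "k \<le> r")
    case False
    then have "k - r \<in> {1..<r}" "r + (k - r) = k" using that by auto
    then show ?thesis using c2 by metis
  qed (rule c1)
  then have "h = 0" unfolding c by (intro sum.neutral) auto
  then show False using h(2) by simp
qed

end

theorem theorem4p6:
  fixes r :: nat
    and e :: "nat \<Rightarrow> nat \<Rightarrow> 'k::{alg_closed_field, field_char_0}"
    and y m l :: "nat \<Rightarrow> 'k mpoly"
  assumes "r \<ge> 2"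
    and "linear_embedding r (2*r) e"
    and "adapted_coordinates r e y"
    and "\<forall>i\<in>{1..<r}. m i \<in> forms 2 r"
    and "\<forall>i\<in>{1..<r}. l i \<in> forms 2 (r - 2)"
    and no_degree_0_syzygy:
      "\<forall>c. (\<Sum>i\<in>{1..<r}. Const (c i) * l i) = 0 \<longrightarrow> (\<forall>i\<in>{1..<r}. c i = 0)"
  shows "curve_of_degree_genus (2*r) (double_structure r e y m l) (2*r) 1 \<and>
         nondegenerate (2*r) (double_structure r e y m l) \<and>
         arithmetically_gorenstein (2*r) (double_structure r e y m l)"
proof -
  interpret rnc_double r e y m l
    using assms by unfold_locales auto
  interpret F: frobenius_ring "2 * r" I "y 0" "y r" "2 * r" ee es \<phi> by (rule frobenius)
  \<comment> \<open>The Hilbert function is \<open>2 r d\<close> from degree \<open>2\<close> on,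
    and the missing constant term is \<open>1 - g\<close> with \<open>g = 1\<close>.\<close>
  have "curve_of_degree_genus (2 * r) I (2 * r) 1"
    unfolding curve_of_degree_genus_def has_hilbert_polynomial_def
    using hilbert_function_I assms(1) by (auto intro!: exI[of _ 2])
  then show ?thesis
    unfolding double_structure_eq arithmetically_gorenstein_def
    using nondegenerate_I F.gorenstein_A by blast
qed

end
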